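(* Let $X$ be a complex Banach space of finite cotype such that $X^*$ has the Gaussian Average Property (GAP), and fix $q>\cot(X)$. There is a constant $C\ge1$ such that for all $m,n\in\mathbb{N}$ and every choice of vectors $\{x_\alpha\}_{\alpha\in\mathbb{N}_0^n,|\alpha|\le m}\subseteq X$, \[ \Big(\mathbb{E}\Big\|\sum_{|\alpha|\le m}x_\alpha w^\alpha\Big\|^q\Big)^{1/q}\le C\Big(\mathbb{E}\Big\|\sum_{|\alpha|\le m}\varepsilon_{i_\alpha}\sqrt{\tfrac q2}^{\,|\alpha|}x_\alpha\Big\|^2\Big)^{1/2}. \]
   Context: $w^\alpha=w_1^{\alpha_1}\cdots w_n^{\alpha_n}$, $w$ a vector of independent Steinhaus (uniform on the unit circle) variables; $\{\varepsilon_{i_\alpha}\}_\alpha$ independent Rademacher variables, one per multi-index $\alpha$ with $|\alpha|\le m$. $\cot(X)$ is the infimum of $q\in[2,\infty)$ with $(\sum_i\|x_i\|^q)^{1/q}\le C(\mathbb{E}\|\sum_i x_i\varepsilon_i\|^q)^{1/q}$ for all finite families. $\pi_1(S)$ is the $1$-summing norm: least $C$ with $\sum_i\|Sy_i\|\le C\sup_{y^*\in B_{Y^*}}\sum_i|y^*(y_i)|$. A Banach space $Y$ has GAP if there is $C\ge1$ such that for all $y_1,\dots,y_n\in Y$, with $T:\ell_2^n\to Y$, $T(e_i)=y_i$, $(\mathbb{E}\|\sum_iy_i\gamma_i\|^2)^{1/2}\le C\pi_1(T^* )$, $\gamma_i$ independent standard complex gaussians. *)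

theory Defs
  imports "HOL-Probability.Probability"
begin

text \<open>A complex Banach space is modelled as a real Banach space type together with
  a complex scalar multiplication extending the real one.\<close>

definition complex_structure :: "(complex \<Rightarrow> 'a::banach \<Rightarrow> 'a) \<Rightarrow> bool" where
  "complex_structure smul \<longleftrightarrow>
     (\<forall>r x. smul (complex_of_real r) x = r *\<^sub>R x) \<and>
     (\<forall>a b x. smul (a * b) x = smul a (smul b x)) \<and>
     (\<forall>a b x. smul (a + b) x = smul a x + smul b x) \<and>
     (\<forall>a x y. smul a (x + y) = smul a x + smul a y) \<and>
     (\<forall>a x. norm (smul a x) = cmod a * norm x)"

text \<open>Normed complex spaces given concretely (carrier, addition, scalar multiplication, norm),
  so that iterated duals can be formed.\<close>

record 'v cspace =
  carr :: "'v set"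
  vadd :: "'v \<Rightarrow> 'v \<Rightarrow> 'v"
  vsmul :: "complex \<Rightarrow> 'v \<Rightarrow> 'v"
  vnorm :: "'v \<Rightarrow> real"

definition space_of :: "(complex \<Rightarrow> 'a::banach \<Rightarrow> 'a) \<Rightarrow> 'a cspace" where
  "space_of smul = \<lparr>carr = UNIV, vadd = (+), vsmul = smul, vnorm = norm\<rparr>"

definition dual :: "'v cspace \<Rightarrow> ('v \<Rightarrow> complex) cspace" where
  "dual S = \<lparr>carr = {f. (\<forall>x\<in>carr S. \<forall>y\<in>carr S. f (vadd S x y) = f x + f y) \<and>
                         (\<forall>c. \<forall>x\<in>carr S. f (vsmul S c x) = c * f x) \<and>
                         (\<exists>K. \<forall>x\<in>carr S. cmod (f x) \<le> K * vnorm S x) \<and>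
                         (\<forall>x. x \<notin> carr S \<longrightarrow> f x = 0)},
             vadd = (\<lambda>f g x. f x + g x),
             vsmul = (\<lambda>c f x. c * f x),
             vnorm = (\<lambda>f. SUP x\<in>{x\<in>carr S. vnorm S x \<le> 1}. cmod (f x))\<rparr>"

definition weak_l1 :: "'v cspace \<Rightarrow> (nat \<Rightarrow> 'v) \<Rightarrow> nat \<Rightarrow> real" where
  "weak_l1 Z z k = (SUP \<phi>\<in>{\<phi>\<in>carr (dual Z). vnorm (dual Z) \<phi> \<le> 1}. \<Sum>j<k. cmod (\<phi> (z j)))"

text \<open>1-summing norm of an operator S on Z, S given through z \<mapsto> norm (S z).\<close>
definition pi1 :: "'v cspace \<Rightarrow> ('v \<Rightarrow> real) \<Rightarrow> real" where
  "pi1 Z Snorm = Inf {C. 0 \<le> C \<and> (\<forall>k (z::nat \<Rightarrow> 'v). (\<forall>j<k. z j \<in> carr Z) \<longrightarrow>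
                        (\<Sum>j<k. Snorm (z j)) \<le> C * weak_l1 Z z k)}"

definition cgauss :: "complex measure" where
  "cgauss = density lborel (\<lambda>z. ennreal (exp (- (cmod z)\<^sup>2) / pi))"

text \<open>GAP for a space Y whose elements are complex functions (e.g. a dual space), with
  pointwise linear structure. For T : l_2^n \<rightarrow> Y, T e_i = y_i, the adjoint
  T* : Y* \<rightarrow> l_2^n is z \<mapsto> (z (y_i))_i.\<close>
definition has_GAP :: "('b \<Rightarrow> complex) cspace \<Rightarrow> bool" where
  "has_GAP Y \<longleftrightarrow> (\<exists>C\<ge>1. \<forall>n (y :: nat \<Rightarrow> 'b \<Rightarrow> complex). (\<forall>i<n. y i \<in> carr Y) \<longrightarrow>
      sqrt (\<integral>\<gamma>. (vnorm Y (\<lambda>b. \<Sum>i<n. \<gamma> i * y i b))\<^sup>2 \<partial>(PiM {..<n} (\<lambda>_. cgauss)))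
        \<le> C * pi1 (dual Y) (\<lambda>z. sqrt (\<Sum>i<n. (cmod (z (y i)))\<^sup>2)))"

definition rad_exp :: "'i set \<Rightarrow> (('i \<Rightarrow> real) \<Rightarrow> real) \<Rightarrow> real" where
  "rad_exp I F = (\<Sum>\<epsilon>\<in>PiE I (\<lambda>_. {-1, 1}). F \<epsilon>) / 2 ^ card I"

definition has_cotype :: "real \<Rightarrow> ('a::real_normed_vector) itself \<Rightarrow> bool" where
  "has_cotype q _ \<longleftrightarrow> (\<exists>C. \<forall>N (x :: nat \<Rightarrow> 'a).
      (\<Sum>i<N. norm (x i) powr q) powr (1/q)
        \<le> C * (rad_exp {..<N} (\<lambda>\<epsilon>. norm (\<Sum>i<N. \<epsilon> i *\<^sub>R x i) powr q)) powr (1/q))"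

definition cotype_set :: "('a::real_normed_vector) itself \<Rightarrow> real set" where
  "cotype_set t = {q. 2 \<le> q \<and> has_cotype q t}"

definition cot :: "('a::real_normed_vector) itself \<Rightarrow> real" where
  "cot t = Inf (cotype_set t)"

definition multi_idx :: "nat \<Rightarrow> nat \<Rightarrow> (nat \<Rightarrow> nat) set" where
  "multi_idx n m = {\<alpha>. (\<forall>i\<ge>n. \<alpha> i = 0) \<and> sum \<alpha> {..<n} \<le> m}"

definition mon :: "nat \<Rightarrow> (nat \<Rightarrow> nat) \<Rightarrow> (nat \<Rightarrow> complex) \<Rightarrow> complex" where
  "mon n \<alpha> w = (\<Prod>i<n. w i ^ \<alpha> i)"

definition steinhaus_exp :: "nat \<Rightarrow> ((nat \<Rightarrow> complex) \<Rightarrow> real) \<Rightarrow> real" where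
  "steinhaus_exp n F = (\<integral>\<theta>. F (\<lambda>i. cis (\<theta> i))
       \<partial>(PiM {..<n} (\<lambda>_. uniform_measure lborel {0..2*pi})))"

end

theory Submission
  imports Defs "HOL-Complex_Analysis.Complex_Analysis" "HOL-Library.Function_Algebras"
    "HOL-Real_Asymp.Real_Asymp" "HOL-Computational_Algebra.Fundamental_Theorem_Algebra"
begin

text \<open>Let \<open>f\<close> be the polynomial on the left, \<open>\<rho> = sqrt (2 / q)\<close>, and test \<open>f\<close> against
  \<open>g = |f|\<^bsup>q-1\<^esup> \<phi>\<close> with \<open>\<phi>\<close> norming. With \<open>z\<^sub>\<alpha> = \<rho>\<^bsup>-|\<alpha>|\<^esup> x\<^sub>\<alpha>\<close> and \<open>y\<^sub>\<alpha> = \<rho>\<^bsup>|\<alpha>|\<^esup> \<integral> w\<^bsup>\<alpha>\<^esup> g\<close> this gives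
  \<open>\<parallel>f\<parallel>\<^sub>q\<^bsup>q\<^esup> = \<Sum>\<^sub>\<alpha> y\<^sub>\<alpha>(z\<^sub>\<alpha>)\<close>, and trace duality bounds the sum by the product of the Gaussian averages of
  the \<open>z\<^sub>\<alpha>\<close> in \<open>X\<close> and of the \<open>y\<^sub>\<alpha>\<close> in the dual. Finite cotype dominates the former by a Rademacher
  average, and GAP dominates the latter by the \<open>1\<close>-summing norm of \<open>z \<mapsto> (z(y\<^sub>\<alpha>))\<^sub>\<alpha>\<close> on the bidual. For a
  functional \<open>z\<close>, the \<open>\<ell>\<^sub>2\<close> norm of \<open>(z(y\<^sub>\<alpha>))\<^sub>\<alpha>\<close> is at most the \<open>L\<^bsub>q'\<^esub>\<close> norm of \<open>z \<circ> g\<close>, by the dual of the scalar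
  inequality \<open>\<parallel>\<Sum>\<^sub>\<alpha> c\<^sub>\<alpha> \<rho>\<^bsup>|\<alpha>|\<^esup> w\<^bsup>\<alpha>\<^esup>\<parallel>\<^sub>q \<le> (\<Sum>\<^sub>\<alpha> |c\<^sub>\<alpha>|\<^sup>2)\<^bsup>1/2\<^esup>\<close>, and a Maurey factorization, available since
  \<open>q\<close> exceeds the cotype, shows that \<open>z \<mapsto> \<parallel>z \<circ> g\<parallel>\<^bsub>q'\<^esub>\<close> is \<open>1\<close>-summing with constant
  \<open>C \<parallel>g\<parallel>\<^bsub>q'\<^esub> = C \<parallel>f\<parallel>\<^sub>q\<^bsup>q-1\<^esup>\<close>. The scalar inequality is Weissler's; it follows from a logarithmic Sobolev inequality
  for analytic functions, which rests on a comparison of the Dirichlet energies of \<open>|K|\<^sup>2\<close> and \<open>K\<^sup>2\<close>.\<close>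

section \<open>Logarithmic Sobolev inequality for analytic functions\<close>

text \<open>The weight \<open>sqrt (q / 2)\<close> dictates the scalar route. On all trigonometric
  polynomials the Poisson semigroup maps L_2 contractively into L_q only up to the radius
  \<open>(q - 1) powr (- 1 / 2)\<close>, which is below \<open>sqrt (2 / q)\<close> for q > 2.
  Analyticity supplies the difference: once its zeros are reflected out of the disc, a polynomial
  has a logarithm, all its powers are analytic, and the differential inequality at every exponent
  reduces to a single inequality for |K|^4. On the vector side the obstacle is that X is not assumed
  K-convex, so the coefficients of g cannot be controlled by projecting g onto a Rademacher or
  Gaussian subspace. GAP trades that projection for a 1-summing norm, but this norm is tested on the
  bidual, whereas cotype is known for X; hence the summing estimate is first proved for tuples of X
  and then carried over. Gaussians enter because GAP is stated with them, and they are exchanged for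
  signs only on the side of X, where cotype is available.\<close>

definition circ :: "(complex \<Rightarrow> complex) \<Rightarrow> complex" where
  "circ f = integral {0..2*pi} (\<lambda>t. f (cis t)) / (2*pi)"

lemma circ_integrable:
  fixes f :: "complex \<Rightarrow> complex"
  assumes "continuous_on (sphere 0 1) f"
  shows "(\<lambda>t. f (cis t)) integrable_on {0..2*pi}"
proof (rule integrable_continuous_interval)
  have "continuous_on {0..2*pi} cis" by (intro continuous_intros)
  then show "continuous_on {0..2*pi} (\<lambda>t. f (cis t))"
    by (rule continuous_on_compose2[OF assms]) auto
qed

lemma circ_add:
  assumes "continuous_on (sphere 0 1) f" "continuous_on (sphere 0 1) g"
  shows "circ (\<lambda>z. f z + g z) = circ f + circ g"
  unfolding circ_def by (simp add: integral_add[OF circ_integrable[OF assms(1)] circ_integrable[OF assms(2)]] add_divide_distrib)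

lemma circ_mult_left: "circ (\<lambda>z. c * f z) = c * circ f"
  by (cases "c = 0") (simp_all add: circ_def)

lemma circ_sum:
  assumes "finite I" "\<And>i. i \<in> I \<Longrightarrow> continuous_on (sphere 0 1) (f i)"
  shows "circ (\<lambda>z. \<Sum>i\<in>I. f i z) = (\<Sum>i\<in>I. circ (f i))"
  unfolding circ_def
  by (subst integral_sum[OF assms(1)]) (auto intro: circ_integrable assms simp: sum_divide_distrib)

lemma circ_cnj: "circ (\<lambda>z. cnj (f z)) = cnj (circ f)"
  by (simp add: circ_def integral_cnj)

lemma circ_cong: "(\<And>z. cmod z = 1 \<Longrightarrow> f z = g z) \<Longrightarrow> circ f = circ g"
  unfolding circ_def by (intro arg_cong2[of _ _ _ _ "(/)"] integral_cong) auto

lemma circ_const: "circ (\<lambda>z. c) = c"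
  by (simp add: circ_def scaleR_conv_of_real)

lemma has_vector_derivative_cis: "(cis has_vector_derivative \<i> * cis t) (at t within S)"
  unfolding has_vector_derivative_complex_iff
  by (auto intro!: derivative_eq_intros)

lemma circ_monom: "circ (\<lambda>z. z ^ i * cnj z ^ j) = (if i = j then 1 else 0)"
proof (cases "i = j")
  case True
  have "circ (\<lambda>z. z ^ i * cnj z ^ i) = circ (\<lambda>z. 1)"
    by (intro circ_cong) (simp flip: power_mult_distrib add: complex_norm_square[symmetric])
  then show ?thesis using True by (simp add: circ_const)
next
  case False
  define k :: real where "k = real i - real j"
  have k: "k \<noteq> 0" using False by (simp add: k_def)
  have eq: "cis t ^ i * cnj (cis t) ^ j = cis (k * t)" for t
    by (simp add: Complex.DeMoivre cis_cnj cis_mult k_def algebra_simps)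
  have "((\<lambda>t. cis (k * t)) has_integral (cis (k * (2*pi)) / (\<i> * k) - cis (k * 0) / (\<i> * k))) {0..2*pi}"
  proof (rule fundamental_theorem_of_calculus)
    fix t
    have "((\<lambda>t. cis (k * t) / (\<i> * k)) has_vector_derivative (k *\<^sub>R (\<i> * cis (k * t)) / (\<i> * k))) (at t within {0..2*pi})"
    proof -
      have "((\<lambda>t. cis (k * t)) has_vector_derivative (k *\<^sub>R (\<i> * cis (k * t)))) (at t within {0..2*pi})"
        using vector_diff_chain_within[of "\<lambda>t. k * t" k t "{0..2*pi}" cis "\<i> * cis (k * t)"]
          has_vector_derivative_cis
          has_vector_derivative_mult_right[OF has_vector_derivative_id, of k "at t within {0..2*pi}"]
        by (simp add: o_def)
      then show ?thesis
        by (rule has_vector_derivative_divide)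
    qed
    then show "((\<lambda>t. cis (k * t) / (\<i> * k)) has_vector_derivative cis (k * t)) (at t within {0..2*pi})"
      using k by (simp add: scaleR_conv_of_real field_simps)
  qed simp
  moreover have "cis (k * (2*pi)) = 1"
    using cis_multiple_2pi[of k] by (simp add: k_def algebra_simps)
  ultimately have "integral {0..2*pi} (\<lambda>t. cis (k * t)) = 0"
    by (auto dest!: integral_unique)
  with False show ?thesis by (simp add: circ_def eq)
qed

section \<open>Analytic polynomials on the circle: inner product, Euler operator, energy\<close>

definition pinner :: "complex poly \<Rightarrow> complex poly \<Rightarrow> complex" where
  "pinner P Q = (\<Sum>n\<le>degree P. coeff P n * cnj (coeff Q n))"

lemma pinner_eq: "degree P \<le> N \<Longrightarrow> pinner P Q = (\<Sum>n\<le>N. coeff P n * cnj (coeff Q n))"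
  unfolding pinner_def by (rule sum.mono_neutral_left) (auto simp: coeff_eq_0)

lemma poly_eqI_forall: "(\<And>x. poly P x = poly Q x) \<Longrightarrow> P = Q" for P Q :: "complex poly"
  by (simp add: poly_eq_poly_eq_iff[symmetric] fun_eq_iff)

lemma poly_eq_sum: "degree P \<le> N \<Longrightarrow> poly P z = (\<Sum>n\<le>N. coeff P n * z ^ n)"
  for P :: "complex poly"
  unfolding poly_altdef by (rule sum.mono_neutral_left) (auto simp: coeff_eq_0)

lemma circ_pinner: "circ (\<lambda>z. poly P z * cnj (poly Q z)) = pinner P Q"
proof -
  let ?N = "max (degree P) (degree Q)"
  have "circ (\<lambda>z. poly P z * cnj (poly Q z)) =
      circ (\<lambda>z. \<Sum>i\<le>?N. \<Sum>j\<le>?N. (coeff P i * cnj (coeff Q j)) * (z ^ i * cnj z ^ j))"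
    by (simp add: poly_eq_sum[of P ?N] poly_eq_sum[of Q ?N] sum_product mult_ac)
  also have "\<dots> = (\<Sum>i\<le>?N. \<Sum>j\<le>?N. (coeff P i * cnj (coeff Q j)) * (if i = j then 1 else 0))"
    by (subst circ_sum; (intro continuous_intros)?; simp?)
       (intro sum.cong refl, subst circ_sum; (intro continuous_intros)?; simp add: circ_mult_left circ_monom)
  also have "\<dots> = pinner P Q"
    by (simp add: pinner_eq[of P ?N] sum.delta' if_distrib cong: if_cong)
  finally show ?thesis .
qed

lemma circ_poly: "circ (poly P) = coeff P 0"
proof -
  have "pinner P 1 = (\<Sum>n\<le>degree P. if n = 0 then coeff P n else 0)"
    unfolding pinner_def by (intro sum.cong) (auto simp: coeff_1)
  then show ?thesis using circ_pinner[of P 1] by (simp add: sum.delta)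
qed

lemma pinner_add_left: "pinner (P + Q) R = pinner P R + pinner Q R"
proof -
  let ?N = "max (degree P) (degree Q)"
  have "degree (P + Q) \<le> ?N" by (rule degree_add_le_max)
  then show ?thesis by (simp add: pinner_eq[of _ ?N] algebra_simps sum.distrib)
qed

lemma pinner_cnj: "pinner Q P = cnj (pinner P Q)"
proof -
  let ?N = "max (degree P) (degree Q)"
  show ?thesis by (simp add: pinner_eq[of _ ?N] mult.commute)
qed

lemma pinner_add_right: "pinner R (P + Q) = pinner R P + pinner R Q"
  by (simp add: pinner_cnj[of R] pinner_add_left)

lemma pinner_smult_left: "pinner (smult c P) R = c * pinner P R"
  by (cases "c = 0") (simp_all add: pinner_def sum_distrib_left mult_ac)

text \<open>The operator \<open>z d/dz\<close>. It multiplies the n-th coefficient by n, so on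
  analytic polynomials it is, up to sign, the generator of the Poisson semigroup.\<close>

definition euler :: "complex poly \<Rightarrow> complex poly" where "euler P = pCons 0 (pderiv P)"

lemma coeff_euler: "coeff (euler P) n = of_nat n * coeff P n"
  by (cases n) (simp_all add: euler_def coeff_pderiv)

lemma poly_euler: "poly (euler P) z = z * poly (pderiv P) z"
  by (simp add: euler_def)

lemma degree_euler_le: "degree (euler P) \<le> degree P"
  by (intro degree_le) (simp add: coeff_euler coeff_eq_0)

lemma euler_add: "euler (P + Q) = euler P + euler Q"
  and euler_smult: "euler (smult c P) = smult c (euler P)"
  and euler_mult: "euler (P * Q) = euler P * Q + P * euler Q"
  by (simp_all add: euler_def pderiv_add pderiv_smult pderiv_mult)

lemma pinner_euler: "pinner (euler P) Q = pinner P (euler Q)"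
  by (simp add: pinner_eq[OF degree_euler_le] pinner_eq[of P, OF order_refl] coeff_euler mult_ac)

text \<open>In coefficients these are the sums of |a_n|^2 and of n |a_n|^2: the squared L_2 norm on
  the circle and the Dirichlet energy.\<close>

definition psq :: "complex poly \<Rightarrow> real" where "psq P = Re (pinner P P)"
definition pen :: "complex poly \<Rightarrow> real" where "pen P = Re (pinner (euler P) P)"

lemma psq_eq: "degree P \<le> N \<Longrightarrow> psq P = (\<Sum>n\<le>N. (cmod (coeff P n))\<^sup>2)"
  unfolding psq_def by (simp add: pinner_eq flip: power2_eq_square cmod_power2)

lemma pen_eq: "degree P \<le> N \<Longrightarrow> pen P = (\<Sum>n\<le>N. real n * (cmod (coeff P n))\<^sup>2)"
  unfolding pen_def using degree_euler_le[of P]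
  by (simp add: pinner_eq[of _ N] coeff_euler cmod_power2) (simp add: power2_eq_square algebra_simps)

lemma pinner_same: "pinner P P = of_real (psq P)"
  by (simp add: pinner_def psq_def complex_eq_iff)

lemma pen_add: "pen (P + Q) = pen P + 2 * Re (pinner (euler P) Q) + pen Q"
  using pinner_cnj[of "euler P" Q] pinner_euler[of Q P]
  by (simp add: pen_def euler_add pinner_add_left pinner_add_right)

lemma pen_smult: "pen (smult c P) = (cmod c)\<^sup>2 * pen P"
  by (simp add: pen_eq[OF degree_smult_le] pen_eq[of P, OF order_refl] sum_distrib_left norm_mult
      power_mult_distrib mult_ac)

lemma pen_pCons_0: "pen (pCons 0 P) = pen P + psq P"
proof -
  have "pen (pCons 0 P) = (\<Sum>n\<le>Suc (degree P). real n * (cmod (coeff (pCons 0 P) n))\<^sup>2)"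
    by (rule pen_eq) (simp add: degree_pCons_le)
  also have "\<dots> = (\<Sum>n\<le>degree P. real (Suc n) * (cmod (coeff P n))\<^sup>2)"
    by (subst sum.atMost_Suc_shift) simp
  finally show ?thesis by (simp add: pen_eq[OF order_refl] psq_eq[OF order_refl] algebra_simps sum.distrib)
qed

lemma psq_pCons: "psq (pCons c P) = (cmod c)\<^sup>2 + psq P"
proof -
  have "psq (pCons c P) = (\<Sum>n\<le>Suc (degree P). (cmod (coeff (pCons c P) n))\<^sup>2)"
    by (rule psq_eq) (simp add: degree_pCons_le)
  also have "\<dots> = (cmod c)\<^sup>2 + (\<Sum>n\<le>degree P. (cmod (coeff P n))\<^sup>2)"
    by (subst sum.atMost_Suc_shift) simp
  finally show ?thesis by (simp add: psq_eq[OF order_refl])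
qed

lemma psq_nonneg: "psq P \<ge> 0" by (simp add: psq_eq[OF order_refl] sum_nonneg)
lemma euler_pCons_coeff_0: "coeff (euler P) 0 = 0" by (simp add: euler_def)

text \<open>The Dirichlet energy of \<open>|K|\<^sup>2\<close> is at most half that of \<open>K\<^sup>2\<close>; here \<open>A\<close> is the analytic
  part of \<open>|K|\<^sup>2\<close> on the circle. In the induction the cross terms agree exactly.\<close>

lemma Dirichlet_energy_norm_square:
  "\<exists>A. coeff A 0 = 0 \<and> (\<forall>z. cmod z = 1 \<longrightarrow> (cmod (poly K z))\<^sup>2 = psq K + 2 * Re (poly A z))
     \<and> 4 * pen A \<le> pen (K * K)"
proof (induction K rule: pCons_induct)
  case 0
  show ?case by (intro exI[of _ 0]) (simp add: psq_def pinner_def pen_def)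
next
  case (pCons c M)
  then obtain A where A0: "coeff A 0 = 0"
    and A: "\<And>z. cmod z = 1 \<Longrightarrow> (cmod (poly M z))\<^sup>2 = psq M + 2 * Re (poly A z)"
    and AM: "4 * pen A \<le> pen (M * M)" by blast
  \<comment> \<open>Multiplication by z does not change the modulus on the circle, so
    \<open>|N|^2\<close> has the same representation as \<open>|M|^2\<close>, with the same
    \<open>A\<close>. Adding the constant \<open>c\<close> then changes the analytic part only by
    \<open>smult (cnj c) N\<close>.\<close>
  define N where "N = pCons 0 M"
  have K: "pCons c M = [:c:] + N" by (simp add: N_def)
  have N: "(cmod (poly N z))\<^sup>2 = psq M + 2 * Re (poly A z)" if "cmod z = 1" for z
    using A[OF that] that by (simp add: N_def norm_mult)
  have 1: "(cmod (poly (pCons c M) z))\<^sup>2 = psq (pCons c M) + 2 * Re (poly (A + smult (cnj c) N) z)"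
    if "cmod z = 1" for z
  proof -
    have "(cmod (poly (pCons c M) z))\<^sup>2 = (cmod c)\<^sup>2 + (cmod (poly N z))\<^sup>2 + 2 * Re (cnj c * poly N z)"
      unfolding K cmod_power2 by (simp add: power2_eq_square algebra_simps)
    then show ?thesis by (simp add: N[OF that] psq_pCons)
  qed
  have DN0: "pinner (euler P) [:d:] = 0" for P d
    by (simp add: pinner_eq[OF degree_euler_le] coeff_pCons coeff_euler split: nat.splits)
       (auto intro!: sum.neutral split: nat.splits)
  \<comment> \<open>The mixed terms of the two energies are matched by writing \<open>|N|^2\<close>
    as \<open>psq M + A + cnj A\<close> inside the pairing of \<open>N\<close> with
    \<open>N * euler N\<close>. The contributions of \<open>psq M\<close> and \<open>cnj A\<close>
    integrate to zero because \<open>euler N\<close> vanishes at 0.\<close>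
  have cross: "Re (c * pinner (euler N) (N * N)) = 2 * Re (cnj c * pinner (euler N) A)"
  proof -
    have "pinner (euler N) (N * N) = 2 * pinner N (N * euler N)"
      by (simp only: pinner_euler euler_mult pinner_add_right mult.commute[of "euler N"] mult_2)
    also have "pinner N (N * euler N) = circ (\<lambda>z. poly N z * cnj (poly (N * euler N) z))"
      by (rule circ_pinner[symmetric])
    also have "\<dots> = circ (\<lambda>z. (of_real (psq M) * cnj (poly (euler N) z) + poly A z * cnj (poly (euler N) z))
        + cnj (poly (A * euler N) z))"
    proof (rule circ_cong)
      fix z :: complex assume z: "cmod z = 1"
      have "poly N z * cnj (poly (N * euler N) z) = of_real ((cmod (poly N z))\<^sup>2) * cnj (poly (euler N) z)"
        by (simp only: complex_norm_square) (simp add: mult_ac)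
      also have "of_real ((cmod (poly N z))\<^sup>2) = of_real (psq M) + poly A z + cnj (poly A z)"
        by (simp add: N[OF z] complex_eq_iff)
      finally show "poly N z * cnj (poly (N * euler N) z) =
        of_real (psq M) * cnj (poly (euler N) z) + poly A z * cnj (poly (euler N) z) + cnj (poly (A * euler N) z)"
        by (simp add: algebra_simps)
    qed
    also have "\<dots> = of_real (psq M) * cnj (circ (poly (euler N))) + circ (\<lambda>z. poly A z * cnj (poly (euler N) z))
        + cnj (circ (poly (A * euler N)))"
      by (subst circ_add, (intro continuous_intros)+, subst circ_add, (intro continuous_intros)+)
        (simp only: circ_mult_left circ_cnj)
    also have "\<dots> = pinner A (euler N)"
      by (simp only: circ_poly circ_pinner) (simp add: euler_pCons_coeff_0 coeff_mult)
    finally have "pinner (euler N) (N * N) = 2 * cnj (pinner (euler N) A)"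
      by (simp only: pinner_cnj[of A "euler N"])
    then show ?thesis by simp
  qed
  have KK: "pCons c M * pCons c M = smult (2 * c) N + (N * N + [:c * c:])"
    unfolding K by (rule poly_eqI_forall, simp add: algebra_simps)
  have penc: "pen (P + [:d:]) = pen P" for P d
    by (simp add: pen_add DN0) (simp add: pen_def euler_def pinner_def)
  have "pen (pCons c M * pCons c M) = (2 * cmod c)\<^sup>2 * pen N + 2 * Re (2 * (c * pinner (euler N) (N * N))) + pen (N * N)"
    unfolding KK by (subst pen_add) (simp only: pen_smult euler_smult pinner_smult_left pinner_add_right DN0 penc norm_mult,
        simp add: mult_ac)
  also have "\<dots> = 4 * ((cmod c)\<^sup>2 * pen N + 2 * Re (cnj c * pinner (euler N) A)) + pen (N * N)"
    using cross by (simp add: power_mult_distrib)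
  \<comment> \<open>The factor z^2 raises the energy by \<open>2 * psq (M * M)\<close>; apart from
    the induction hypothesis this is the only slack in the step.\<close>
  also have "pen (N * N) = pen (M * M) + 2 * psq (M * M)"
    by (simp add: N_def pen_pCons_0 psq_pCons)
  finally have "4 * ((cmod c)\<^sup>2 * pen N + 2 * Re (cnj c * pinner (euler N) A)) + 4 * pen A \<le> pen (pCons c M * pCons c M)"
    using AM psq_nonneg[of "M * M"] by linarith
  moreover have "pen (A + smult (cnj c) N) = pen A + 2 * Re (cnj c * pinner (euler N) A) + (cmod c)\<^sup>2 * pen N"
    by (subst add.commute, subst pen_add) (simp add: pen_smult euler_smult pinner_smult_left)
  ultimately have 2: "4 * pen (A + smult (cnj c) N) \<le> pen (pCons c M * pCons c M)" by simp
  show ?case by (intro exI[of _ "A + smult (cnj c) N"]) (use A0 1 2 in \<open>simp add: N_def\<close>)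
qed

lemma psq_circ: "of_real (psq P) = circ (\<lambda>z. of_real ((cmod (poly P z))\<^sup>2))"
proof -
  have "of_real (psq P) = circ (\<lambda>z. poly P z * cnj (poly P z))"
    by (simp add: circ_pinner pinner_same)
  then show ?thesis by (simp only: complex_norm_square)
qed

text \<open>Since A(0) = 0, the n-th coefficient of A^2 is a sum of n - 1 products, and
  Cauchy-Schwarz bounds its square by \<open>(n - 1) * c n\<close>. The inequality between the
  means, weighted by n - 1, turns the pairing with the n-th coefficient of A into
  \<open>4 * (n - 1) * (a n)^2 + c n\<close>. The n - 1 in place of n yields the term
  \<open>- 4 * psq A\<close>, and the \<open>c n\<close> add up to at most
  \<open>(psq A)^2\<close>.\<close>

lemma cubic_coefficient_bound:
  assumes A0: "coeff A 0 = 0"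
  shows "4 * Re (pinner (A * A) A) \<le> 4 * pen A - 4 * psq A + (psq A)\<^sup>2"
proof -
  define d where "d = degree A"
  define a where "a n = cmod (coeff A n)" for n
  define N where "N = d + d"
  have dA: "degree (A * A) \<le> N" "degree A \<le> N" using degree_mult_le[of A A] by (auto simp: N_def d_def)
  have a0: "a 0 = 0" by (simp add: a_def A0)
  define c where "c n = (\<Sum>i\<le>n. (a i)\<^sup>2 * (a (n - i))\<^sup>2)" for n
  have cs: "(cmod (coeff (A * A) n))\<^sup>2 \<le> (real n - 1) * c n" if n: "n \<ge> 1" for n
  proof -
    have "cmod (coeff (A * A) n) \<le> (\<Sum>i\<le>n. a i * a (n - i))"
      unfolding coeff_mult a_def by (rule sum_norm_le) (simp add: norm_mult)
    also have "\<dots> = (\<Sum>i\<in>{1..<n}. a i * a (n - i))"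
      by (rule sum.mono_neutral_right) (auto simp: a0 not_less Suc_le_eq)
    finally have "(cmod (coeff (A * A) n))\<^sup>2 \<le> (\<Sum>i\<in>{1..<n}. 1 * (a i * a (n - i)))\<^sup>2"
      by (intro power_mono) auto
    also have "\<dots> \<le> (\<Sum>i\<in>{1..<n}. 1\<^sup>2) * (\<Sum>i\<in>{1..<n}. (a i * a (n - i))\<^sup>2)"
      by (rule Cauchy_Schwarz_ineq_sum)
    also have "(\<Sum>i\<in>{1..<n}. (a i * a (n - i))\<^sup>2) \<le> c n"
      unfolding c_def power_mult_distrib by (rule sum_mono2) auto
    finally show ?thesis using n by (simp add: of_nat_diff mult_left_mono)
  qed
  have summand: "4 * Re (coeff (A * A) n * cnj (coeff A n)) \<le> 4 * (real n - 1) * (a n)\<^sup>2 + c n" for n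
  proof (cases "n \<le> 1")
    case True
    have "coeff (A * A) n = 0" using True A0 by (cases n) (auto simp: coeff_mult)
    moreover have "(real n - 1) * (a n)\<^sup>2 = 0" using True a0 by (cases n) auto
    moreover have "c n \<ge> 0" unfolding c_def by (intro sum_nonneg) auto
    ultimately show ?thesis by (simp only: mult.assoc) simp
  next
    case False
    define x where "x = cmod (coeff (A * A) n)"
    define s where "s = real n - 1"
    have s: "s > 0" using False by (simp add: s_def)
    have "Re (coeff (A * A) n * cnj (coeff A n)) \<le> x * a n"
      unfolding x_def a_def using complex_Re_le_cmod[of "coeff (A * A) n * cnj (coeff A n)"] by (simp add: norm_mult)
    moreover have "4 * (x * a n) \<le> 4 * s * (a n)\<^sup>2 + x\<^sup>2 / s"
    proof -
      have "0 \<le> (2 * s * a n - x)\<^sup>2 / s" using s by simp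
      then show ?thesis using s by (simp add: power2_eq_square field_simps)
    qed
    moreover have "x\<^sup>2 / s \<le> c n" using cs[of n] False s by (simp add: x_def s_def field_simps)
    ultimately show ?thesis unfolding s_def by linarith
  qed
  have "4 * Re (pinner (A * A) A) = (\<Sum>n\<le>N. 4 * Re (coeff (A * A) n * cnj (coeff A n)))"
    by (simp only: pinner_eq[OF dA(1)] Re_sum sum_distrib_left)
  also have "\<dots> \<le> (\<Sum>n\<le>N. 4 * (real n - 1) * (a n)\<^sup>2 + c n)" by (rule sum_mono) (rule summand)
  also have "\<dots> = 4 * pen A - 4 * psq A + (\<Sum>n\<le>N. c n)"
    by (simp add: pen_eq[OF dA(2)] psq_eq[OF dA(2)] sum.distrib sum_distrib_left algebra_simps sum_subtractf a_def)
  also have "(\<Sum>n\<le>N. c n) = (\<Sum>(i, j)\<in>{(i, j). i + j \<le> N}. (a i)\<^sup>2 * (a j)\<^sup>2)"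
    unfolding c_def by (rule sum.triangle_reindex_eq[symmetric])
  also have "\<dots> \<le> (\<Sum>(i, j)\<in>{..N} \<times> {..N}. (a i)\<^sup>2 * (a j)\<^sup>2)" by (rule sum_mono2) auto
  also have "\<dots> = (psq A)\<^sup>2"
    by (simp add: psq_eq[OF dA(2)] power2_eq_square sum_product sum.cartesian_product a_def)
  finally show ?thesis by simp
qed

text \<open>A logarithmic Sobolev inequality for \<open>|K|^4\<close> whose logarithm has been
  replaced by the cubic of \<open>entropy_cubic_bound\<close>, so that only moments of
  \<open>|K|^2\<close> occur. Expanded in \<open>b = psq K\<close> and the analytic part
  \<open>A\<close>, the one term that is not a function of \<open>b\<close> is \<open>Re t\<close>;
  \<open>cubic_coefficient_bound\<close> absorbs it into \<open>4 * pen A\<close>.\<close>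

lemma polynomial_log_Sobolev:
  assumes S4: "psq (K * K) = 1"
  shows "2 / 3 * psq (K * K * K) + 4 / 3 - 2 * psq K \<le> pen (K * K)"
proof -
  obtain A where A0: "coeff A 0 = 0"
    and A: "\<And>z. cmod z = 1 \<Longrightarrow> (cmod (poly K z))\<^sup>2 = psq K + 2 * Re (poly A z)"
    and AK: "4 * pen A \<le> pen (K * K)" using Dirichlet_energy_norm_square[of K] by blast
  define b where "b = psq K"
  define \<sigma> where "\<sigma> = psq A"
  have b: "b \<ge> 0" by (simp add: b_def psq_nonneg)
  have A0': "circ (poly A) = 0" "circ (poly (A * A)) = 0" "circ (poly (A * A * A)) = 0"
    by (simp_all only: circ_poly) (simp_all add: A0 coeff_mult)
  have AA: "circ (\<lambda>z. poly A z * cnj (poly A z)) = \<sigma>" by (simp add: circ_pinner pinner_same \<sigma>_def)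
  have f: "of_real ((cmod (poly K z))\<^sup>2) = of_real b + (poly A z + cnj (poly A z))" if "cmod z = 1" for z
    by (simp add: A[OF that] b_def complex_eq_iff)
  have "of_real (psq (K * K)) = circ (\<lambda>z. (of_real ((cmod (poly K z))\<^sup>2))\<^sup>2)"
    unfolding psq_circ by (simp add: norm_mult power2_eq_square)
  also have "\<dots> = circ (\<lambda>z. of_real (b\<^sup>2) + ((2 * b) * poly A z + ((2 * b) * cnj (poly A z) + (poly (A * A) z
      + (cnj (poly (A * A) z) + 2 * (poly A z * cnj (poly A z)))))))"
    by (rule circ_cong, simp only: f) (simp add: power2_eq_square algebra_simps)
  also have "\<dots> = of_real (b\<^sup>2) + ((2 * b) * circ (poly A) + ((2 * b) * cnj (circ (poly A)) + (circ (poly (A * A))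
      + (cnj (circ (poly (A * A))) + 2 * circ (\<lambda>z. poly A z * cnj (poly A z))))))"
    by (subst circ_add, (intro continuous_intros)+)+ (simp only: circ_mult_left circ_cnj circ_const)
  also have "\<dots> = of_real (b\<^sup>2 + 2 * \<sigma>)" by (simp only: A0' AA) simp
  finally have S4': "b\<^sup>2 + 2 * \<sigma> = 1" using S4 by (simp only: of_real_eq_iff)
  define t where "t = pinner (A * A) A"
  have t: "circ (\<lambda>z. poly (A * A) z * cnj (poly A z)) = t" by (simp only: circ_pinner t_def)
  have t': "circ (\<lambda>z. cnj (poly (A * A) z * cnj (poly A z))) = cnj t" by (simp only: circ_cnj t)
  have "of_real (psq (K * K * K)) = circ (\<lambda>z. (of_real ((cmod (poly K z))\<^sup>2)) ^ 3)"
    unfolding psq_circ by (simp add: norm_mult power2_eq_square power3_eq_cube mult_ac)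
  also have "\<dots> = circ (\<lambda>z. of_real (b ^ 3) + ((3 * b\<^sup>2) * poly A z + ((3 * b\<^sup>2) * cnj (poly A z)
      + ((3 * b) * poly (A * A) z + ((3 * b) * cnj (poly (A * A) z) + ((6 * b) * (poly A z * cnj (poly A z))
      + (poly (A * A * A) z + (cnj (poly (A * A * A) z) + (3 * (poly (A * A) z * cnj (poly A z))
      + 3 * cnj (poly (A * A) z * cnj (poly A z)))))))))))"
    by (rule circ_cong, simp only: f) (simp add: power2_eq_square power3_eq_cube algebra_simps)
  also have "\<dots> = of_real (b ^ 3) + ((3 * b\<^sup>2) * circ (poly A) + ((3 * b\<^sup>2) * cnj (circ (poly A))
      + ((3 * b) * circ (poly (A * A)) + ((3 * b) * cnj (circ (poly (A * A))) + ((6 * b) * circ (\<lambda>z. poly A z * cnj (poly A z))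
      + (circ (poly (A * A * A)) + (cnj (circ (poly (A * A * A))) + (3 * t + 3 * cnj t))))))))"
    by (subst circ_add, (intro continuous_intros)+)+ (simp only: circ_mult_left t t' circ_const, simp only: circ_cnj)
  also have "\<dots> = of_real (b ^ 3 + 6 * b * \<sigma> + 6 * Re t)" by (simp only: A0' AA) (simp add: complex_eq_iff)
  finally have S6: "psq (K * K * K) = b ^ 3 + 6 * b * \<sigma> + 6 * Re t" by (simp only: of_real_eq_iff)
  have cub: "4 * Re t \<le> 4 * pen A - 4 * \<sigma> + \<sigma>\<^sup>2"
    using cubic_coefficient_bound[OF A0] by (simp add: t_def \<sigma>_def)
  have \<sigma>: "\<sigma> = (1 - b\<^sup>2) / 2" using S4' by simp
  have b1: "b \<le> 1"
  proof (rule ccontr)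
    assume "\<not> b \<le> 1" then have "b\<^sup>2 > 1" by simp
    then show False using S4' psq_nonneg[of A] by (simp add: \<sigma>_def)
  qed
  \<comment> \<open>What is left is a polynomial in \<open>b\<close> with a double zero at
    \<open>b = 1\<close>, the case in which \<open>\<sigma>\<close> is 0 and |K| is constant on the
    circle.\<close>
  have "2 / 3 * b ^ 3 + 4 * b * \<sigma> - 4 * \<sigma> + \<sigma>\<^sup>2 + 4 / 3 - 2 * b = - ((1 - b)\<^sup>2 * (5 / 12 + b * (10 - 3 * b) / 12))"
    unfolding \<sigma> by (simp add: power2_eq_square power3_eq_cube field_simps)
  also have "\<dots> \<le> 0" using b b1 by simp
  finally show ?thesis using cub AK unfolding S6 b_def[symmetric] by (simp add: algebra_simps)
qed

section \<open>Averages of real functions over the circle\<close>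

definition rcirc :: "(complex \<Rightarrow> real) \<Rightarrow> real" where
  "rcirc g = integral {0..2*pi} (\<lambda>t. g (cis t)) / (2*pi)"

lemma rcirc_integrable:
  fixes g :: "complex \<Rightarrow> real"
  assumes "continuous_on (sphere 0 1) g"
  shows "(\<lambda>t. g (cis t)) integrable_on {0..2*pi}"
proof (rule integrable_continuous_interval)
  have "continuous_on {0..2*pi} cis" by (intro continuous_intros)
  then show "continuous_on {0..2*pi} (\<lambda>t. g (cis t))"
    by (rule continuous_on_compose2[OF assms]) auto
qed

lemma circ_of_real:
  assumes "continuous_on (sphere 0 1) g"
  shows "circ (\<lambda>z. of_real (g z)) = of_real (rcirc g)"
proof -
  have "((\<lambda>t. of_real (g (cis t))) has_integral (of_real (integral {0..2*pi} (\<lambda>t. g (cis t))) :: complex)) {0..2*pi}"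
    by (intro has_integral_of_real integrable_integral rcirc_integrable assms)
  then show ?thesis by (simp add: circ_def rcirc_def integral_unique)
qed

lemma Re_circ:
  assumes "continuous_on (sphere 0 1) f"
  shows "Re (circ f) = rcirc (\<lambda>z. Re (f z))"
  using has_integral_Re[OF integrable_integral[OF circ_integrable[OF assms]]]
  by (simp add: circ_def rcirc_def integral_unique)

lemma psq_rcirc: "psq P = rcirc (\<lambda>z. (cmod (poly P z))\<^sup>2)"
proof -
  have "of_real (psq P) = (of_real (rcirc (\<lambda>z. (cmod (poly P z))\<^sup>2)) :: complex)"
    unfolding psq_circ by (rule circ_of_real) (intro continuous_intros)
  then show ?thesis by (simp only: of_real_eq_iff)
qed

lemma pen_rcirc: "pen P = rcirc (\<lambda>z. Re (z * poly (pderiv P) z * cnj (poly P z)))"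
proof -
  have "pen P = Re (circ (\<lambda>z. poly (euler P) z * cnj (poly P z)))"
    by (simp add: pen_def circ_pinner)
  also have "\<dots> = rcirc (\<lambda>z. Re (poly (euler P) z * cnj (poly P z)))"
    by (rule Re_circ) (intro continuous_intros)
  finally show ?thesis by (simp add: poly_euler)
qed

lemma rcirc_mono:
  assumes "continuous_on (sphere 0 1) f" "continuous_on (sphere 0 1) g"
    and "\<And>z. cmod z = 1 \<Longrightarrow> f z \<le> g z"
  shows "rcirc f \<le> rcirc g"
  unfolding rcirc_def
  by (intro divide_right_mono integral_le rcirc_integrable assms) (auto simp: assms(3))

lemma rcirc_cong: "(\<And>z. cmod z = 1 \<Longrightarrow> f z = g z) \<Longrightarrow> rcirc f = rcirc g"
  unfolding rcirc_def by (intro arg_cong2[of _ _ _ _ "(/)"] integral_cong) auto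

lemma rcirc_add:
  assumes "continuous_on (sphere 0 1) f" "continuous_on (sphere 0 1) g"
  shows "rcirc (\<lambda>z. f z + g z) = rcirc f + rcirc g"
  unfolding rcirc_def
  by (simp add: integral_add[OF rcirc_integrable[OF assms(1)] rcirc_integrable[OF assms(2)]] add_divide_distrib)

lemma rcirc_mult_left: "rcirc (\<lambda>z. c * f z) = c * rcirc f"
  by (cases "c = 0") (simp_all add: rcirc_def)

lemma rcirc_const: "rcirc (\<lambda>z. c) = c"
  by (simp add: rcirc_def)

lemma rcirc_pos:
  assumes "continuous_on (sphere 0 1) f" "\<And>z. cmod z = 1 \<Longrightarrow> 0 < f z"
  shows "0 < rcirc f"
proof -
  have "compact (f ` sphere 0 1)" by (intro compact_continuous_image assms compact_sphere)
  moreover have "f ` sphere 0 1 \<noteq> {}" by (auto intro!: exI[of _ "1::complex"] simp: image_iff)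
  ultimately obtain z where z: "cmod z = 1" "\<And>w. cmod w = 1 \<Longrightarrow> f z \<le> f w"
    using compact_attains_inf[of "f ` sphere 0 1"] by auto
  have "0 < f z" using z assms by simp
  also have "f z = rcirc (\<lambda>_. f z)" by (simp add: rcirc_const)
  also have "\<dots> \<le> rcirc f" by (intro rcirc_mono assms continuous_intros z)
  finally show ?thesis .
qed

lemma rcirc_tendsto:
  fixes f :: "nat \<Rightarrow> complex \<Rightarrow> real"
  assumes "\<And>n. continuous_on (sphere 0 1) (f n)"
    and "\<And>n z. cmod z = 1 \<Longrightarrow> \<bar>f n z\<bar> \<le> B"
    and "\<And>z. cmod z = 1 \<Longrightarrow> (\<lambda>n. f n z) \<longlonglongrightarrow> g z"
  shows "(\<lambda>n. rcirc (f n)) \<longlonglongrightarrow> rcirc g"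
proof -
  have "(\<lambda>n. integral {0..2*pi} (\<lambda>t. f n (cis t))) \<longlonglongrightarrow> integral {0..2*pi} (\<lambda>t. g (cis t))"
    by (rule dominated_convergence(2)[where h = "\<lambda>_. B"])
       (auto intro!: rcirc_integrable assms)
  then show ?thesis unfolding rcirc_def by (intro tendsto_divide tendsto_const) auto
qed

text \<open>\<open>psq (K * K)\<close> has degree 4 in the modulus of \<open>K\<close>, so division
  of \<open>K\<close> by the fourth root of \<open>m\<close> leads to the normalized case.\<close>

lemma polynomial_log_Sobolev_scaled:
  assumes m: "psq (K * K) = m" "m > 0"
  shows "2 / 3 * psq (K * K * K) / (m * sqrt m) + 4 / 3 - 2 * psq K / sqrt m \<le> pen (K * K) / m"
proof -
  define c where "c = 1 / sqrt (sqrt m)"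
  have c4: "c\<^sup>2 = 1 / sqrt m" using m(2) by (simp add: c_def power_divide)
  have s: "sqrt m * sqrt m = m" using m(2) by simp
  have psq_smult: "psq (smult (of_real a) P) = a\<^sup>2 * psq P" for a P
    by (simp add: psq_eq[OF degree_smult_le] psq_eq[of P, OF order_refl] sum_distrib_left norm_mult
      power_mult_distrib)
  let ?K = "smult (of_real c) K"
  have 2: "?K * ?K = smult (of_real (c\<^sup>2)) (K * K)" by (simp add: power2_eq_square)
  have 3: "?K * ?K * ?K = smult (of_real (c * c\<^sup>2)) (K * K * K)" by (simp add: power2_eq_square)
  have "psq (?K * ?K) = 1"
    unfolding 2 psq_smult c4 m using m(2) by (simp add: power2_eq_square s)
  from polynomial_log_Sobolev[OF this]
  have "2 / 3 * ((c * c\<^sup>2)\<^sup>2 * psq (K * K * K)) + 4 / 3 - 2 * (c\<^sup>2 * psq K) \<le> (c\<^sup>2)\<^sup>2 * pen (K * K)"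
    unfolding 3 unfolding 2 psq_smult pen_smult by (simp add: norm_power flip: power_mult)
  also have "(c\<^sup>2)\<^sup>2 = 1 / m" unfolding c4 using m(2) by (simp add: power_divide)
  also have "(c * c\<^sup>2)\<^sup>2 = c\<^sup>2 * (c\<^sup>2)\<^sup>2" by (simp add: power_mult_distrib)
  also have "\<dots> = 1 / (m * sqrt m)" unfolding c4 using m(2) by (simp add: power_divide)
  finally show ?thesis by (simp add: c4)
qed

text \<open>The cubic agrees with \<open>x^2 ln (x^2)\<close> to third order at 1. After division by
  \<open>x^2\<close> the difference has a derivative proportional to
  \<open>(x - 1) ^ 3 / x ^ 3\<close>, so its minimum is the value 0 at \<open>x = 1\<close>.\<close>

lemma entropy_cubic_bound:
  fixes x :: real assumes "x > 0"
  shows "x\<^sup>2 * ln (x\<^sup>2) \<le> 2 / 3 * x ^ 3 + x\<^sup>2 - 2 * x + 1 / 3"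
proof -
  define g where "g x = 2 / 3 * x + 1 - 2 / x + 1 / (3 * x\<^sup>2) - 2 * ln x" for x :: real
  have D: "(g has_real_derivative 2 * (x - 1) ^ 3 / (3 * x ^ 3)) (at x)" if "x > 0" for x
  proof -
    have "(g has_real_derivative 2 / 3 + 2 / x\<^sup>2 - 2 / (3 * x ^ 3) - 2 / x) (at x)"
      unfolding g_def using that
      by (auto intro!: derivative_eq_intros) (simp add: power2_eq_square power3_eq_cube power4_eq_xxxx)
    also have "2 / 3 + 2 / x\<^sup>2 - 2 / (3 * x ^ 3) - 2 / x = 2 * (x - 1) ^ 3 / (3 * x ^ 3)"
      using that by (simp add: power2_eq_square power3_eq_cube field_simps)
    finally show ?thesis .
  qed
  have "g 1 \<le> g x"
  proof (cases "x \<ge> 1")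
    case True
    then show ?thesis
    proof (rule DERIV_nonneg_imp_nondecreasing)
      fix y :: real assume y: "1 \<le> y" "y \<le> x"
      then have "0 \<le> 2 * (y - 1) ^ 3 / (3 * y ^ 3)" by simp
      with D[of y] y show "\<exists>d. (g has_real_derivative d) (at y) \<and> 0 \<le> d" by auto
    qed
  next
    case False
    then have "x \<le> 1" by simp
    then show ?thesis
    proof (rule DERIV_nonpos_imp_nonincreasing)
      fix y :: real assume y: "x \<le> y" "y \<le> 1"
      then have "(y - 1) ^ 3 \<le> 0" by (simp add: power_le_zero_eq)
      then have "2 * (y - 1) ^ 3 / (3 * y ^ 3) \<le> 0"
        using assms y by (intro divide_nonpos_nonneg) auto
      with D[of y] y assms show "\<exists>d. (g has_real_derivative d) (at y) \<and> d \<le> 0" by auto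
    qed
  qed
  then have "0 \<le> x\<^sup>2 * g x" by (simp add: g_def)
  also have "x\<^sup>2 * g x = 2 / 3 * x ^ 3 + x\<^sup>2 - 2 * x + 1 / 3 - x\<^sup>2 * ln (x\<^sup>2)"
    using assms ln_realpow[of x 2] by (simp add: g_def) (simp add: power2_eq_square power3_eq_cube field_simps)
  finally show ?thesis by simp
qed

text \<open>On the circle the Taylor polynomials converge together with their derivatives, because
  \<open>R > 1\<close>. The limit is taken in the moment inequality, which contains no logarithm,
  since Taylor polynomials may vanish on the circle. The logarithm is introduced afterwards,
  pointwise, through \<open>entropy_cubic_bound\<close>.\<close>

lemma analytic_log_Sobolev:
  assumes hol: "K holomorphic_on ball 0 R" and R: "R > 1" and nz: "\<And>z. cmod z = 1 \<Longrightarrow> K z \<noteq> 0"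
  defines "m \<equiv> rcirc (\<lambda>z. cmod (K z) ^ 4)"
  shows "rcirc (\<lambda>z. cmod (K z) ^ 4 * ln (cmod (K z) ^ 4)) - m * ln m
    \<le> rcirc (\<lambda>z. Re (z * (2 * K z * deriv K z) * cnj (K z * K z)))"
proof -
  define a where "a n = (deriv ^^ n) K 0 / fact n" for n
  have powser: "(\<lambda>n. a n * z ^ n) sums K z" if "z \<in> ball 0 R" for z
    using holomorphic_power_series[OF hol that] by (simp add: a_def)
  have sub: "sphere 0 1 \<subseteq> ball (0::complex) R" using R by auto
  have contK: "continuous_on (sphere 0 1) K"
    using hol sub by (auto intro: holomorphic_on_imp_continuous_on continuous_on_subset)
  obtain r where r: "1 < r" "r < R" using dense[OF R] by blast
  have rb: "of_real r \<in> ball (0::complex) R" using r by auto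
  have summ: "summable (\<lambda>n. a n * of_real r ^ n)" using powser[OF rb] by (rule sums_summable)
  have sa: "summable (\<lambda>n. cmod (a n))"
    using powser_insidea[OF summ, of 1] r by simp
  \<comment> \<open>A radius strictly between 1 and \<open>r\<close> leaves room both to
    differentiate the series and to conclude absolute summability on the circle.\<close>
  have summ2: "summable (\<lambda>n. diffs a n * of_real ((1 + r) / 2) ^ n)"
  proof (rule termdiff_converges)
    have "norm (of_real ((1 + r) / 2) :: complex) = (1 + r) / 2" using r by (simp only: norm_of_real) simp
    then show "norm (of_real ((1 + r) / 2) :: complex) < r" using r by simp
    show "summable (\<lambda>n. a n * x ^ n)" if "norm x < r" for x
      using powser[of x] that r by (intro sums_summable) auto
  qed
  have sd: "summable (\<lambda>n. cmod (diffs a n))"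
  proof -
    have "norm (of_real ((1 + r) / 2) :: complex) = (1 + r) / 2" using r by (simp only: norm_of_real) simp
    then have "norm (1::complex) < norm (of_real ((1 + r) / 2) :: complex)" using r by simp
    from powser_insidea[OF summ2 this] show ?thesis by simp
  qed
  have dK: "(\<lambda>n. diffs a n * z ^ n) sums deriv K z" if z: "cmod z = 1" for z
  proof -
    have "((\<lambda>z. \<Sum>n. a n * z ^ n) has_field_derivative (\<Sum>n. diffs a n * z ^ n)) (at z)"
      by (rule termdiffs_strong[OF summ]) (use z r in auto)
    moreover have "eventually (\<lambda>w. w \<in> ball 0 R) (nhds z)"
      by (rule eventually_nhds_in_open) (use z R in auto)
    then have "eventually (\<lambda>w. (\<Sum>n. a n * w ^ n) = K w) (nhds z)"
      by eventually_elim (simp add: sums_unique[OF powser, symmetric])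
    ultimately have "(K has_field_derivative (\<Sum>n. diffs a n * z ^ n)) (at z)"
      using DERIV_cong_ev[OF refl _ refl] by fast
    then have "deriv K z = (\<Sum>n. diffs a n * z ^ n)" by (rule DERIV_imp_deriv)
    moreover have "summable (\<lambda>n. diffs a n * z ^ n)"
      by (rule summable_norm_cancel) (simp add: norm_mult norm_power z sd)
    ultimately show ?thesis by (simp add: sums_iff)
  qed
  define P where "P n = (\<Sum>k<Suc n. monom (a k) k)" for n
  have polyP: "poly (P n) z = (\<Sum>k<Suc n. a k * z ^ k)" for n z
    unfolding P_def by (simp add: poly_sum poly_monom)
  have polyP': "poly (pderiv (P n)) z = (\<Sum>k<n. diffs a k * z ^ k)" for n z
  proof -
    have "poly (pderiv (P n)) z = (\<Sum>k<Suc n. of_nat k * a k * z ^ (k - 1))"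
    proof -
      have "pderiv (\<Sum>k<j. monom (a k) k) = (\<Sum>k<j. pderiv (monom (a k) k))" for j
        by (induction j) (simp_all add: pderiv_add)
      then show ?thesis
        unfolding P_def by (simp add: poly_sum pderiv_monom poly_monom del: sum.lessThan_Suc)
    qed
    also have "\<dots> = (\<Sum>k<n. diffs a k * z ^ k)"
      unfolding sum.lessThan_Suc_shift by (simp add: diffs_def)
    finally show ?thesis .
  qed
  have lim: "(\<lambda>n. poly (P n) z) \<longlonglongrightarrow> K z" if z: "cmod z = 1" for z
    unfolding polyP using powser[of z] z R by (intro LIMSEQ_Suc) (simp add: sums_def)
  have lim': "(\<lambda>n. poly (pderiv (P n)) z) \<longlonglongrightarrow> deriv K z" if z: "cmod z = 1" for z
    unfolding polyP' using dK[OF z] by (simp add: sums_def)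
  define B where "B = (\<Sum>k. cmod (a k))"
  define B' where "B' = (\<Sum>k. cmod (diffs a k))"
  have bd: "cmod (poly (P n) z) \<le> B" if z: "cmod z = 1" for n z
  proof -
    have "cmod (poly (P n) z) \<le> (\<Sum>k<Suc n. cmod (a k))"
      unfolding polyP by (rule sum_norm_le) (simp add: norm_mult norm_power z)
    also have "\<dots> \<le> B" unfolding B_def by (rule sum_le_suminf[OF sa]) auto
    finally show ?thesis .
  qed
  have bd': "cmod (poly (pderiv (P n)) z) \<le> B'" if z: "cmod z = 1" for n z
  proof -
    have "cmod (poly (pderiv (P n)) z) \<le> (\<Sum>k<n. cmod (diffs a k))"
      unfolding polyP' by (rule sum_norm_le) (simp add: norm_mult norm_power z)
    also have "\<dots> \<le> B'" unfolding B'_def by (rule sum_le_suminf[OF sd]) auto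
    finally show ?thesis .
  qed
  have B0: "0 \<le> B" unfolding B_def by (intro suminf_nonneg sa) auto
  define S where "S k = rcirc (\<lambda>z. cmod (K z) ^ (2 * k))" for k
  define E where "E = rcirc (\<lambda>z. Re (z * (2 * K z * deriv K z) * cnj (K z * K z)))"
  have limS: "(\<lambda>n. rcirc (\<lambda>z. cmod (poly (P n) z) ^ (2 * k))) \<longlonglongrightarrow> S k" for k
    unfolding S_def
    by (rule rcirc_tendsto[where B = "B ^ (2 * k)"])
       (auto intro!: continuous_intros tendsto_intros lim bd power_mono)
  have psq1: "psq (P n) = rcirc (\<lambda>z. cmod (poly (P n) z) ^ (2 * 1))" for n
    by (simp add: psq_rcirc)
  have psq2: "psq (P n * P n) = rcirc (\<lambda>z. cmod (poly (P n) z) ^ (2 * 2))" for n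
    by (simp add: psq_rcirc norm_mult power_mult_distrib flip: power_add)
  have psq3: "psq (P n * P n * P n) = rcirc (\<lambda>z. cmod (poly (P n) z) ^ (2 * 3))" for n
    by (simp add: psq_rcirc norm_mult power_mult_distrib flip: power_add)
  have limE: "(\<lambda>n. pen (P n * P n)) \<longlonglongrightarrow> E"
    unfolding E_def pen_rcirc
  proof (rule rcirc_tendsto[where B = "2 * B * B' * (B * B)"])
    fix n z assume z: "cmod z = 1"
    have "\<bar>Re (z * poly (pderiv (P n * P n)) z * cnj (poly (P n * P n) z))\<bar>
      \<le> cmod (z * poly (pderiv (P n * P n)) z * cnj (poly (P n * P n) z))" by (rule abs_Re_le_cmod)
    also have "\<dots> = 2 * cmod (poly (P n) z) * cmod (poly (pderiv (P n)) z) * (cmod (poly (P n) z) * cmod (poly (P n) z))"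
    proof -
      have "poly (pderiv (P n * P n)) z = 2 * poly (P n) z * poly (pderiv (P n)) z"
        by (simp add: pderiv_mult)
      then show ?thesis by (simp add: norm_mult z)
    qed
    also have "\<dots> \<le> 2 * B * B' * (B * B)"
      by (intro mult_mono bd[OF z] bd'[OF z]) (use B0 order_trans[OF norm_ge_zero bd'[OF z]] in auto)
    finally show "\<bar>Re (z * poly (pderiv (P n * P n)) z * cnj (poly (P n * P n) z))\<bar> \<le> 2 * B * B' * (B * B)" .
  next
    fix z :: complex assume z: "cmod z = 1"
    have "(\<lambda>n. Re (z * (2 * poly (P n) z * poly (pderiv (P n)) z) * cnj (poly (P n) z * poly (P n) z)))
        \<longlonglongrightarrow> Re (z * (2 * K z * deriv K z) * cnj (K z * K z))"
      by (intro tendsto_intros lim[OF z] lim'[OF z])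
    then show "(\<lambda>n. Re (z * poly (pderiv (P n * P n)) z * cnj (poly (P n * P n) z)))
        \<longlonglongrightarrow> Re (z * (2 * K z * deriv K z) * cnj (K z * K z))"
      by (simp add: pderiv_mult mult_ac)
  qed (intro continuous_intros)
  have mS: "m = S 2" by (simp add: m_def S_def)
  have m0: "m > 0" unfolding m_def by (intro rcirc_pos continuous_intros contK) (simp add: nz)
  have "2 / 3 * S 3 / (m * sqrt m) + 4 / 3 - 2 * S 1 / sqrt m \<le> E / m"
  proof (rule tendsto_le[OF sequentially_bot])
    have lim2: "(\<lambda>n. psq (P n * P n)) \<longlonglongrightarrow> m" unfolding psq2 mS by (rule limS)
    show "(\<lambda>n. pen (P n * P n) / psq (P n * P n)) \<longlonglongrightarrow> E / m"
      using m0 by (intro tendsto_intros limE lim2) auto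
    show "(\<lambda>n. 2 / 3 * psq (P n * P n * P n) / (psq (P n * P n) * sqrt (psq (P n * P n))) + 4 / 3
        - 2 * psq (P n) / sqrt (psq (P n * P n))) \<longlonglongrightarrow> 2 / 3 * S 3 / (m * sqrt m) + 4 / 3 - 2 * S 1 / sqrt m"
      unfolding psq3 psq1 using m0
      by (intro tendsto_intros limS lim2) auto
    have "eventually (\<lambda>n. psq (P n * P n) > 0) sequentially"
      using lim2 m0 by (rule order_tendstoD(1))
    then show "eventually (\<lambda>n. 2 / 3 * psq (P n * P n * P n) / (psq (P n * P n) * sqrt (psq (P n * P n))) + 4 / 3
        - 2 * psq (P n) / sqrt (psq (P n * P n)) \<le> pen (P n * P n) / psq (P n * P n)) sequentially"
      by eventually_elim (rule polynomial_log_Sobolev_scaled[OF refl])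
  qed
  moreover have "(rcirc (\<lambda>z. cmod (K z) ^ 4 * ln (cmod (K z) ^ 4)) - m * ln m) / m
      \<le> 2 / 3 * S 3 / (m * sqrt m) + 4 / 3 - 2 * S 1 / sqrt m"
  proof -
    let ?f = "\<lambda>z. cmod (K z) ^ 4 * ln (cmod (K z) ^ 4)"
    let ?s = "sqrt m"
    have "rcirc (\<lambda>z. (1 / m) * ?f z + (- ln m / m) * cmod (K z) ^ 4) \<le>
      rcirc (\<lambda>z. (2 / 3 / (m * ?s)) * cmod (K z) ^ (2 * 3) + ((1 / m) * cmod (K z) ^ (2 * 2)
        + ((- 2 / ?s) * cmod (K z) ^ (2 * 1) + 1 / 3)))"
    proof (rule rcirc_mono)
      fix z :: complex assume z: "cmod z = 1"
      define k where "k = cmod (K z)"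
      have k: "k > 0" using nz[OF z] by (simp add: k_def)
      define x where "x = k\<^sup>2 / ?s"
      have x: "x > 0" using k m0 by (simp add: x_def)
      have x2: "x\<^sup>2 = k ^ 4 / m" using m0 by (simp add: x_def power_divide flip: power_mult)
      have x3: "x ^ 3 = k ^ 6 / (m * ?s)" using m0
        by (simp add: x_def power_divide power3_eq_cube flip: power_mult)
      have "ln (x\<^sup>2) = ln (k ^ 4) - ln m" unfolding x2 using k m0 by (simp add: ln_div)
      with entropy_cubic_bound[OF x] show "(1 / m) * ?f z + (- ln m / m) * cmod (K z) ^ 4 \<le>
         (2 / 3 / (m * ?s)) * cmod (K z) ^ (2 * 3) + ((1 / m) * cmod (K z) ^ (2 * 2)
        + ((- 2 / ?s) * cmod (K z) ^ (2 * 1) + 1 / 3))"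
        unfolding k_def[symmetric] x3 unfolding x2 by (simp add: x_def) (simp add: algebra_simps diff_divide_distrib)
    qed (use m0 in \<open>auto intro!: continuous_intros contK simp: nz\<close>)
    also have "rcirc (\<lambda>z. (1 / m) * ?f z + (- ln m / m) * cmod (K z) ^ 4) = (1 / m) * rcirc ?f + (- ln m / m) * m"
    proof -
      have c1: "continuous_on (sphere 0 1) (\<lambda>z. (1 / m) * ?f z)"
        using m0 by (auto intro!: continuous_intros contK simp: nz)
      have c2: "continuous_on (sphere 0 1) (\<lambda>z. (- ln m / m) * cmod (K z) ^ 4)"
        by (intro continuous_intros contK)
      show ?thesis by (simp only: rcirc_add[OF c1 c2] rcirc_mult_left flip: m_def)
    qed
    also have "rcirc (\<lambda>z. (2 / 3 / (m * ?s)) * cmod (K z) ^ (2 * 3) + ((1 / m) * cmod (K z) ^ (2 * 2)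
        + ((- 2 / ?s) * cmod (K z) ^ (2 * 1) + 1 / 3))) =
      (2 / 3 / (m * ?s)) * S 3 + ((1 / m) * S 2 + ((- 2 / ?s) * S 1 + 1 / 3))"
      by (subst rcirc_add, (intro continuous_intros contK)+)+ (simp only: rcirc_mult_left rcirc_const S_def)
    finally show ?thesis using m0 by (simp add: mS[symmetric] diff_divide_distrib)
  qed
  ultimately have "(rcirc (\<lambda>z. cmod (K z) ^ 4 * ln (cmod (K z) ^ 4)) - m * ln m) / m \<le> E / m"
    by linarith
  then show ?thesis using m0 unfolding E_def[symmetric] by (simp add: divide_le_cancel)
qed

section \<open>Hypercontractivity\<close>

lemma continuous_on_sphere_scaled:
  assumes "f holomorphic_on ball 0 R" "0 \<le> s" "s < R"
  shows "continuous_on (sphere 0 1) (\<lambda>z. f (of_real s * z))"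
  by (rule continuous_on_compose2[OF holomorphic_on_imp_continuous_on[OF assms(1)]])
     (use assms in \<open>auto intro!: continuous_intros simp: norm_mult\<close>)

text \<open>For F = exp L, \<open>\<Phi> t\<close> is the logarithm of the norm of
  \<open>F (e t * z)\<close> in the exponent \<open>p t = 2 * exp (2 * t)\<close>, where
  \<open>e t = exp (- t)\<close>. The logarithmic Sobolev inequality is what makes
  \<open>\<Phi>\<close> nonincreasing. It applies at every exponent because
  \<open>exp (p t / 4 * L)\<close> is again holomorphic and zero-free, and the fourth power of its
  modulus is |F|^(p t).\<close>

lemma hypercontractive_exp:
  assumes hol: "L holomorphic_on ball 0 R" and R: "R > 1" and q: "q \<ge> 2"
  shows "rcirc (\<lambda>z. exp (q * Re (L (of_real (sqrt (2 / q)) * z)))) \<le>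
    rcirc (\<lambda>z. exp (2 * Re (L z))) powr (q / 2)"
proof -
  define p where "p t = 2 * exp (2 * t)" for t :: real
  define e where "e t = exp (- t)" for t :: real
  define u where "u t z = Re (L (of_real (e t) * z))" for t z
  \<comment> \<open>The radial derivative: \<open>- w t z\<close> is the derivative of
    \<open>u t z\<close> in \<open>t\<close>.\<close>
  define w where "w t z = Re (of_real (e t) * z * deriv L (of_real (e t) * z))" for t z
  define J where "J t = rcirc (\<lambda>z. exp (p t * u t z))" for t
  define J' where "J' t = rcirc (\<lambda>z. exp (p t * u t z) * (2 * p t * u t z - p t * w t z))" for t
  \<comment> \<open>\<open>R > 1\<close> puts 0 into the interior of \<open>U\<close>, so that
    two-sided derivatives exist at the starting time as well.\<close>
  define U where "U = {- ln R<..}"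
  have U: "open U" "convex U" "0 \<in> U" using R by (auto simp: U_def)
  have e: "0 < e t" "t \<in> U \<Longrightarrow> e t < R" for t
  proof -
    show "0 < e t" by (simp add: e_def)
    assume "t \<in> U" then have "- t < ln R" by (simp add: U_def)
    then show "e t < R" unfolding e_def using R by (metis exp_less_mono exp_ln less_trans zero_less_one)
  qed
  have holL': "deriv L holomorphic_on ball 0 R" by (intro holomorphic_deriv hol) simp
  have contL: "continuous_on (ball 0 R) L" "continuous_on (ball 0 R) (deriv L)"
    using hol holL' by (auto intro: holomorphic_on_imp_continuous_on)
  have in_ball: "of_real (e t) * z \<in> ball 0 R" if "t \<in> U" "cmod z = 1" for t z
    using e[of t] that by (simp add: norm_mult)
  have cont_u: "continuous_on (sphere 0 1) (u t)" if "t \<in> U" for t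
    unfolding u_def using continuous_on_sphere_scaled[OF hol, of "e t"] e[of t] that
    by (intro continuous_intros) auto
  have cont_w: "continuous_on (sphere 0 1) (w t)" if "t \<in> U" for t
    unfolding w_def using continuous_on_sphere_scaled[OF holL', of "e t"] e[of t] that
    by (intro continuous_intros) auto
  have p0: "p t > 0" for t by (simp add: p_def)
  have J0: "J t > 0" if "t \<in> U" for t
    unfolding J_def by (intro rcirc_pos continuous_intros cont_u that) simp
  have derJ: "(J has_real_derivative J' t) (at t)" if t: "t \<in> U" for t
  proof -
    define f where "f t \<theta> = exp (p t * u t (cis \<theta>))" for t \<theta>
    define fx where "fx t \<theta> = exp (p t * u t (cis \<theta>)) * (2 * p t * u t (cis \<theta>) - p t * w t (cis \<theta>))" for t \<theta>
    have "((\<lambda>t. integral (cbox 0 (2*pi)) (f t)) has_field_derivative integral (cbox 0 (2*pi)) (fx t)) (at t within U)"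
    proof (rule leibniz_rule_field_derivative)
      fix t \<theta> :: real assume t: "t \<in> U"
      have "(L has_field_derivative deriv L (of_real (e t) * cis \<theta>)) (at (of_real (e t) * cis \<theta>))"
        using hol in_ball[OF t] by (intro holomorphic_derivI) auto
      moreover have "((\<lambda>t. of_real (e t) * cis \<theta>) has_vector_derivative of_real (- e t) * cis \<theta>) (at t)"
      proof -
        have "(e has_real_derivative - e t) (at t)"
          unfolding e_def by (auto intro!: derivative_eq_intros)
        then have "((\<lambda>t. of_real (e t)) has_vector_derivative (of_real (- e t) :: complex)) (at t)"
          by (intro has_vector_derivative_of_real) (simp add: has_real_derivative_iff_has_vector_derivative)
        then show ?thesis by (intro has_vector_derivative_mult_left)
      qed
      ultimately have "(L \<circ> (\<lambda>t. of_real (e t) * cis \<theta>) has_vector_derivative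
          (of_real (- e t) * cis \<theta>) * deriv L (of_real (e t) * cis \<theta>)) (at t)"
        by (intro field_vector_diff_chain_at)
      then have "((\<lambda>t. L (of_real (e t) * cis \<theta>)) has_vector_derivative
          (of_real (- e t) * cis \<theta>) * deriv L (of_real (e t) * cis \<theta>)) (at t)"
        by (simp only: o_def)
      then have "((\<lambda>t. u t (cis \<theta>)) has_real_derivative - w t (cis \<theta>)) (at t)"
        unfolding u_def w_def has_vector_derivative_complex_iff by simp
      moreover have "(p has_real_derivative 2 * p t) (at t)"
        unfolding p_def by (auto intro!: derivative_eq_intros)
      ultimately have "(f' has_real_derivative fx t \<theta>) (at t)" if "f' = (\<lambda>t. f t \<theta>)" for f'
        unfolding that f_def fx_def by (auto intro!: derivative_eq_intros simp: algebra_simps)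
      then show "((\<lambda>t. f t \<theta>) has_field_derivative fx t \<theta>) (at t within U)"
        using has_field_derivative_at_within by blast
    next
      fix t assume "t \<in> U"
      then have "continuous_on (sphere 0 1) (\<lambda>z. exp (p t * u t z))"
        by (intro continuous_intros cont_u)
      from rcirc_integrable[OF this] show "f t integrable_on cbox 0 (2 * pi)"
        by (simp add: f_def[abs_def])
    next
      have c1: "continuous_on (U \<times> cbox 0 (2*pi)) (\<lambda>x. of_real (e (fst x)) * cis (snd x))"
        unfolding e_def by (intro continuous_intros)
      have c2: "(\<lambda>x. of_real (e (fst x)) * cis (snd x)) ` (U \<times> cbox 0 (2*pi)) \<subseteq> ball 0 R"
        using in_ball by force
      note cc = continuous_on_compose2[OF contL(1) c1 c2] continuous_on_compose2[OF contL(2) c1 c2]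
      show "continuous_on (U \<times> cbox 0 (2 * pi)) (\<lambda>(t, \<theta>). fx t \<theta>)"
        unfolding fx_def p_def u_def w_def split_beta
        by (intro continuous_intros cc c1)
    qed (use U t in auto)
    then have "((\<lambda>t. integral {0..2*pi} (f t) / (2*pi)) has_real_derivative integral {0..2*pi} (fx t) / (2*pi)) (at t)"
      using at_within_open[OF t U(1)] by (intro DERIV_cdivide) simp
    then show ?thesis unfolding J_def J'_def rcirc_def f_def[abs_def] fx_def[abs_def] .
  qed
  have LS: "2 * (rcirc (\<lambda>z. exp (p t * u t z) * (p t * u t z)) - J t * ln (J t))
      \<le> p t * rcirc (\<lambda>z. exp (p t * u t z) * w t z)" if t: "t \<in> U" for t
  proof -
    define h where "h z = of_real (p t / 4) * L (of_real (e t) * z)" for z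
    define K where "K z = exp (h z)" for z
    have sub: "(\<lambda>z. of_real (e t) * z) ` ball 0 (R / e t) \<subseteq> ball (0::complex) R"
      using e(1)[of t] by (auto simp: norm_mult field_simps)
    have holLt: "(\<lambda>z. L (of_real (e t) * z)) holomorphic_on ball 0 (R / e t)"
      using holomorphic_on_compose_gen[OF _ hol sub] by (simp add: o_def holomorphic_intros)
    have holK: "K holomorphic_on ball 0 (R / e t)"
      unfolding K_def h_def by (intro holomorphic_intros holLt)
    have K4: "cmod (K z) ^ 4 = exp (p t * u t z)" for z
      by (simp add: K_def h_def u_def norm_exp_eq_Re flip: exp_of_nat_mult)
    have dK: "z * (2 * K z * deriv K z) * cnj (K z * K z) = of_real (exp (p t * u t z)) * (of_real (p t / 2) * (of_real (e t) * z * deriv L (of_real (e t) * z)))"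
      if z: "cmod z = 1" for z
    proof -
      have "(L has_field_derivative deriv L (of_real (e t) * z)) (at (of_real (e t) * z))"
        using hol in_ball[OF t z] by (intro holomorphic_derivI) auto
      then have "((\<lambda>z. L (of_real (e t) * z)) has_field_derivative deriv L (of_real (e t) * z) * of_real (e t)) (at z)"
        by (rule DERIV_chain2) (auto intro!: derivative_eq_intros)
      then have "(K has_field_derivative K z * (of_real (p t / 4) * (deriv L (of_real (e t) * z) * of_real (e t)))) (at z)"
        unfolding K_def h_def by (auto intro!: derivative_eq_intros)
      then have eq: "deriv K z = K z * (of_real (p t / 4) * (deriv L (of_real (e t) * z) * of_real (e t)))"
        by (rule DERIV_imp_deriv)
      have half: "of_real (p t / 2) = 2 * (of_real (p t / 4) :: complex)" by simp
      have "z * (2 * K z * deriv K z) * cnj (K z * K z) = (K z * cnj (K z)) * (K z * cnj (K z))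
          * (of_real (p t / 2) * (of_real (e t) * z * deriv L (of_real (e t) * z)))"
        by (simp only: eq half complex_cnj_mult mult_ac)
      also have "(K z * cnj (K z)) * (K z * cnj (K z)) = of_real (cmod (K z) ^ 4)"
        by (simp add: complex_norm_square[symmetric] power4_eq_xxxx power2_eq_square)
      finally show ?thesis by (simp only: K4)
    qed
    have "rcirc (\<lambda>z. cmod (K z) ^ 4 * ln (cmod (K z) ^ 4)) - J t * ln (J t)
      \<le> rcirc (\<lambda>z. Re (z * (2 * K z * deriv K z) * cnj (K z * K z)))"
      using analytic_log_Sobolev[OF holK] e[of t] t unfolding J_def K4
      by (simp add: K_def)
    also have "\<dots> = rcirc (\<lambda>z. (p t / 2) * (exp (p t * u t z) * w t z))"
      by (rule rcirc_cong, subst dK) (simp_all add: w_def)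
    also have "\<dots> = (p t / 2) * rcirc (\<lambda>z. exp (p t * u t z) * w t z)" by (rule rcirc_mult_left)
    finally show ?thesis unfolding K4 by simp
  qed
  define \<Phi> where "\<Phi> t = ln (J t) / p t" for t
  \<comment> \<open>The time at which \<open>p T = q\<close>; there
    \<open>e T = sqrt (2 / q)\<close>, which is the radius in the claim.\<close>
  define T where "T = ln (q / 2) / 2"
  have T: "0 \<le> T" using q by (simp add: T_def)
  have "\<Phi> T \<le> \<Phi> 0"
  proof (rule DERIV_nonpos_imp_nonincreasing[OF T])
    fix t assume "0 \<le> t" "t \<le> T"
    then have t: "t \<in> U" using R by (auto simp: U_def intro: less_le_trans[of _ 0])
    have "(p has_real_derivative 2 * p t) (at t)"
      unfolding p_def by (auto intro!: derivative_eq_intros)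
    then have D: "(\<Phi> has_real_derivative (J' t / J t * p t - ln (J t) * (2 * p t)) / (p t * p t)) (at t)"
      unfolding \<Phi>_def using derJ[OF t] J0[OF t] p0[of t]
      by (auto intro!: derivative_eq_intros)
    have "J' t = rcirc (\<lambda>z. 2 * (exp (p t * u t z) * (p t * u t z)) + (- p t) * (exp (p t * u t z) * w t z))"
      unfolding J'_def by (rule rcirc_cong) (simp add: algebra_simps)
    also have "\<dots> = 2 * rcirc (\<lambda>z. exp (p t * u t z) * (p t * u t z)) + (- p t) * rcirc (\<lambda>z. exp (p t * u t z) * w t z)"
      by (subst rcirc_add, (intro continuous_intros cont_u[OF t] cont_w[OF t])+) (simp only: rcirc_mult_left)
    finally have "J' t \<le> 2 * J t * ln (J t)" using LS[OF t] by simp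
    then have "J' t / J t \<le> 2 * ln (J t)" using J0[OF t] by (simp add: field_simps)
    then have "J' t / J t * p t \<le> 2 * ln (J t) * p t" using p0[of t] by (intro mult_right_mono) auto
    then have "(J' t / J t * p t - ln (J t) * (2 * p t)) / (p t * p t) \<le> 0"
      using p0[of t] by (intro divide_nonpos_pos) auto
    with D show "\<exists>d. (\<Phi> has_real_derivative d) (at t) \<and> d \<le> 0" by blast
  qed
  moreover have pT: "p T = q" using q by (simp add: p_def T_def)
  moreover have "p 0 = 2" by (simp add: p_def)
  ultimately have "ln (J T) \<le> (q / 2) * ln (J 0)" using q by (simp add: \<Phi>_def field_simps)
  moreover have TU: "T \<in> U" using T R by (auto simp: U_def intro: less_le_trans[of _ 0])
  ultimately have "J T \<le> J 0 powr (q / 2)"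
    using J0[OF TU] J0[OF U(3)] by (simp add: powr_def ln_ge_iff[symmetric] ln_le_cancel_iff flip: ln_le_cancel_iff)
  moreover have "e T = sqrt (2 / q)"
  proof -
    have "e T = exp (ln (2 / q) / 2)" using q by (simp add: e_def T_def ln_div field_simps)
    also have "\<dots> = (2 / q) powr (1 / 2)" using q by (simp add: powr_def)
    also have "\<dots> = sqrt (2 / q)" using q by (simp add: powr_half_sqrt)
    finally show ?thesis .
  qed
  ultimately show ?thesis unfolding J_def u_def pT by (simp add: p_def e_def)
qed

text \<open>A zero \<open>a\<close> in the open disc is moved to its mirror image: the factor
  \<open>z - a\<close> becomes \<open>1 - cnj a * z\<close>, which has the same modulus on the
  circle, a modulus at least as large inside, and no zero in the disc. Zeros on the circle are
  kept.\<close>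

lemma reflect_zeros:
  fixes P :: "complex poly"
  assumes "P \<noteq> 0"
  shows "\<exists>Q. (\<forall>z. cmod z < 1 \<longrightarrow> poly Q z \<noteq> 0) \<and> (\<forall>z. cmod z = 1 \<longrightarrow> cmod (poly Q z) = cmod (poly P z))
    \<and> (\<forall>z. cmod z \<le> 1 \<longrightarrow> cmod (poly P z) \<le> cmod (poly Q z))"
  using assms
proof (induction "degree P" arbitrary: P rule: less_induct)
  case less
  show ?case
  proof (cases "degree P = 0")
    case True
    then obtain c where "P = [:c:]" by (rule degree_eq_zeroE)
    with less.prems show ?thesis by (intro exI[of _ P]) auto
  next
    case False
    then have "\<not> constant (poly P)" by (simp add: constant_degree)
    then obtain a where "poly P a = 0" using fundamental_theorem_of_algebra by blast
    then obtain P1 where P: "P = [:- a, 1:] * P1" by (auto simp: poly_eq_0_iff_dvd dvd_def)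
    with less.prems have "P1 \<noteq> 0" by auto
    then have "degree P = Suc (degree P1)" unfolding P by (subst degree_mult_eq) auto
    then obtain Q1 where Q1: "\<And>z. cmod z < 1 \<Longrightarrow> poly Q1 z \<noteq> 0"
      "\<And>z. cmod z = 1 \<Longrightarrow> cmod (poly Q1 z) = cmod (poly P1 z)"
      "\<And>z. cmod z \<le> 1 \<Longrightarrow> cmod (poly P1 z) \<le> cmod (poly Q1 z)"
      using less.hyps[of P1] \<open>P1 \<noteq> 0\<close> by auto
    show ?thesis
    proof (cases "cmod a \<ge> 1")
      case True
      have pQ: "poly ([:- a, 1:] * Q) z = (z - a) * poly Q z" for Q z by (simp add: algebra_simps)
      show ?thesis unfolding P
        by (rule exI[of _ "[:- a, 1:] * Q1"], unfold pQ)
           (use True in \<open>auto simp: Q1 norm_mult intro!: mult_left_mono\<close>)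
    next
      case False
      have key: "(cmod (1 - cnj a * z))\<^sup>2 - (cmod (z - a))\<^sup>2 = (1 - (cmod a)\<^sup>2) * (1 - (cmod z)\<^sup>2)" for z
        unfolding cmod_power2 by (simp add: power2_eq_square algebra_simps)
      have le: "cmod (z - a) \<le> cmod (1 - cnj a * z)" if "cmod z \<le> 1" for z
      proof -
        have "0 \<le> (1 - (cmod a)\<^sup>2) * (1 - (cmod z)\<^sup>2)"
          using that False by (intro mult_nonneg_nonneg) (auto simp: power_le_one)
        then have "(cmod (z - a))\<^sup>2 \<le> (cmod (1 - cnj a * z))\<^sup>2" using key[of z] by linarith
        then show ?thesis by simp
      qed
      have eq: "cmod (z - a) = cmod (1 - cnj a * z)" if "cmod z = 1" for z
      proof -
        have "(cmod (z - a))\<^sup>2 = (cmod (1 - cnj a * z))\<^sup>2" using key[of z] that by simp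
        then show ?thesis by simp
      qed
      have ne: "1 - cnj a * z \<noteq> 0" if "cmod z < 1" for z
      proof
        assume "1 - cnj a * z = 0"
        then have "cmod (cnj a * z) = 1" by (metis eq_iff_diff_eq_0 norm_one)
        moreover have "cmod a * cmod z < 1 * 1" using False that
          by (intro mult_strict_mono') auto
        ultimately show False by (simp add: norm_mult)
      qed
      have pQ: "poly ([:1, - cnj a:] * Q1) z = (1 - cnj a * z) * poly Q1 z" for z by (simp add: algebra_simps)
      have pP: "poly P z = (z - a) * poly P1 z" for z by (simp add: P algebra_simps)
      show ?thesis
        by (rule exI[of _ "[:1, - cnj a:] * Q1"], unfold pQ pP)
           (use ne in \<open>auto simp: norm_mult Q1 eq le intro!: mult_mono\<close>)
    qed
  qed
qed

text \<open>Weissler's inequality for one variable.\<close>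

lemma hypercontractive_polynomial:
  assumes q: "q \<ge> 2"
  shows "rcirc (\<lambda>z. cmod (poly P (of_real (sqrt (2 / q)) * z)) powr q) \<le> psq P powr (q / 2)"
proof (cases "P = 0")
  case True
  then show ?thesis using q by (simp add: rcirc_const)
next
  case False
  define \<rho> where "\<rho> = sqrt (2 / q)"
  have \<rho>: "0 < \<rho>" "\<rho> \<le> 1" using q by (auto simp: \<rho>_def)
  obtain Q where Q: "\<And>z. cmod z < 1 \<Longrightarrow> poly Q z \<noteq> 0"
      "\<And>z. cmod z = 1 \<Longrightarrow> cmod (poly Q z) = cmod (poly P z)"
      "\<And>z. cmod z \<le> 1 \<Longrightarrow> cmod (poly P z) \<le> cmod (poly Q z)"
    using reflect_zeros[OF False] by blast
  have cont: "continuous_on (sphere 0 1) (\<lambda>z. cmod (poly A (c * z)) powr q)" for A c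
    using q by (intro continuous_intros continuous_on_powr') auto
  have psqQ: "psq Q = psq P"
    unfolding psq_rcirc by (rule rcirc_cong) (simp add: Q)
  \<comment> \<open>\<open>Q\<close> may still vanish on the circle. Its dilate by
    \<open>s < 1\<close> is zero-free on a disc of radius \<open>1 / s > 1\<close> and therefore has
    a holomorphic logarithm there; the limit as \<open>s\<close> tends to 1 is taken
    afterwards.\<close>
  have s: "rcirc (\<lambda>z. cmod (poly Q (of_real (s * \<rho>) * z)) powr q) \<le> psq Q powr (q / 2)" if s: "0 < s" "s < 1" for s
  proof -
    let ?F = "\<lambda>z. poly Q (of_real s * z)"
    have "?F holomorphic_on ball 0 (1 / s)" by (intro holomorphic_intros)
    moreover have "?F z \<noteq> 0" if "z \<in> ball 0 (1 / s)" for z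
      using that s by (intro Q) (simp add: norm_mult field_simps)
    ultimately obtain L where L: "L holomorphic_on ball 0 (1 / s)" "\<And>z. z \<in> ball 0 (1 / s) \<Longrightarrow> ?F z = exp (L z)"
      using contractible_imp_holomorphic_log[of ?F "ball 0 (1 / s)"]
      by (metis convex_ball convex_imp_contractible)
    have F: "cmod (?F z) = exp (Re (L z))" if "cmod z \<le> 1" for z
    proof -
      have "1 < 1 / s" using s by simp
      with that have "z \<in> ball 0 (1 / s)" by simp
      then show ?thesis by (simp add: L(2) norm_exp_eq_Re)
    qed
    have "rcirc (\<lambda>z. cmod (poly Q (of_real (s * \<rho>) * z)) powr q) = rcirc (\<lambda>z. exp (q * Re (L (of_real \<rho> * z))))"
    proof (rule rcirc_cong)
      fix z :: complex assume z: "cmod z = 1"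
      have "cmod (poly Q (of_real (s * \<rho>) * z)) = exp (Re (L (of_real \<rho> * z)))"
        using F[of "of_real \<rho> * z"] z \<rho> by (simp add: norm_mult mult.assoc)
      then show "cmod (poly Q (of_real (s * \<rho>) * z)) powr q = exp (q * Re (L (of_real \<rho> * z)))"
        by (simp add: powr_def)
    qed
    also have "\<dots> \<le> rcirc (\<lambda>z. exp (2 * Re (L z))) powr (q / 2)"
      unfolding \<rho>_def by (rule hypercontractive_exp[OF L(1) _ q]) (use s in simp)
    also have "rcirc (\<lambda>z. exp (2 * Re (L z))) = rcirc (\<lambda>z. (cmod (poly (pcompose Q [:0, of_real s:]) z))\<^sup>2)"
    proof (rule rcirc_cong)
      fix z :: complex assume "cmod z = 1"
      then have "exp (2 * Re (L z)) = (cmod (?F z))\<^sup>2" by (simp add: F exp_double)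
      then show "exp (2 * Re (L z)) = (cmod (poly (pcompose Q [:0, of_real s:]) z))\<^sup>2"
        by (simp add: poly_pcompose mult.commute)
    qed
    also have "\<dots> = psq (pcompose Q [:0, of_real s:])" by (rule psq_rcirc[symmetric])
    \<comment> \<open>Dilation by \<open>s\<close> multiplies the n-th coefficient by
      \<open>s ^ n\<close>, so it can only decrease \<open>psq\<close>.\<close>
    also have "\<dots> powr (q / 2) \<le> psq Q powr (q / 2)"
    proof (intro powr_mono2 psq_nonneg)
      have d: "degree (pcompose Q [:0, of_real s:]) \<le> degree Q" using s by (simp add: degree_pcompose)
      have "(cmod (coeff (pcompose Q [:0, of_real s:]) n))\<^sup>2 \<le> (cmod (coeff Q n))\<^sup>2" for n
      proof -
        have "coeff (pcompose Q [:0, of_real s:]) n = of_real (s ^ n) * coeff Q n"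
          using coeff_pcompose_linear[of Q "of_real s" n] by simp
        moreover have "s ^ n \<le> 1" using s by (simp add: power_le_one)
        ultimately show ?thesis using s
          by (intro power_mono) (auto simp: norm_mult norm_power intro: mult_left_le_one_le)
      qed
      then show "psq (pcompose Q [:0, of_real s:]) \<le> psq Q"
        unfolding psq_eq[OF d] psq_eq[of Q, OF order_refl] by (rule sum_mono)
    qed (use q in simp)
    finally show ?thesis .
  qed
  define r where "r n = 1 - 1 / real (n + 2)" for n
  have r: "0 < r n" "r n < 1" for n by (auto simp: r_def field_simps)
  have rlim: "r \<longlonglongrightarrow> 1"
    unfolding r_def by real_asymp
  obtain B where B: "\<And>z. cmod z \<le> 1 \<Longrightarrow> cmod (poly Q z) \<le> B"
  proof -
    have "compact ((\<lambda>z. cmod (poly Q z)) ` cball 0 1)"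
      by (intro compact_continuous_image continuous_intros compact_cball)
    then have "bdd_above ((\<lambda>z. cmod (poly Q z)) ` cball 0 1)"
      by (intro bounded_imp_bdd_above compact_imp_bounded)
    then obtain M where "\<And>z. z \<in> cball 0 1 \<Longrightarrow> cmod (poly Q z) \<le> M" unfolding bdd_above_def by blast
    then show ?thesis by (intro that[of M]) simp
  qed
  have "(\<lambda>n. rcirc (\<lambda>z. cmod (poly Q (of_real (r n * \<rho>) * z)) powr q)) \<longlonglongrightarrow>
      rcirc (\<lambda>z. cmod (poly Q (of_real \<rho> * z)) powr q)"
  proof (rule rcirc_tendsto[where B = "B powr q"])
    show "continuous_on (sphere 0 1) (\<lambda>z. cmod (poly Q (of_real (r n * \<rho>) * z)) powr q)" for n by (rule cont)
    show "\<bar>cmod (poly Q (of_real (r n * \<rho>) * z)) powr q\<bar> \<le> B powr q" if "cmod z = 1" for n z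
    proof -
      have "r n * \<rho> \<le> 1 * 1" using r[of n] \<rho> by (intro mult_mono) auto
      then have "cmod (of_real (r n * \<rho>) * z) \<le> 1" using that r[of n] \<rho> by (simp add: norm_mult abs_mult)
      then show ?thesis using B q by (auto intro!: powr_mono2)
    qed
    show "(\<lambda>n. cmod (poly Q (of_real (r n * \<rho>) * z)) powr q) \<longlonglongrightarrow> cmod (poly Q (of_real \<rho> * z)) powr q" if "cmod z = 1" for z
    proof -
      have "(\<lambda>n. poly Q (of_real (r n * \<rho>) * z)) \<longlonglongrightarrow> poly Q (of_real (1 * \<rho>) * z)"
        by (intro tendsto_intros rlim)
      then show ?thesis using q by (intro tendsto_powr' tendsto_norm tendsto_const) auto
    qed
  qed
  then have Qle: "rcirc (\<lambda>z. cmod (poly Q (of_real \<rho> * z)) powr q) \<le> psq Q powr (q / 2)"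
    by (rule LIMSEQ_le_const2) (use s r in blast)
  \<comment> \<open>On the circle of radius \<open>\<rho>\<close>, inside the disc, \<open>Q\<close>
    dominates \<open>P\<close>, while on the unit circle the moduli agree, so the right-hand sides
    coincide.\<close>
  have "rcirc (\<lambda>z. cmod (poly P (of_real \<rho> * z)) powr q) \<le> rcirc (\<lambda>z. cmod (poly Q (of_real \<rho> * z)) powr q)"
  proof (rule rcirc_mono[OF cont cont])
    fix z :: complex assume "cmod z = 1"
    then have "cmod (of_real \<rho> * z) \<le> 1" using \<rho> by (simp add: norm_mult)
    then show "cmod (poly P (of_real \<rho> * z)) powr q \<le> cmod (poly Q (of_real \<rho> * z)) powr q"
      using Q(3) q by (intro powr_mono2) auto
  qed
  with Qle show ?thesis unfolding \<rho>_def psqQ by simp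
qed

section \<open>Minkowski's inequality in L_s\<close>

lemma convex_on_powr_nonneg:
  assumes "p \<ge> 1" shows "convex_on {0..} (\<lambda>x::real. x powr p)"
proof (rule convex_onI)
  fix t x y :: real assume t: "0 < t" "t < 1" and xy: "x \<in> {0..}" "y \<in> {0..}"
  have le: "a powr p \<le> a" if "0 < a" "a < 1" for a :: real
    using powr_mono'[of 1 p a] that assms by simp
  consider "x = 0" | "y = 0" | "x > 0" "y > 0" using xy by fastforce
  then show "((1 - t) *\<^sub>R x + t *\<^sub>R y) powr p \<le> (1 - t) * x powr p + t * y powr p"
  proof cases
    case 1
    then show ?thesis using t xy le[of t] by (simp add: powr_mult mult_right_mono)
  next
    case 2
    then show ?thesis using t xy le[of "1 - t"] by (simp add: powr_mult mult_right_mono)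
  next
    case 3
    then show ?thesis using convex_onD[OF powr_convex[OF assms], of t x y] t by simp
  qed
qed auto

text \<open>Convexity of \<open>x powr s\<close>, used with weights proportional to
  \<open>u k = t k + e\<close>. The summand \<open>e\<close> keeps the weights positive and tends to
  0 at the end.\<close>

lemma integral_Minkowski_powr:
  fixes f :: "'k \<Rightarrow> 'a \<Rightarrow> real"
  assumes K: "finite K" and s: "s \<ge> 1"
    and f0: "\<And>k x. k \<in> K \<Longrightarrow> 0 \<le> f k x"
    and int: "\<And>k. k \<in> K \<Longrightarrow> integrable M (\<lambda>x. f k x powr s)"
    and intS: "integrable M (\<lambda>x. (\<Sum>k\<in>K. f k x) powr s)"
    and t0: "\<And>k. k \<in> K \<Longrightarrow> 0 \<le> t k"
    and le: "\<And>k. k \<in> K \<Longrightarrow> (\<integral>x. f k x powr s \<partial>M) \<le> t k powr s"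
  shows "(\<integral>x. (\<Sum>k\<in>K. f k x) powr s \<partial>M) \<le> (\<Sum>k\<in>K. t k) powr s"
proof (cases "K = {}")
  case True
  then show ?thesis by simp
next
  case False
  have step: "(\<integral>x. (\<Sum>k\<in>K. f k x) powr s \<partial>M) \<le> (\<Sum>k\<in>K. t k + e) powr s" if e: "e > 0" for e
  proof -
    define u where "u k = t k + e" for k
    define T where "T = (\<Sum>k\<in>K. u k)"
    have u: "u k > 0" if "k \<in> K" for k using t0[OF that] e by (simp add: u_def)
    have T: "T > 0" unfolding T_def using K False u by (intro sum_pos) auto
    have pt: "(\<Sum>k\<in>K. f k x) powr s \<le> (\<Sum>k\<in>K. T powr s * (u k / T) * (f k x powr s / u k powr s))" for x
    proof -
      have "(\<Sum>k\<in>K. f k x) = T * (\<Sum>k\<in>K. (u k / T) *\<^sub>R (f k x / u k))"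
        using T u by (force simp: sum_distrib_left intro!: sum.cong)
      also have "\<dots> powr s = T powr s * (\<Sum>k\<in>K. (u k / T) *\<^sub>R (f k x / u k)) powr s"
        using T u f0 by (intro powr_mult) 
      also have "\<dots> \<le> T powr s * (\<Sum>k\<in>K. (u k / T) * (f k x / u k) powr s)"
      proof (intro mult_left_mono convex_on_sum[OF K False convex_on_powr_nonneg[OF s]])
        show "(\<Sum>k\<in>K. u k / T) = 1" using T by (simp add: T_def flip: sum_divide_distrib)
      qed (use T u f0 in \<open>auto intro!: divide_nonneg_pos intro: less_imp_le\<close>)
      also have "\<dots> = (\<Sum>k\<in>K. T powr s * (u k / T) * (f k x powr s / u k powr s))"
        unfolding sum_distrib_left using u f0 by (intro sum.cong refl) (auto simp: powr_divide less_imp_le)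
      finally show ?thesis .
    qed
    have "(\<integral>x. (\<Sum>k\<in>K. f k x) powr s \<partial>M) \<le> (\<integral>x. (\<Sum>k\<in>K. T powr s * (u k / T) * (f k x powr s / u k powr s)) \<partial>M)"
      by (intro integral_mono intS Bochner_Integration.integrable_sum integrable_mult_right integrable_divide int pt) auto
    also have "\<dots> = (\<Sum>k\<in>K. T powr s * (u k / T) * ((\<integral>x. f k x powr s \<partial>M) / u k powr s))"
      by (subst Bochner_Integration.integral_sum) (auto intro!: integrable_mult_right integrable_divide int)
    also have "\<dots> \<le> (\<Sum>k\<in>K. T powr s * (u k / T) * 1)"
    proof (intro sum_mono mult_left_mono)
      fix k assume k: "k \<in> K"
      have "(\<integral>x. f k x powr s \<partial>M) \<le> u k powr s"
        using le[OF k] t0[OF k] e s by (intro order_trans[OF le[OF k]] powr_mono2) (auto simp: u_def)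
      then show "(\<integral>x. f k x powr s \<partial>M) / u k powr s \<le> 1" using u[OF k] by simp
    qed (use T u in \<open>auto intro: less_imp_le\<close>)
    also have "\<dots> = T powr s * ((\<Sum>k\<in>K. u k) / T)" by (simp add: sum_distrib_left sum_divide_distrib)
    also have "\<dots> = T powr s" using T by (simp add: T_def[symmetric])
    finally show ?thesis by (simp add: T_def u_def)
  qed
  show ?thesis
  proof (rule LIMSEQ_le_const)
    have "(\<lambda>n. (\<Sum>k\<in>K. t k + inverse (real (Suc n)))) \<longlonglongrightarrow> (\<Sum>k\<in>K. t k + 0)"
      by (intro tendsto_intros LIMSEQ_inverse_real_of_nat)
    then show "(\<lambda>n. (\<Sum>k\<in>K. t k + inverse (real (Suc n))) powr s) \<longlonglongrightarrow> (\<Sum>k\<in>K. t k) powr s"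
      using s t0 by (intro tendsto_powr' tendsto_const) (auto intro!: always_eventually sum_nonneg)
    show "\<exists>N. \<forall>n\<ge>N. (\<integral>x. (\<Sum>k\<in>K. f k x) powr s \<partial>M) \<le> (\<Sum>k\<in>K. t k + inverse (real (Suc n))) powr s"
      by (intro exI[of _ 0] allI impI step) auto
  qed
qed

section \<open>The torus with its normalized measure\<close>

abbreviation circle_measure :: "real measure" where
  "circle_measure \<equiv> uniform_measure lborel {0..2*pi}"

abbreviation torus :: "nat \<Rightarrow> (nat \<Rightarrow> real) measure" where
  "torus n \<equiv> PiM {..<n} (\<lambda>_. circle_measure)"

lemma prob_space_circle_measure: "prob_space circle_measure"
  by (rule prob_space_uniform_measure) auto

lemma prob_space_torus: "prob_space (torus n)"
  by (intro prob_space_PiM prob_space_circle_measure)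

lemma integral_circle_measure:
  assumes "continuous_on (sphere 0 1) g"
  shows "(\<integral>\<theta>. g (cis \<theta>) \<partial>circle_measure) = rcirc g"
proof -
  have c: "continuous_on {0..2*pi} (\<lambda>t. g (cis t))"
    by (rule continuous_on_compose2[OF assms]) (auto intro!: continuous_intros)
  have m: "(\<lambda>\<theta>. g (cis \<theta>)) \<in> borel_measurable borel"
    by (intro borel_measurable_continuous_onI continuous_on_compose2[OF assms] continuous_intros) auto
  have "(\<integral>\<theta>. g (cis \<theta>) \<partial>circle_measure) = (\<integral>\<theta>. (indicator {0..2*pi} \<theta> / (2*pi)) * g (cis \<theta>) \<partial>lborel)"
  proof -
    have "1 / ennreal (2 * pi) = ennreal (1 / (2 * pi))" using divide_ennreal[of 1 "2 * pi"] by simp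
    then have "circle_measure = density lborel (\<lambda>\<theta>. ennreal (indicator {0..2*pi} \<theta> / (2*pi)))"
      unfolding uniform_measure_def
      by (intro arg_cong[of _ _ "density lborel"]) (auto simp: fun_eq_iff split: split_indicator)
    then show ?thesis using m by (simp add: integral_density)
  qed
  also have "\<dots> = (\<integral>\<theta>. indicator {0..2*pi} \<theta> *\<^sub>R g (cis \<theta>) \<partial>lborel) / (2*pi)"
    by (simp flip: integral_divide_zero)
  also have "(\<integral>\<theta>. indicator {0..2*pi} \<theta> *\<^sub>R g (cis \<theta>) \<partial>lborel) = integral {0..2*pi} (\<lambda>\<theta>. g (cis \<theta>))"
  proof -
    have "set_integrable lborel {0..2*pi} (\<lambda>\<theta>. g (cis \<theta>))"
      by (rule borel_integrable_atLeastAtMost') (rule c)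
    from set_borel_integral_eq_integral(2)[OF this] show ?thesis by (simp add: set_lebesgue_integral_def)
  qed
  finally show ?thesis by (simp add: rcirc_def)
qed

lemma torus_integrable_bounded:
  fixes F :: "(nat \<Rightarrow> real) \<Rightarrow> 'b::{banach, second_countable_topology}"
  assumes "F \<in> borel_measurable (torus n)" "\<And>\<theta>. norm (F \<theta>) \<le> B"
  shows "integrable (torus n) F"
proof -
  interpret prob_space "torus n" by (rule prob_space_torus)
  show ?thesis by (rule integrable_const_bound[where B = B]) (use assms in auto)
qed

lemma measurable_torus_mon [measurable]:
  "(\<lambda>\<theta>. mon n \<alpha> (\<lambda>i. cis (\<theta> i))) \<in> borel_measurable (torus n)"
proof -
  have cis: "cis \<in> borel_measurable borel" by (intro borel_measurable_continuous_onI continuous_intros)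
  have "(\<lambda>\<theta>. cis (\<theta> i)) \<in> borel_measurable (torus n)" if "i < n" for i
    using measurable_compose[OF _ cis, of "\<lambda>\<theta>. \<theta> i" "torus n"] measurable_component_singleton[of i "{..<n}" "\<lambda>_. circle_measure"] that
    by simp
  then show ?thesis unfolding mon_def by (intro borel_measurable_prod borel_measurable_power) auto
qed

lemma norm_mon_cis: "cmod (mon n \<alpha> (\<lambda>i. cis (\<theta> i))) = 1"
  by (simp add: mon_def prod_norm[symmetric] norm_power)

text \<open>Weissler's inequality on the torus; Minkowski's inequality in \<open>L\<^bsup>q/2\<^esup>\<close> lets the variables be added one at a time.\<close>

lemma hypercontractive_torus:
  fixes c :: "(nat \<Rightarrow> nat) \<Rightarrow> complex"
  assumes q: "q \<ge> 2" and I: "finite I" and inj: "inj_on (\<lambda>\<alpha>. restrict \<alpha> {..<n}) I"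
  shows "(\<integral>\<theta>. cmod (\<Sum>\<alpha>\<in>I. c \<alpha> * of_real (sqrt (2 / q) ^ sum \<alpha> {..<n}) * mon n \<alpha> (\<lambda>i. cis (\<theta> i))) powr q \<partial>torus n)
    \<le> (\<Sum>\<alpha>\<in>I. (cmod (c \<alpha>))\<^sup>2) powr (q / 2)"
  using I inj
proof (induction n arbitrary: I)
  case 0
  \<comment> \<open>Without variables all restrictions coincide, so injectivity leaves at most one
    index.\<close>
  have "\<alpha> = \<beta>" if "\<alpha> \<in> I" "\<beta> \<in> I" for \<alpha> \<beta>
    by (rule inj_onD[OF 0(2) _ that]) (simp add: restrict_def)
  then consider "I = {}" | a where "I = {a}" by blast
  then show ?case
  proof cases
    case 2
    interpret prob_space "torus 0" by (rule prob_space_torus)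
    have "cmod (c a) powr q = ((cmod (c a))\<^sup>2) powr (q / 2)"
      by (simp add: powr_powr flip: powr_numeral)
    then show ?thesis unfolding 2 mon_def using prob_space by simp
  qed (use q in simp)
next
  case (Suc n)
  define \<rho> where "\<rho> = sqrt (2 / q)"
  define d where "d \<alpha> = c \<alpha> * of_real (\<rho> ^ sum \<alpha> {..<n})" for \<alpha>
  define g where "g \<alpha> \<theta> = d \<alpha> * mon n \<alpha> (\<lambda>i. cis (\<theta> i))" for \<alpha> \<theta>
  define F where "F \<theta> = (\<Sum>\<alpha>\<in>I. c \<alpha> * of_real (\<rho> ^ sum \<alpha> {..<Suc n}) * mon (Suc n) \<alpha> (\<lambda>i. cis (\<theta> i)))" for \<theta>
  define N where "N = Max (insert 0 ((\<lambda>\<alpha>. \<alpha> n) ` I))"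
  have N: "\<alpha> n \<le> N" if "\<alpha> \<in> I" for \<alpha> using Suc.prems(1) that by (auto simp: N_def)
  \<comment> \<open>Indices with the same last exponent are still separated by their first
    \<open>n\<close> entries, which is the injectivity that the induction hypothesis asks
    for.\<close>
  define J where "J k = {\<alpha> \<in> I. \<alpha> n = k}" for k
  have finJ: "finite (J k)" for k using Suc.prems(1) by (simp add: J_def)
  have injJ: "inj_on (\<lambda>\<alpha>. restrict \<alpha> {..<n}) (J k)" for k
  proof (rule inj_onI)
    fix \<alpha> \<beta> assume ab: "\<alpha> \<in> J k" "\<beta> \<in> J k" and eq: "restrict \<alpha> {..<n} = restrict \<beta> {..<n}"
    have "restrict \<alpha> {..<Suc n} = restrict \<beta> {..<Suc n}"
    proof
      fix i show "restrict \<alpha> {..<Suc n} i = restrict \<beta> {..<Suc n} i"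
        using fun_cong[OF eq, of i] ab by (auto simp: J_def less_Suc_eq)
    qed
    then show "\<alpha> = \<beta>" by (rule inj_onD[OF Suc.prems(2)]) (use ab in \<open>auto simp: J_def\<close>)
  qed
  define P where "P \<theta> = (\<Sum>\<alpha>\<in>I. monom (g \<alpha> \<theta>) (\<alpha> n))" for \<theta>
  have mon_Suc: "mon (Suc n) \<alpha> w = mon n \<alpha> w * w n ^ \<alpha> n" for \<alpha> w
    by (simp add: mon_def)
  have mon_upd: "mon n \<alpha> (\<lambda>i. cis ((\<theta>(n := t)) i)) = mon n \<alpha> (\<lambda>i. cis (\<theta> i))" for \<alpha> \<theta> t
    by (simp add: mon_def)
  have F_upd: "F (\<theta>(n := t)) = poly (P \<theta>) (of_real \<rho> * cis t)" for \<theta> t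
    by (simp add: F_def P_def poly_sum poly_monom mon_Suc mon_upd g_def d_def power_add power_mult_distrib mult_ac
        del: fun_upd_apply) (simp add: mult_ac)
  define C where "C k \<theta> = (\<Sum>\<alpha>\<in>J k. g \<alpha> \<theta>)" for k \<theta>
  have coeffP: "coeff (P \<theta>) k = C k \<theta>" for \<theta> k
    unfolding P_def C_def J_def coeff_sum using Suc.prems(1)
    by (simp add: sum.If_cases if_distrib Int_def conj_commute eq_commute cong: if_cong)
  have degP: "degree (P \<theta>) \<le> N" for \<theta>
    unfolding P_def by (intro degree_sum_le Suc.prems(1)) (use N degree_monom_le order_trans in blast)
  have psqP: "psq (P \<theta>) = (\<Sum>k\<le>N. (cmod (C k \<theta>))\<^sup>2)" for \<theta>
    by (simp add: psq_eq[OF degP] coeffP)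
  interpret product_sigma_finite "\<lambda>_::nat. circle_measure"
    unfolding product_sigma_finite_def by (intro allI prob_space_imp_sigma_finite prob_space_circle_measure)
  have measC[measurable]: "C k \<in> borel_measurable (torus n)" for k
    unfolding C_def g_def by measurable
  have C_bd: "cmod (C k \<theta>) \<le> (\<Sum>\<alpha>\<in>J k. cmod (d \<alpha>))" for k \<theta>
    unfolding C_def g_def by (rule sum_norm_le) (simp add: norm_mult norm_mon_cis)
  have measF: "F \<in> borel_measurable (torus m)" if "m = Suc n" for m
    unfolding F_def that by measurable
  have F_bd: "cmod (F \<theta>) \<le> (\<Sum>\<alpha>\<in>I. cmod (c \<alpha> * of_real (\<rho> ^ sum \<alpha> {..<Suc n})))" for \<theta>
    unfolding F_def by (rule sum_norm_le) (simp add: norm_mult norm_mon_cis del: sum.lessThan_Suc)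
  have q0: "q \<ge> 0" using q by simp
  have "(\<integral>\<theta>. cmod (F \<theta>) powr q \<partial>torus (Suc n)) = (\<integral>\<theta>. \<integral>t. cmod (F (\<theta>(n := t))) powr q \<partial>circle_measure \<partial>torus n)"
  proof -
    have "integrable (PiM (insert n {..<n}) (\<lambda>_. circle_measure)) (\<lambda>\<theta>. cmod (F \<theta>) powr q)"
      unfolding lessThan_Suc[symmetric]
    proof (rule torus_integrable_bounded)
      show "(\<lambda>\<theta>. cmod (F \<theta>) powr q) \<in> borel_measurable (torus (Suc n))" using measF[OF refl] by measurable
      show "norm (cmod (F \<theta>) powr q) \<le> (\<Sum>\<alpha>\<in>I. cmod (c \<alpha> * of_real (\<rho> ^ sum \<alpha> {..<Suc n}))) powr q" for \<theta>
        using powr_mono2[OF q0 norm_ge_zero F_bd] by simp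
    qed
    from product_integral_insert[OF _ _ this] show ?thesis by (simp add: lessThan_Suc)
  qed
  also have "\<dots> \<le> (\<integral>\<theta>. (\<Sum>k\<le>N. (cmod (C k \<theta>))\<^sup>2) powr (q / 2) \<partial>torus n)"
  proof (rule integral_mono')
    show "integrable (torus n) (\<lambda>\<theta>. (\<Sum>k\<le>N. (cmod (C k \<theta>))\<^sup>2) powr (q / 2))"
    proof (rule torus_integrable_bounded)
      show "norm ((\<Sum>k\<le>N. (cmod (C k \<theta>))\<^sup>2) powr (q / 2)) \<le> (\<Sum>k\<le>N. (\<Sum>\<alpha>\<in>J k. cmod (d \<alpha>))\<^sup>2) powr (q / 2)" for \<theta>
        using q by (auto intro!: powr_mono2 sum_mono power_mono C_bd sum_nonneg)
    qed measurable
    fix \<theta>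
    have "(\<integral>t. cmod (F (\<theta>(n := t))) powr q \<partial>circle_measure) = rcirc (\<lambda>z. cmod (poly (P \<theta>) (of_real \<rho> * z)) powr q)"
      unfolding F_upd using q
      by (intro integral_circle_measure continuous_intros continuous_on_powr') auto
    also have "\<dots> \<le> psq (P \<theta>) powr (q / 2)" unfolding \<rho>_def by (rule hypercontractive_polynomial[OF q])
    finally show "(\<integral>t. cmod (F (\<theta>(n := t))) powr q \<partial>circle_measure) \<le> (\<Sum>k\<le>N. (cmod (C k \<theta>))\<^sup>2) powr (q / 2)"
      by (simp only: psqP)
  qed simp
  also have "\<dots> \<le> (\<Sum>k\<le>N. \<Sum>\<alpha>\<in>J k. (cmod (c \<alpha>))\<^sup>2) powr (q / 2)"
  proof (rule integral_Minkowski_powr)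
    have sq: "((cmod (C k \<theta>))\<^sup>2) powr (q / 2) = cmod (C k \<theta>) powr q" for k \<theta>
      by (simp add: powr_powr flip: powr_numeral)
    show "integrable (torus n) (\<lambda>\<theta>. ((cmod (C k \<theta>))\<^sup>2) powr (q / 2))" for k
    proof (rule torus_integrable_bounded)
      show "norm (((cmod (C k \<theta>))\<^sup>2) powr (q / 2)) \<le> ((\<Sum>\<alpha>\<in>J k. cmod (d \<alpha>))\<^sup>2) powr (q / 2)" for \<theta>
        using q by (auto intro!: powr_mono2 power_mono C_bd)
    qed measurable
    show "integrable (torus n) (\<lambda>\<theta>. (\<Sum>k\<le>N. (cmod (C k \<theta>))\<^sup>2) powr (q / 2))"
    proof (rule torus_integrable_bounded)
      show "norm ((\<Sum>k\<le>N. (cmod (C k \<theta>))\<^sup>2) powr (q / 2)) \<le> (\<Sum>k\<le>N. (\<Sum>\<alpha>\<in>J k. cmod (d \<alpha>))\<^sup>2) powr (q / 2)" for \<theta>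
        using q by (auto intro!: powr_mono2 sum_mono power_mono C_bd sum_nonneg)
    qed measurable
    show "(\<integral>\<theta>. ((cmod (C k \<theta>))\<^sup>2) powr (q / 2) \<partial>torus n) \<le> (\<Sum>\<alpha>\<in>J k. (cmod (c \<alpha>))\<^sup>2) powr (q / 2)" for k
      unfolding sq unfolding C_def g_def d_def \<rho>_def by (rule Suc.IH[OF finJ injJ])
  qed (use q in \<open>auto intro: sum_nonneg\<close>)
  also have "(\<Sum>k\<le>N. \<Sum>\<alpha>\<in>J k. (cmod (c \<alpha>))\<^sup>2) = (\<Sum>\<alpha>\<in>I. (cmod (c \<alpha>))\<^sup>2)"
    unfolding J_def using N Suc.prems(1) by (intro sum.group) auto
  finally show ?case unfolding F_def \<rho>_def .
qed

section \<open>Factorization of summing operators\<close>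

definition sublinear :: "('a::real_vector \<Rightarrow> real) \<Rightarrow> bool" where
  "sublinear p \<longleftrightarrow> (\<forall>x y. p (x + y) \<le> p x + p y) \<and> (\<forall>c x. c \<ge> 0 \<longrightarrow> p (c *\<^sub>R x) = c * p x)"

lemma sublinearI:
  assumes add: "\<And>x y. p (x + y) \<le> p x + p y" and zero: "p 0 = 0"
    and scale: "\<And>c x. c > 0 \<Longrightarrow> p (c *\<^sub>R x) \<le> c * p x"
  shows "sublinear p"
proof -
  have "p (c *\<^sub>R x) = c * p x" if "c \<ge> 0" for c x
  proof (cases "c = 0")
    case False
    with that have c: "c > 0" by simp
    have "p x \<le> inverse c * p (c *\<^sub>R x)"
      using scale[of "inverse c" "c *\<^sub>R x"] c by simp
    with scale[OF c, of x] c show ?thesis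
      by (simp add: field_simps)
  qed (simp add: zero)
  with add show ?thesis by (simp add: sublinear_def)
qed

lemma sublinear_add: "sublinear p \<Longrightarrow> p (x + y) \<le> p x + p y"
  and sublinear_scale: "sublinear p \<Longrightarrow> c \<ge> 0 \<Longrightarrow> p (c *\<^sub>R x) = c * p x"
  by (simp_all add: sublinear_def)

lemma sublinear_0: "sublinear p \<Longrightarrow> p 0 = 0"
  using sublinear_scale[of p 0 0] by simp

lemma sublinear_minus: "sublinear p \<Longrightarrow> - p (- x) \<le> p x"
  using sublinear_add[of p x "- x"] sublinear_0[of p] by simp

text \<open>\<open>p\<close> is lowered along the directions \<open>A u\<close> as far as the
  domination of \<open>\<phi>\<close> permits; subadditivity bounds the infimum below by
  \<open>- p (- w)\<close>. A ray as the cone \<open>D\<close> serves the minimality argument in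
  \<open>linear_below_sublinear\<close>, the whole space serves
  \<open>Hahn_Banach_factor\<close>.\<close>

lemma sublinear_infimal_convolution:
  fixes p :: "'b::real_vector \<Rightarrow> real" and A :: "'a::real_vector \<Rightarrow> 'b" and \<phi> :: "'a \<Rightarrow> real"
  assumes p: "sublinear p" and A: "linear A" and \<phi>: "linear \<phi>"
    and D: "0 \<in> D" "\<And>u v. u \<in> D \<Longrightarrow> v \<in> D \<Longrightarrow> u + v \<in> D"
      "\<And>c u. c > 0 \<Longrightarrow> u \<in> D \<Longrightarrow> c *\<^sub>R u \<in> D"
    and le: "\<And>u. u \<in> D \<Longrightarrow> \<phi> u \<le> p (A u)"
  defines "p' \<equiv> \<lambda>w. INF u\<in>D. p (w + A u) - \<phi> u"
  shows "sublinear p'" and "\<And>w u. u \<in> D \<Longrightarrow> p' w \<le> p (w + A u) - \<phi> u"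
proof -
  have lb: "- p (- w) \<le> p (w + A u) - \<phi> u" if "u \<in> D" for w u
    using sublinear_add[OF p, of "w + A u" "- w"] le[OF that] by simp
  have bdd: "bdd_below ((\<lambda>u. p (w + A u) - \<phi> u) ` D)" for w
    using lb[of _ w] by (auto intro!: bdd_belowI[of _ "- p (- w)"])
  show p'_le: "p' w \<le> p (w + A u) - \<phi> u" if "u \<in> D" for w u
    unfolding p'_def using that by (intro cINF_lower bdd)
  have p'_ge: "k \<le> p' w" if "\<And>u. u \<in> D \<Longrightarrow> k \<le> p (w + A u) - \<phi> u" for k w
    unfolding p'_def using that D(1) by (intro cINF_greatest) auto
  show "sublinear p'"
  proof (rule sublinearI)
    fix x y
    have *: "p' (x + y) \<le> (p (x + A u) - \<phi> u) + (p (y + A v) - \<phi> v)" if "u \<in> D" "v \<in> D" for u v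
    proof -
      have "p' (x + y) \<le> p (x + y + A (u + v)) - \<phi> (u + v)"
        by (intro p'_le D(2) that)
      also have "x + y + A (u + v) = (x + A u) + (y + A v)"
        by (simp add: linear_add[OF A] algebra_simps)
      finally show ?thesis
        using sublinear_add[OF p, of "x + A u" "y + A v"] by (simp add: linear_add[OF \<phi>])
    qed
    have "p' (x + y) - (p (x + A u) - \<phi> u) \<le> p' y" if "u \<in> D" for u
      by (rule p'_ge) (use *[OF that] in \<open>force simp: algebra_simps\<close>)
    then have "p' (x + y) - p' y \<le> p' x"
      by (intro p'_ge) (force simp: algebra_simps)
    then show "p' (x + y) \<le> p' x + p' y" by simp
  next
    have "p' 0 \<le> 0" using p'_le[OF D(1), of 0] sublinear_0[OF p] linear_0[OF A] linear_0[OF \<phi>] by simp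
    moreover have "0 \<le> p' 0" by (rule p'_ge) (use le in simp)
    ultimately show "p' 0 = 0" by simp
  next
    fix c :: real and x assume c: "c > 0"
    have "p' (c *\<^sub>R x) / c \<le> p (x + A u) - \<phi> u" if "u \<in> D" for u
    proof -
      have "p' (c *\<^sub>R x) \<le> p (c *\<^sub>R x + A (c *\<^sub>R u)) - \<phi> (c *\<^sub>R u)"
        by (intro p'_le D(3) c that)
      also have "c *\<^sub>R x + A (c *\<^sub>R u) = c *\<^sub>R (x + A u)"
        by (simp add: linear_scale[OF A] scaleR_add_right)
      finally show ?thesis using c sublinear_scale[OF p, of c "x + A u"]
        by (simp add: linear_scale[OF \<phi>] field_simps)
    qed
    then have "p' (c *\<^sub>R x) / c \<le> p' x" by (rule p'_ge)
    then show "p' (c *\<^sub>R x) \<le> c * p' x" using c by (simp add: field_simps)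
  qed
qed

text \<open>The lower bounds required by Zorn's lemma. Every member of the chain stays above
  \<open>- p (- x)\<close>, so the infimum is finite; for subadditivity, the smaller of two members
  bounds both terms.\<close>

lemma sublinear_chain_Inf:
  fixes p :: "'a::real_vector \<Rightarrow> real"
  assumes C: "C \<noteq> {}" "\<And>g. g \<in> C \<Longrightarrow> sublinear g" "\<And>g x. g \<in> C \<Longrightarrow> g x \<le> p x"
    and chain: "\<And>g h. g \<in> C \<Longrightarrow> h \<in> C \<Longrightarrow> g \<le> h \<or> h \<le> g"
  shows "sublinear (\<lambda>x. INF g\<in>C. g x)" and "\<And>g x. g \<in> C \<Longrightarrow> (INF g\<in>C. g x) \<le> g x"
proof -
  let ?u = "\<lambda>x. INF g\<in>C. g x"
  have bdd: "bdd_below ((\<lambda>g. g x) ` C)" for x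
  proof (rule bdd_belowI2)
    fix g assume g: "g \<in> C"
    show "- p (- x) \<le> g x" using sublinear_minus[OF C(2)[OF g], of x] C(3)[OF g, of "- x"] by simp
  qed
  show lower: "?u x \<le> g x" if "g \<in> C" for g x
    using that by (intro cINF_lower bdd)
  show "sublinear ?u"
  proof (rule sublinearI)
    fix x y
    have *: "?u (x + y) \<le> g x + h y" if gh: "g \<in> C" "h \<in> C" for g h
    proof -
      have g: "?u (x + y) \<le> g x + g y"
        using lower[OF gh(1), of "x + y"] sublinear_add[OF C(2)[OF gh(1)], of x y] by linarith
      have h: "?u (x + y) \<le> h x + h y"
        using lower[OF gh(2), of "x + y"] sublinear_add[OF C(2)[OF gh(2)], of x y] by linarith
      from chain[OF gh] show ?thesis
      proof
        assume "g \<le> h" then have "g y \<le> h y" by (rule le_funD)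
        with g show ?thesis by linarith
      next
        assume "h \<le> g" then have "h x \<le> g x" by (rule le_funD)
        with h show ?thesis by linarith
      qed
    qed
    have "?u (x + y) - g x \<le> ?u y" if "g \<in> C" for g
      by (rule cINF_greatest[OF C(1)]) (use *[OF that] in \<open>force simp: algebra_simps\<close>)
    then have "?u (x + y) - ?u y \<le> ?u x"
      by (intro cINF_greatest[OF C(1)]) (force simp: algebra_simps)
    then show "?u (x + y) \<le> ?u x + ?u y" by simp
  next
    have "?u 0 = (INF g\<in>C. 0)" by (intro INF_cong refl) (simp add: sublinear_0 C(2))
    then show "?u 0 = 0" using C(1) by simp
  next
    fix c :: real and x assume c: "c > 0"
    have "?u (c *\<^sub>R x) / c \<le> ?u x"
    proof (rule cINF_greatest[OF C(1)])
      fix g assume g: "g \<in> C"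
      show "?u (c *\<^sub>R x) / c \<le> g x"
        using lower[OF g, of "c *\<^sub>R x"] sublinear_scale[OF C(2)[OF g], of c x] c by (simp add: field_simps)
    qed
    then show "?u (c *\<^sub>R x) \<le> c * ?u x" using c by (simp add: field_simps)
  qed
qed

text \<open>A minimal sublinear functional is linear, so no subspaces or extensions need to be handled.\<close>

lemma linear_below_sublinear:
  fixes p :: "'a::real_vector \<Rightarrow> real"
  assumes p: "sublinear p"
  shows "\<exists>f. linear f \<and> (\<forall>x. f x \<le> p x)"
proof -
  let ?S = "{g. sublinear g \<and> g \<le> p}"
  let ?P = "\<lambda>g h :: 'a \<Rightarrow> real. h \<le> g"
  have "\<exists>m\<in>?S. \<forall>a\<in>?S. ?P m a \<longrightarrow> a = m"
  proof (rule predicate_Zorn)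
    show "partial_order_on ?S (relation_of ?P ?S)"
      by (rule partial_order_on_relation_ofI) auto
  next
    fix C assume C: "C \<in> Chains (relation_of ?P ?S)"
    have CS: "C \<subseteq> ?S" and ch: "\<And>g h. g \<in> C \<Longrightarrow> h \<in> C \<Longrightarrow> g \<le> h \<or> h \<le> g"
      using C by (auto simp: Chains_def relation_of_def)
    show "\<exists>u\<in>?S. \<forall>a\<in>C. ?P a u"
    proof (cases "C = {}")
      case True
      then show ?thesis using p by auto
    next
      case False
      have 1: "g \<in> C \<Longrightarrow> sublinear g" and 2: "g \<in> C \<Longrightarrow> g x \<le> p x" for g x
        using CS by (auto simp: le_fun_def)
      have I: "sublinear (\<lambda>x. INF g\<in>C. g x)" "\<And>g x. g \<in> C \<Longrightarrow> (INF g\<in>C. g x) \<le> g x"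
        by (rule sublinear_chain_Inf[of C p]; use False 1 2 ch in blast)+
      let ?u = "\<lambda>x. INF g\<in>C. g x"
      have "?u \<le> p"
      proof (rule le_funI)
        fix x
        obtain g where "g \<in> C" using False by blast
        then show "?u x \<le> p x" using I(2)[of g x] 2[of g x] by linarith
      qed
      then have "?u \<in> ?S" using I(1) by simp
      moreover have "\<forall>a\<in>C. ?u \<le> a" by (auto intro!: le_funI I(2))
      ultimately show ?thesis by blast
    qed
  qed
  then obtain g where g: "sublinear g" "g \<le> p" and min: "\<And>h. sublinear h \<Longrightarrow> h \<le> p \<Longrightarrow> h \<le> g \<Longrightarrow> h = g"
    by auto
  \<comment> \<open>Lowering \<open>g\<close> along the ray through \<open>x0\<close> gives a
    sublinear functional below \<open>g\<close>, hence \<open>g\<close> itself by minimality. Its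
    value at \<open>- x0\<close>, estimated with \<open>t = 1\<close>, is at most
    \<open>- g x0\<close>.\<close>
  have neg: "g (- x0) = - g x0" for x0
  proof -
    let ?g' = "\<lambda>w. INF t\<in>{0..}. g (w + t *\<^sub>R x0) - t * g x0"
    have lin1: "linear (\<lambda>t::real. t *\<^sub>R x0)" by (intro linearI) (auto simp: scaleR_add_left)
    have lin2: "linear (\<lambda>t::real. t * g x0)" by (intro linearI) (auto simp: algebra_simps)
    note I = sublinear_infimal_convolution[OF g(1) lin1 lin2, of "{0..}"]
    have sub: "sublinear ?g'" and le: "\<And>w u. u \<in> {0..} \<Longrightarrow> ?g' w \<le> g (w + u *\<^sub>R x0) - u * g x0"
      by (rule I; use sublinear_scale[OF g(1)] in force)+
    have "?g' w \<le> g w" for w using le[of 0 w] by simp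
    then have "?g' \<le> g" by (rule le_funI)
    moreover from this have "?g' \<le> p" using g(2) by (rule order_trans)
    ultimately have "?g' = g" using min[OF sub] by blast
    then have "g (- x0) = ?g' (- x0)" by (rule fun_cong[symmetric])
    also have "\<dots> \<le> g (- x0 + 1 *\<^sub>R x0) - 1 * g x0" by (rule le) simp
    also have "\<dots> = - g x0" by (simp add: sublinear_0[OF g(1)])
    finally have "g (- x0) \<le> - g x0" .
    with sublinear_minus[OF g(1), of x0] show ?thesis by linarith
  qed
  have "linear g"
  proof (rule linearI)
    fix x y
    have "g (- (x + y)) \<le> g (- x) + g (- y)" using sublinear_add[OF g(1), of "- x" "- y"] by simp
    then show "g (x + y) = g x + g y" using sublinear_add[OF g(1), of x y] neg[of "x + y"] neg[of x] neg[of y] by linarith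
  next
    fix c x
    show "g (c *\<^sub>R x) = c *\<^sub>R g x"
    proof (cases "c \<ge> 0")
      case True then show ?thesis by (simp add: sublinear_scale[OF g(1)])
    next
      case False
      then have "g ((- c) *\<^sub>R x) = (- c) * g x" by (intro sublinear_scale[OF g(1)]) auto
      then show ?thesis by (simp add: neg)
    qed
  qed
  with g(2) show ?thesis by (auto simp: le_fun_def)
qed

text \<open>\<open>A\<close> takes the place of the inclusion of a subspace. At \<open>- A v\<close>
  the lowered functional is at most \<open>- \<phi> v\<close>, so every linear functional below it
  satisfies \<open>\<phi> v \<le> f (A v)\<close>; passing to \<open>- v\<close> gives
  equality.\<close>

theorem Hahn_Banach_factor:
  fixes p :: "'b::real_vector \<Rightarrow> real" and A :: "'a::real_vector \<Rightarrow> 'b" and \<phi> :: "'a \<Rightarrow> real"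
  assumes p: "sublinear p" and A: "linear A" and \<phi>: "linear \<phi>" and le: "\<And>u. \<phi> u \<le> p (A u)"
  shows "\<exists>f. linear f \<and> (\<forall>w. f w \<le> p w) \<and> (\<forall>u. f (A u) = \<phi> u)"
proof -
  let ?p = "\<lambda>w. INF u\<in>UNIV. p (w + A u) - \<phi> u"
  have sub: "sublinear ?p" and ple: "\<And>w u. ?p w \<le> p (w + A u) - \<phi> u"
    using sublinear_infimal_convolution[OF p A \<phi>, of UNIV] le by auto
  obtain f where f: "linear f" "\<And>w. f w \<le> ?p w" using linear_below_sublinear[OF sub] by blast
  have "f w \<le> p w" for w using f(2)[of w] ple[of w 0] by (simp add: linear_0[OF A] linear_0[OF \<phi>])
  moreover have "f (A u) = \<phi> u" for u
  proof -
    have *: "\<phi> v \<le> f (A v)" for v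
      using f(2)[of "- A v"] ple[of "- A v" v] sublinear_0[OF p] by (simp add: linear_neg[OF f(1)])
    have "f (A (- u)) = - f (A u)" by (simp add: linear_neg[OF A] linear_neg[OF f(1)])
    with *[of u] *[of "- u"] show ?thesis by (simp add: linear_neg[OF \<phi>])
  qed
  ultimately show ?thesis using f(1) by blast
qed

text \<open>The pointwise linear structure makes the preceding results available for families, in
  particular for functions on \<open>J\<close> and for vectors indexed by signs.\<close>

instantiation "fun" :: (type, real_vector) real_vector
begin

definition "scaleR c f = (\<lambda>x. c *\<^sub>R f x)"

instance
  by standard (auto simp: scaleR_fun_def fun_eq_iff scaleR_add_right scaleR_add_left)

end

lemma scaleR_fun_apply [simp]: "(c *\<^sub>R f) x = c *\<^sub>R f x"
  by (simp add: scaleR_fun_def)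

lemma sum_fun_apply: "(\<Sum>i\<in>I. f i) x = (\<Sum>i\<in>I. f i x)"
  by (induction I rule: infinite_finite_induct) auto

lemma sublinear_sum_le:
  "sublinear N \<Longrightarrow> N (\<Sum>i\<in>I. f i) \<le> (\<Sum>i\<in>I. N (f i))"
  by (induction I rule: infinite_finite_induct)
     (auto simp: sublinear_0 intro: order_trans[OF sublinear_add])

lemma sublinear_even_nonneg:
  assumes "sublinear N" "\<And>h. N (- h) = N h"
  shows "N h \<ge> 0"
  using sublinear_minus[OF assms(1), of h] by (simp add: assms(2))

lemma norming_functional:
  assumes "sublinear N"
  shows "\<exists>f. linear f \<and> (\<forall>w. f w \<le> N w) \<and> f u = N u"
proof -
  have "linear (\<lambda>t::real. t *\<^sub>R u)" by (intro linearI) (auto simp: scaleR_add_left)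
  moreover have "linear (\<lambda>t::real. t * N u)" by (intro linearI) (auto simp: algebra_simps)
  moreover have "t * N u \<le> N (t *\<^sub>R u)" for t
  proof (cases "t \<ge> 0")
    case False
    then have "N ((- t) *\<^sub>R u) = (- t) * N u" by (intro sublinear_scale assms) auto
    then show ?thesis using sublinear_minus[OF assms, of "t *\<^sub>R u"] by simp
  qed (simp add: sublinear_scale[OF assms])
  ultimately obtain f where "linear f" "\<And>w. f w \<le> N w" "\<And>t::real. f (t *\<^sub>R u) = t * N u"
    using Hahn_Banach_factor[OF assms, of "\<lambda>t::real. t *\<^sub>R u" "\<lambda>t. t * N u"] by auto
  from this(3)[of 1] this(1,2) show ?thesis by auto
qed

text \<open>\<open>(r,1)\<close>-summing operators on \<open>\<ell>\<^sub>\<infinity>\<close>: a family that almost attains the summing constant yields the measure.\<close>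

lemma summing_approx_measure:
  fixes N :: "('i \<Rightarrow> real) \<Rightarrow> real"
  assumes J: "finite J" and N: "sublinear N" and even: "\<And>h. N (- h) = N h"
    and supp: "\<And>h. (\<forall>j\<in>J. h j = 0) \<Longrightarrow> N h = 0"
    and r: "r > 1"
    and summing: "\<And>(n::nat) h. (\<forall>j\<in>J. (\<Sum>i<n. \<bar>h i j\<bar>) \<le> 1) \<Longrightarrow> (\<Sum>i<n. N (h i) powr r) \<le> A"
    and \<delta>: "\<delta> > 0"
  shows "\<exists>\<mu>. (\<forall>j. 0 \<le> \<mu> j) \<and> (\<Sum>j\<in>J. \<mu> j) \<le> A \<and>
    (\<forall>h. (\<forall>j\<in>J. \<bar>h j\<bar> \<le> 1) \<longrightarrow> N h powr r \<le> \<delta> + r * (\<Sum>j\<in>J. \<mu> j * \<bar>h j\<bar>))"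
proof -
  have nn: "N h \<ge> 0" for h by (rule sublinear_even_nonneg[OF N]) (rule even)
  define F where "F = {(n, h :: nat \<Rightarrow> 'i \<Rightarrow> real). \<forall>j\<in>J. (\<Sum>i<n. \<bar>h i j\<bar>) \<le> 1}"
  define v where "v = (\<lambda>(n, h). \<Sum>i<n::nat. N (h i) powr r)"
  define B where "B = (SUP x\<in>F. v x)"
  have bdd: "bdd_above (v ` F)"
    by (rule bdd_aboveI2[of _ _ A]) (auto simp: F_def v_def intro!: summing)
  have ne: "(0, \<lambda>_ _. 0) \<in> F" by (simp add: F_def)
  have leB: "(\<Sum>i<n. N (h i) powr r) \<le> B" if "\<forall>j\<in>J. (\<Sum>i<n. \<bar>h i j\<bar>) \<le> 1" for n :: nat and h
    using cSUP_upper[OF _ bdd, of "(n, h)"] that by (simp add: B_def v_def F_def)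
  have BA: "B \<le> A" unfolding B_def
  proof (rule cSUP_least)
    show "F \<noteq> {}" using ne by blast
    show "v x \<le> A" if "x \<in> F" for x
      using that by (auto simp: F_def v_def intro!: summing)
  qed
  have "F \<noteq> {}" using ne by blast
  moreover have "B - \<delta> < B" using \<delta> by simp
  ultimately obtain x where x: "x \<in> F" "B - \<delta> < v x"
    unfolding B_def using less_cSUP_iff[OF _ bdd] by blast
  then obtain n :: nat and g where g: "\<And>j. j \<in> J \<Longrightarrow> (\<Sum>i<n. \<bar>g i j\<bar>) \<le> 1" and near: "B - \<delta> < (\<Sum>i<n. N (g i) powr r)"
    by (auto simp: F_def v_def)
  define a where "a i = N (g i)" for i
  define S where "S = (\<Sum>i<n. a i powr r)"
  have "\<forall>i. \<exists>f. linear f \<and> (\<forall>w. f w \<le> N w) \<and> f (g i) = a i"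
    unfolding a_def using norming_functional[OF N] by blast
  then obtain \<xi> where \<xi>: "\<And>i. linear (\<xi> i)" "\<And>i w. \<xi> i w \<le> N w" "\<And>i. \<xi> i (g i) = a i" by metis
  \<comment> \<open>Up to the factor \<open>r\<close>, a subgradient at the constant 1 of the
    function sending \<open>h\<close> to the sum of the \<open>N (h * g i) powr r\<close>.\<close>
  define \<Xi> where "\<Xi> h = (\<Sum>i<n. a i powr (r - 1) * \<xi> i (\<lambda>j. h j * g i j))" for h
  have a0: "a i \<ge> 0" for i by (simp add: a_def nn)
  have \<Xi>_add: "\<Xi> (\<lambda>j. h j + h' j) = \<Xi> h + \<Xi> h'" for h h'
  proof -
    have "(\<lambda>j. (h j + h' j) * g i j) = (\<lambda>j. h j * g i j) + (\<lambda>j. h' j * g i j)" for i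
      by (auto simp: algebra_simps)
    then show ?thesis by (simp add: \<Xi>_def linear_add[OF \<xi>(1)] algebra_simps sum.distrib)
  qed
  have \<Xi>_1: "\<Xi> (\<lambda>_. 1) = S"
    unfolding \<Xi>_def S_def
  proof (intro sum.cong refl)
    fix i show "a i powr (r - 1) * \<xi> i (\<lambda>j. 1 * g i j) = a i powr r"
      using a0[of i] r by (cases "a i = 0") (auto simp: \<xi>(3) powr_diff)
  qed
  have young: "\<Xi> h \<le> (\<Sum>i<n. N (\<lambda>j. h j * g i j) powr r) / r + (1 - 1 / r) * S" for h
  proof -
    have "a i powr (r - 1) * \<xi> i (\<lambda>j. h j * g i j) \<le> N (\<lambda>j. h j * g i j) powr r / r + (1 - 1 / r) * a i powr r" for i
    proof -
      let ?b = "N (\<lambda>j. h j * g i j)"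
      have "a i powr (r - 1) * \<xi> i (\<lambda>j. h j * g i j) \<le> a i powr (r - 1) * ?b"
        by (intro mult_left_mono \<xi>) simp
      also have "\<dots> = ?b * a i powr (r - 1)" by simp
      also have "\<dots> \<le> ?b powr r / r + (a i powr (r - 1)) powr (r / (r - 1)) / (r / (r - 1))"
        by (rule Youngs_inequality) (use r in \<open>auto simp: field_simps nn\<close>)
      also have "(a i powr (r - 1)) powr (r / (r - 1)) = a i powr r"
        using r by (simp add: powr_powr)
      also have "a i powr r / (r / (r - 1)) = (1 - 1 / r) * a i powr r"
        using r by (simp add: field_simps)
      finally show ?thesis .
    qed
    then have "\<Xi> h \<le> (\<Sum>i<n. N (\<lambda>j. h j * g i j) powr r / r + (1 - 1 / r) * a i powr r)"
      unfolding \<Xi>_def by (rule sum_mono)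
    then show ?thesis by (simp add: S_def sum.distrib sum_divide_distrib sum_distrib_left)
  qed
  define e where "e j = (\<lambda>k. if k = j then 1 else 0 :: real)" for j :: 'i
  have \<Xi>_sum: "\<Xi> h = (\<Sum>j\<in>J. h j * \<Xi> (e j))" for h
  proof -
    have *: "\<xi> i (\<lambda>j. h j * g i j) = (\<Sum>j\<in>J. h j * \<xi> i (\<lambda>k. e j k * g i k))" for i
    proof -
      define f where "f = (\<lambda>j. h j * g i j)"
      \<comment> \<open>The remainder vanishes on \<open>J\<close>, so \<open>N\<close> is 0 at
        \<open>d\<close> and at \<open>- d\<close>; a linear functional below \<open>N\<close> then
        vanishes at \<open>d\<close>.\<close>
      define d where "d = f - (\<Sum>j\<in>J. h j *\<^sub>R (\<lambda>k. e j k * g i k))"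
      have "d k = 0" if "k \<in> J" for k
      proof -
        have "(\<Sum>j\<in>J. h j * (e j k * g i k)) = (\<Sum>j\<in>J. if k = j then h j * g i k else 0)"
          by (intro sum.cong) (auto simp: e_def)
        then show ?thesis using that J by (simp add: d_def f_def sum_fun_apply)
      qed
      then have "N d = 0" "N (- d) = 0" using supp[of d] even[of d] by auto
      then have "\<xi> i d = 0" using \<xi>(2)[of i d] \<xi>(2)[of i "- d"] linear_neg[OF \<xi>(1), of i d] by simp
      then have "\<xi> i f = \<xi> i (\<Sum>j\<in>J. h j *\<^sub>R (\<lambda>k. e j k * g i k))"
        by (simp add: d_def linear_diff[OF \<xi>(1)])
      then show ?thesis unfolding f_def by (simp add: linear_sum[OF \<xi>(1)] linear_scale[OF \<xi>(1)])
    qed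
    show ?thesis unfolding \<Xi>_def *
      by (simp add: sum_distrib_left sum.swap[of _ J] mult_ac)
  qed
  define \<mu> where "\<mu> j = \<bar>\<Xi> (e j)\<bar>" for j
  have \<mu>_sum: "(\<Sum>j\<in>J. \<mu> j) \<le> A"
  proof -
    \<comment> \<open>Evaluated at its own signs, \<open>\<Xi>\<close> returns the total mass. A
      sign change keeps the family admissible, so the mass is at most \<open>B\<close>.\<close>
    define s where "s j = sgn (\<Xi> (e j))" for j
    have "(\<Sum>j\<in>J. \<mu> j) = \<Xi> s"
      by (subst \<Xi>_sum) (auto intro!: sum.cong simp: \<mu>_def s_def abs_sgn mult.commute)
    also have "\<dots> \<le> (\<Sum>i<n. N (\<lambda>j. s j * g i j) powr r) / r + (1 - 1 / r) * S" by (rule young)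
    also have "\<dots> \<le> B / r + (1 - 1 / r) * B"
    proof (intro add_mono divide_right_mono mult_left_mono)
      have "(\<Sum>i<n. \<bar>s j * g i j\<bar>) \<le> 1" if "j \<in> J" for j
      proof -
        have "(\<Sum>i<n. \<bar>s j * g i j\<bar>) \<le> (\<Sum>i<n. \<bar>g i j\<bar>)"
          by (intro sum_mono) (auto simp: abs_mult s_def sgn_if)
        with g[OF that] show ?thesis by simp
      qed
      then show "(\<Sum>i<n. N (\<lambda>j. s j * g i j) powr r) \<le> B" by (intro leB) auto
      show "S \<le> B" unfolding S_def a_def by (intro leB) (auto simp: g)
    qed (use r in auto)
    also have "\<dots> = B" using r by (simp add: field_simps)
    finally show ?thesis using BA by simp
  qed
  have main: "N h powr r \<le> \<delta> + r * (\<Sum>j\<in>J. \<mu> j * \<bar>h j\<bar>)" if h: "\<forall>j\<in>J. \<bar>h j\<bar> \<le> 1" for h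
  proof -
    define c where "c = (\<lambda>j. 1 - \<bar>h j\<bar>)"
    \<comment> \<open>The family damped by \<open>c = 1 - |h|\<close> stays admissible when
      \<open>h\<close> is appended. The undamped family is almost extremal, so
      \<open>N h powr r\<close> exceeds the loss caused by the damping by at most
      \<open>\<delta>\<close>, and \<open>young\<close> bounds that loss by \<open>r\<close> times
      the integral of |h|.\<close>
    define G where "G i = (if i = n then h else (\<lambda>j. c j * g i j))" for i
    have "(\<Sum>i<Suc n. \<bar>G i j\<bar>) \<le> 1" if "j \<in> J" for j
    proof -
      have c: "c j \<ge> 0" using h that by (simp add: c_def)
      have "(\<Sum>i<n. \<bar>G i j\<bar>) = c j * (\<Sum>i<n. \<bar>g i j\<bar>)"
        using c by (simp add: G_def sum_distrib_left abs_mult)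
      also have "\<dots> \<le> c j * 1" by (intro mult_left_mono g that c)
      finally show ?thesis by (simp add: G_def c_def)
    qed
    then have "(\<Sum>i<Suc n. N (G i) powr r) \<le> B" by (intro leB) auto
    then have 1: "N h powr r + (\<Sum>i<n. N (\<lambda>j. c j * g i j) powr r) \<le> B" by (simp add: G_def)
    have "S = \<Xi> c + \<Xi> (\<lambda>j. \<bar>h j\<bar>)"
      by (simp add: \<Xi>_1[symmetric] c_def flip: \<Xi>_add)
    moreover have "\<Xi> (\<lambda>j. \<bar>h j\<bar>) \<le> (\<Sum>j\<in>J. \<mu> j * \<bar>h j\<bar>)"
      by (subst \<Xi>_sum) (auto intro!: sum_mono mult_right_mono simp: \<mu>_def mult.commute[of "\<bar>h _\<bar>"])
    ultimately have "S - (\<Sum>j\<in>J. \<mu> j * \<bar>h j\<bar>) \<le> \<Xi> c" by simp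
    then have "S - (\<Sum>j\<in>J. \<mu> j * \<bar>h j\<bar>) \<le> (\<Sum>i<n. N (\<lambda>j. c j * g i j) powr r) / r + (1 - 1 / r) * S"
      using young[of c] by linarith
    then have "S / r - (\<Sum>j\<in>J. \<mu> j * \<bar>h j\<bar>) \<le> (\<Sum>i<n. N (\<lambda>j. c j * g i j) powr r) / r"
      by (simp add: algebra_simps)
    from mult_left_mono[OF this, of r] r
    have "S - r * (\<Sum>j\<in>J. \<mu> j * \<bar>h j\<bar>) \<le> (\<Sum>i<n. N (\<lambda>j. c j * g i j) powr r)"
      by (simp add: right_diff_distrib)
    with 1 near show ?thesis unfolding S_def a_def by simp
  qed
  show ?thesis by (intro exI[of _ \<mu>]) (use \<mu>_sum main in \<open>auto simp: \<mu>_def\<close>)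
qed

text \<open>Compactness: the approximating measures have bounded coordinates on the finite set
  \<open>J\<close>, and a convergent subsequence removes \<open>\<delta>\<close>.\<close>

lemma summing_measure:
  fixes N :: "('i \<Rightarrow> real) \<Rightarrow> real"
  assumes J: "finite J" and N: "sublinear N" and even: "\<And>h. N (- h) = N h"
    and supp: "\<And>h. (\<forall>j\<in>J. h j = 0) \<Longrightarrow> N h = 0"
    and r: "r > 1"
    and summing: "\<And>(n::nat) h. (\<forall>j\<in>J. (\<Sum>i<n. \<bar>h i j\<bar>) \<le> 1) \<Longrightarrow> (\<Sum>i<n. N (h i) powr r) \<le> A"
  shows "\<exists>\<mu>. (\<forall>j\<in>J. 0 \<le> \<mu> j) \<and> (\<Sum>j\<in>J. \<mu> j) \<le> A \<and>
    (\<forall>h. (\<forall>j\<in>J. \<bar>h j\<bar> \<le> 1) \<longrightarrow> N h powr r \<le> r * (\<Sum>j\<in>J. \<mu> j * \<bar>h j\<bar>))"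
proof -
  have "\<exists>\<mu>. (\<forall>j. 0 \<le> \<mu> j) \<and> (\<Sum>j\<in>J. \<mu> j) \<le> A \<and>
    (\<forall>h. (\<forall>j\<in>J. \<bar>h j\<bar> \<le> 1) \<longrightarrow> N h powr r \<le> inverse (real (Suc n)) + r * (\<Sum>j\<in>J. \<mu> j * \<bar>h j\<bar>))" for n
    by (rule summing_approx_measure[OF J N even supp r summing]) auto
  then obtain \<mu> where \<mu>0: "\<And>n j. 0 \<le> \<mu> n j" and \<mu>A: "\<And>n. (\<Sum>j\<in>J. \<mu> n j) \<le> A"
    and \<mu>: "\<And>n h. \<forall>j\<in>J. \<bar>h j\<bar> \<le> 1 \<Longrightarrow> N h powr r \<le> inverse (real (Suc n)) + r * (\<Sum>j\<in>J. \<mu> n j * \<bar>h j\<bar>)"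
    by metis
  have "norm (\<mu> n j) \<le> A" if "j \<in> J" for n j
    using member_le_sum[OF that, of "\<mu> n"] \<mu>0 J \<mu>A[of n] by (simp add: order_trans)
  then obtain k where k: "strict_mono k" "\<And>j. j \<in> J \<Longrightarrow> \<exists>l. (\<lambda>n. \<mu> (k n) j) \<longlonglongrightarrow> l"
    using function_convergent_subsequence[OF countable_finite[OF J], of \<mu> A] by metis
  then obtain l where l: "\<And>j. j \<in> J \<Longrightarrow> (\<lambda>n. \<mu> (k n) j) \<longlonglongrightarrow> l j" by metis
  have "0 \<le> l j" if "j \<in> J" for j
    using LIMSEQ_le_const[OF l[OF that]] \<mu>0 by blast
  moreover have "(\<Sum>j\<in>J. l j) \<le> A"
    using LIMSEQ_le_const2[of "\<lambda>n. \<Sum>j\<in>J. \<mu> (k n) j"] \<mu>A tendsto_sum[of J "\<lambda>j n. \<mu> (k n) j" l] l by blast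
  moreover have "N h powr r \<le> r * (\<Sum>j\<in>J. l j * \<bar>h j\<bar>)" if h: "\<forall>j\<in>J. \<bar>h j\<bar> \<le> 1" for h
  proof (rule LIMSEQ_le_const)
    have "(\<lambda>n. inverse (real (Suc (k n)))) \<longlonglongrightarrow> 0"
      using LIMSEQ_subseq_LIMSEQ[OF LIMSEQ_inverse_real_of_nat k(1)] by (simp add: o_def)
    then have "(\<lambda>n. inverse (real (Suc (k n))) + r * (\<Sum>j\<in>J. \<mu> (k n) j * \<bar>h j\<bar>)) \<longlonglongrightarrow>
        0 + r * (\<Sum>j\<in>J. l j * \<bar>h j\<bar>)"
      by (intro tendsto_intros l)
    then show "(\<lambda>n. inverse (real (Suc (k n))) + r * (\<Sum>j\<in>J. \<mu> (k n) j * \<bar>h j\<bar>)) \<longlonglongrightarrow>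
        r * (\<Sum>j\<in>J. l j * \<bar>h j\<bar>)" by simp
    show "\<exists>M. \<forall>n\<ge>M. N h powr r \<le> inverse (real (Suc (k n))) + r * (\<Sum>j\<in>J. \<mu> (k n) j * \<bar>h j\<bar>)"
      using \<mu>[OF h] by blast
  qed
  ultimately show ?thesis by blast
qed

text \<open>Collects the block estimates of \<open>summing_dominated\<close>: 1 for the part of
  \<open>h\<close> of modulus at most 1, and a geometric series of ratio
  \<open>2 powr (1 - q / r)\<close> for the dyadic shells. The prefactor is the r-th root of the
  factor \<open>r\<close> in \<open>summing_measure\<close>.\<close>

definition maurey_const :: "real \<Rightarrow> real \<Rightarrow> real" where
  "maurey_const r q = r powr (1 / r) * (1 + 2 / (1 - 2 powr (1 - q / r)))"

text \<open>From weak type \<open>(r,1)\<close> to strong type \<open>q > r\<close>: split \<open>h\<close> into dyadic blocks.\<close>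

lemma summing_dominated:
  fixes N :: "('i \<Rightarrow> real) \<Rightarrow> real"
  assumes J: "finite J" and N: "sublinear N" and even: "\<And>h. N (- h) = N h"
    and supp: "\<And>h. (\<forall>j\<in>J. h j = 0) \<Longrightarrow> N h = 0"
    and r: "r > 1" and q: "q > r" and A: "A > 0"
    and summing: "\<And>(n::nat) h. (\<forall>j\<in>J. (\<Sum>i<n. \<bar>h i j\<bar>) \<le> 1) \<Longrightarrow> (\<Sum>i<n. N (h i) powr r) \<le> A"
  shows "\<exists>\<nu>. (\<forall>j\<in>J. 0 \<le> \<nu> j) \<and> (\<Sum>j\<in>J. \<nu> j) \<le> 1 \<and>
    (\<forall>h t. t > 0 \<longrightarrow> (\<Sum>j\<in>J. \<nu> j * \<bar>h j\<bar> powr q) \<le> t powr q \<longrightarrow> N h \<le> maurey_const r q * A powr (1 / r) * t)"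
proof -
  obtain \<mu> where \<mu>0: "\<And>j. j \<in> J \<Longrightarrow> 0 \<le> \<mu> j" and \<mu>A: "(\<Sum>j\<in>J. \<mu> j) \<le> A"
    and \<mu>: "\<And>h. \<forall>j\<in>J. \<bar>h j\<bar> \<le> 1 \<Longrightarrow> N h powr r \<le> r * (\<Sum>j\<in>J. \<mu> j * \<bar>h j\<bar>)"
    using summing_measure[OF J N even supp r summing] by blast
  have nn: "N h \<ge> 0" for h by (rule sublinear_even_nonneg[OF N]) (rule even)
  define \<theta> where "\<theta> = 2 powr (1 - q / r)"
  have \<theta>: "0 < \<theta>" "\<theta> < 1" using q r by (auto simp: \<theta>_def powr_less_one divide_simps intro!: powr_less_one)
  have unit: "N h \<le> maurey_const r q * A powr (1 / r)" if h: "(\<Sum>j\<in>J. \<mu> j * \<bar>h j\<bar> powr q) \<le> A" for h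
  proof -
    obtain M :: nat where M: "\<And>j. j \<in> J \<Longrightarrow> \<bar>h j\<bar> \<le> 2 ^ M"
    proof -
      obtain M :: nat where "Max (insert 0 ((\<lambda>j. \<bar>h j\<bar>) ` J)) < 2 ^ M" using real_arch_pow[of 2] by auto
      then show ?thesis using J by (intro that[of M]) (auto simp: less_imp_le)
    qed
    define b where "b s = (\<lambda>j. if s = 0 then (if \<bar>h j\<bar> \<le> 1 then h j else 0)
        else if 2 ^ (s - 1) < \<bar>h j\<bar> \<and> \<bar>h j\<bar> \<le> 2 ^ s then h j else 0)" for s :: nat
    have split: "(\<Sum>s\<le>m. b s j) = (if \<bar>h j\<bar> \<le> 2 ^ m then h j else 0)" for m j
    proof (induction m)
      case (Suc m)
      have "(2::real) ^ m \<le> 2 ^ Suc m" by simp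
      with Suc show ?case by (auto simp: b_def)
    qed (simp add: b_def)
    have root: "x \<le> y powr (1 / r)" if "x powr r \<le> y" "x \<ge> 0" for x y :: real
    proof -
      have "x = (x powr r) powr (1 / r)" using that r by (simp add: powr_powr)
      also have "\<dots> \<le> y powr (1 / r)" using that r by (intro powr_mono2) auto
      finally show ?thesis .
    qed
    have block0: "N (b 0) \<le> r powr (1 / r) * A powr (1 / r)"
    proof -
      have "N (b 0) powr r \<le> r * (\<Sum>j\<in>J. \<mu> j * \<bar>b 0 j\<bar>)" by (intro \<mu>) (auto simp: b_def)
      also have "\<dots> \<le> r * (\<Sum>j\<in>J. \<mu> j)" using r \<mu>0
        by (intro mult_left_mono sum_mono) (auto simp: b_def intro: mult_left_le)
      also have "\<dots> \<le> r * A" using r \<mu>A by simp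
      finally have "N (b 0) \<le> (r * A) powr (1 / r)" by (intro root nn)
      then show ?thesis using r A by (simp add: powr_mult)
    qed
    have block: "N (b (Suc s)) \<le> r powr (1 / r) * A powr (1 / r) * (2 * \<theta> ^ s)" for s
    proof -
      \<comment> \<open>Scaled into the unit cube, the block obeys the estimate by
        \<open>\<mu>\<close>. On its support |h| exceeds \<open>2 ^ s\<close>, so Chebyshev's
        inequality with exponent \<open>q\<close> bounds the mass there.\<close>
      define g where "g = (1 / 2 ^ Suc s) *\<^sub>R b (Suc s)"
      have g1: "\<bar>g j\<bar> \<le> 1" for j by (auto simp: g_def b_def abs_mult field_simps)
      have "N g powr r \<le> r * (\<Sum>j\<in>J. \<mu> j * \<bar>g j\<bar>)" by (intro \<mu>) (use g1 in auto)
      also have "\<dots> \<le> r * (\<Sum>j\<in>J. (\<mu> j * \<bar>h j\<bar> powr q) / (2 ^ s) powr q)"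
      proof (intro mult_left_mono sum_mono)
        fix j assume j: "j \<in> J"
        have "\<bar>g j\<bar> \<le> \<bar>h j\<bar> powr q / (2 ^ s) powr q"
        proof (cases "g j = 0")
          case False
          then have "2 ^ s < \<bar>h j\<bar>" by (auto simp: g_def b_def split: if_splits)
          then have "(2 ^ s) powr q \<le> \<bar>h j\<bar> powr q" using q r by (intro powr_mono2) auto
          then have "1 \<le> \<bar>h j\<bar> powr q / (2 ^ s) powr q" by (simp add: field_simps)
          with g1[of j] show ?thesis by linarith
        qed simp
        from mult_left_mono[OF this \<mu>0[OF j]] show "\<mu> j * \<bar>g j\<bar> \<le> (\<mu> j * \<bar>h j\<bar> powr q) / (2 ^ s) powr q" by simp
      qed (use r in auto)
      also have "\<dots> \<le> r * (A / (2 ^ s) powr q)"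
        unfolding sum_divide_distrib[symmetric] using h r by (intro mult_left_mono divide_right_mono) auto
      finally have "N g \<le> (r * (A / (2 ^ s) powr q)) powr (1 / r)" using root[OF _ nn, of g] by blast
      also have "\<dots> = r powr (1 / r) * A powr (1 / r) * (1 / (2 ^ s) powr (q / r))"
        using r A by (simp add: powr_mult powr_divide powr_powr)
      finally have "N (b (Suc s)) \<le> 2 ^ Suc s * (r powr (1 / r) * A powr (1 / r) * (1 / (2 ^ s) powr (q / r)))"
        unfolding g_def by (subst (asm) sublinear_scale[OF N]) (auto simp: field_simps)
      also have "\<dots> = r powr (1 / r) * A powr (1 / r) * (2 * (2 ^ s / (2 ^ s) powr (q / r)))" by simp
      also have "2 ^ s / (2 ^ s) powr (q / r) = \<theta> ^ s"
        by (simp add: \<theta>_def powr_diff powr_powr power_divide flip: powr_realpow) (simp add: mult.commute)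
      finally show ?thesis .
    qed
    define d where "d = h - (\<Sum>s\<le>M. b s)"
    have "d j = 0" if "j \<in> J" for j using M[OF that] by (simp add: d_def sum_fun_apply split)
    then have "N d = 0" by (intro supp) auto
    have "N h = N (d + (\<Sum>s\<le>M. b s))" by (simp add: d_def)
    also have "\<dots> \<le> (\<Sum>s\<le>M. N (b s))"
      using sublinear_add[OF N, of d "\<Sum>s\<le>M. b s"] sublinear_sum_le[OF N, of b "{..M}"] \<open>N d = 0\<close> by simp
    also have "\<dots> \<le> (\<Sum>s\<le>Suc M. N (b s))" using nn by simp
    also have "\<dots> = N (b 0) + (\<Sum>s\<le>M. N (b (Suc s)))" by (rule sum.atMost_Suc_shift)
    also have "\<dots> \<le> r powr (1 / r) * A powr (1 / r) + (\<Sum>s\<le>M. r powr (1 / r) * A powr (1 / r) * (2 * \<theta> ^ s))"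
      by (intro add_mono sum_mono block0 block)
    also have "\<dots> = r powr (1 / r) * A powr (1 / r) * (1 + 2 * (\<Sum>s\<le>M. \<theta> ^ s))"
      by (simp add: sum_distrib_left algebra_simps)
    also have "\<dots> \<le> r powr (1 / r) * A powr (1 / r) * (1 + 2 * (1 / (1 - \<theta>)))"
    proof -
      have "(\<Sum>s\<le>M. \<theta> ^ s) \<le> (\<Sum>s. \<theta> ^ s)" using \<theta> by (intro sum_le_suminf) auto
      then show ?thesis using \<theta> by (intro mult_left_mono add_left_mono) (auto simp: suminf_geometric)
    qed
    finally show ?thesis by (simp add: maurey_const_def \<theta>_def mult_ac)
  qed
  define \<nu> where "\<nu> j = \<mu> j / A" for j
  have "N h \<le> maurey_const r q * A powr (1 / r) * t"
    if t: "t > 0" and h: "(\<Sum>j\<in>J. \<nu> j * \<bar>h j\<bar> powr q) \<le> t powr q" for h t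
  proof -
    define g where "g = (1 / t) *\<^sub>R h"
    have "(\<Sum>j\<in>J. \<mu> j * \<bar>g j\<bar> powr q) = A / t powr q * (\<Sum>j\<in>J. \<nu> j * \<bar>h j\<bar> powr q)"
      using t A by (simp add: g_def \<nu>_def abs_mult powr_divide sum_distrib_left)
    also have "\<dots> \<le> A / t powr q * t powr q" using A t by (intro mult_left_mono h) auto
    finally have "N g \<le> maurey_const r q * A powr (1 / r)" using t by (intro unit) simp
    then show ?thesis unfolding g_def using t
      by (subst (asm) sublinear_scale[OF N]) (auto simp: field_simps)
  qed
  moreover have "(\<Sum>j\<in>J. \<nu> j) \<le> 1" using \<mu>A A by (simp add: \<nu>_def flip: sum_divide_distrib)
  ultimately show ?thesis using \<mu>0 A by (intro exI[of _ \<nu>]) (auto simp: \<nu>_def)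
qed

section \<open>Rademacher averages and cotype\<close>

abbreviation signs :: "'i set \<Rightarrow> ('i \<Rightarrow> real) set" where
  "signs I \<equiv> PiE I (\<lambda>_. {-1, 1})"

lemma finite_signs: "finite I \<Longrightarrow> finite (signs I)"
  by (intro finite_PiE) auto

lemma card_signs: "finite I \<Longrightarrow> card (signs I) = 2 ^ card I"
  by (simp add: card_PiE numeral_2_eq_2)

lemma rad_exp_mono: "(\<And>\<epsilon>. \<epsilon> \<in> signs I \<Longrightarrow> F \<epsilon> \<le> G \<epsilon>) \<Longrightarrow> rad_exp I F \<le> rad_exp I G"
  unfolding rad_exp_def by (intro divide_right_mono sum_mono) auto

lemma rad_exp_cong: "(\<And>\<epsilon>. \<epsilon> \<in> signs I \<Longrightarrow> F \<epsilon> = G \<epsilon>) \<Longrightarrow> rad_exp I F = rad_exp I G"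
  unfolding rad_exp_def by (intro arg_cong2[of _ _ _ _ "(/)"] sum.cong) auto

lemma rad_exp_nonneg: "(\<And>\<epsilon>. \<epsilon> \<in> signs I \<Longrightarrow> 0 \<le> F \<epsilon>) \<Longrightarrow> 0 \<le> rad_exp I F"
  unfolding rad_exp_def by (intro divide_nonneg_nonneg sum_nonneg) auto

lemma rad_exp_const: "finite I \<Longrightarrow> rad_exp I (\<lambda>_. c) = c"
  by (simp add: rad_exp_def card_signs)

lemma rad_exp_add: "rad_exp I (\<lambda>\<epsilon>. F \<epsilon> + G \<epsilon>) = rad_exp I F + rad_exp I G"
  by (simp add: rad_exp_def sum.distrib add_divide_distrib)

lemma rad_exp_mult_left: "rad_exp I (\<lambda>\<epsilon>. c * F \<epsilon>) = c * rad_exp I F"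
  by (simp add: rad_exp_def sum_distrib_left)

lemma rad_exp_sum: "rad_exp I (\<lambda>\<epsilon>. \<Sum>k\<in>K. F k \<epsilon>) = (\<Sum>k\<in>K. rad_exp I (F k))"
  unfolding rad_exp_def by (subst sum.swap) (simp add: sum_divide_distrib)

lemma rad_exp_swap: "rad_exp I (\<lambda>\<epsilon>. rad_exp J (F \<epsilon>)) = rad_exp J (\<lambda>\<delta>. rad_exp I (\<lambda>\<epsilon>. F \<epsilon> \<delta>))"
  unfolding rad_exp_def sum_divide_distrib[symmetric] by (subst sum.swap) simp

lemma rad_exp_insert:
  assumes "finite I" "i \<notin> I"
  shows "rad_exp (insert i I) F = (rad_exp I (\<lambda>\<epsilon>. F (\<epsilon>(i := 1))) + rad_exp I (\<lambda>\<epsilon>. F (\<epsilon>(i := - 1)))) / 2"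
proof -
  have "sum F (signs (insert i I)) = (\<Sum>(y, g)\<in>{- 1, 1} \<times> signs I. F (g(i := y)))"
    unfolding PiE_insert_eq
    by (subst sum.reindex) (use inj_combinator[OF assms(2), of "\<lambda>_. {- 1, 1::real}"] in \<open>auto simp: case_prod_unfold\<close>)
  also have "\<dots> = (\<Sum>g\<in>signs I. F (g(i := - 1))) + (\<Sum>g\<in>signs I. F (g(i := 1)))"
    by (subst sum.cartesian_product[symmetric]) simp
  finally show ?thesis using assms by (simp add: rad_exp_def field_simps)
qed

lemma rad_exp_flip:
  assumes "finite I" and s: "\<And>i. i \<in> I \<Longrightarrow> s i \<in> {- 1, 1}"
  shows "rad_exp I (\<lambda>\<epsilon>. F (\<lambda>i\<in>I. s i * \<epsilon> i)) = rad_exp I F"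
proof -
  have ss: "s i * s i = 1" if "i \<in> I" for i using s[OF that] by auto
  have "bij_betw (\<lambda>\<epsilon>. \<lambda>i\<in>I. s i * \<epsilon> i) (signs I) (signs I)"
  proof (rule bij_betw_byWitness[where f' = "\<lambda>\<epsilon>. \<lambda>i\<in>I. s i * \<epsilon> i"])
    show "(\<lambda>\<epsilon>. \<lambda>i\<in>I. s i * \<epsilon> i) ` signs I \<subseteq> signs I"
      using s by (fastforce simp: PiE_iff)
    then show "(\<lambda>\<epsilon>. \<lambda>i\<in>I. s i * \<epsilon> i) ` signs I \<subseteq> signs I" .
  qed (auto simp: PiE_iff extensional_def fun_eq_iff ss simp flip: mult.assoc)
  from sum.reindex_bij_betw[OF this, of F] show ?thesis by (simp only: rad_exp_def)
qed

definition rad_norm :: "'i set \<Rightarrow> (('i \<Rightarrow> real) \<Rightarrow> 'a::real_normed_vector) \<Rightarrow> real" where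
  "rad_norm I f = sqrt (rad_exp I (\<lambda>\<epsilon>. (norm (f \<epsilon>))\<^sup>2))"

lemma rad_norm_nonneg: "0 \<le> rad_norm I f"
  by (simp add: rad_norm_def rad_exp_nonneg)

lemma rad_norm_square: "(rad_norm I f)\<^sup>2 = rad_exp I (\<lambda>\<epsilon>. (norm (f \<epsilon>))\<^sup>2)"
  by (simp add: rad_norm_def rad_exp_nonneg)

lemma rad_norm_eq: "rad_norm I f = L2_set (\<lambda>\<epsilon>. norm (f \<epsilon>)) (signs I) / sqrt (2 ^ card I)"
  by (simp add: rad_norm_def rad_exp_def L2_set_def real_sqrt_divide)

lemma rad_norm_triangle: "rad_norm I (\<lambda>\<epsilon>. f \<epsilon> + g \<epsilon>) \<le> rad_norm I f + rad_norm I g"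
proof -
  have "L2_set (\<lambda>\<epsilon>. norm (f \<epsilon> + g \<epsilon>)) (signs I) \<le> L2_set (\<lambda>\<epsilon>. norm (f \<epsilon>) + norm (g \<epsilon>)) (signs I)"
    by (intro L2_set_mono norm_triangle_ineq) auto
  also have "\<dots> \<le> L2_set (\<lambda>\<epsilon>. norm (f \<epsilon>)) (signs I) + L2_set (\<lambda>\<epsilon>. norm (g \<epsilon>)) (signs I)"
    by (rule L2_set_triangle_ineq)
  finally show ?thesis unfolding rad_norm_eq add_divide_distrib[symmetric] by (rule divide_right_mono) simp
qed

lemma rad_norm_scale: "rad_norm I (\<lambda>\<epsilon>. c *\<^sub>R f \<epsilon>) = \<bar>c\<bar> * rad_norm I f"
  by (simp add: rad_norm_def power_mult_distrib rad_exp_mult_left real_sqrt_mult)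

section \<open>Kahane's inequality by way of a two-point inequality\<close>

lemma even_part_bound:
  fixes c s :: real
  assumes c: "0 \<le> c" "c \<le> 1" and s: "\<bar>s\<bar> \<le> 1" and k: "k \<ge> 1"
  shows "((c + s) ^ k + (c - s) ^ k) / 2 \<le> c + 2 ^ k * s\<^sup>2"
proof -
  define E where "E k = ((c + s) ^ k + (c - s) ^ k) / 2" for k
  define O' where "O' k = ((c + s) ^ k - (c - s) ^ k) / 2" for k
  have E: "E (Suc k) = c * E k + s * O' k" and O': "O' (Suc k) = c * O' k + s * E k" for k
    by (simp_all add: E_def O'_def field_simps)
  have bounds: "\<bar>E k\<bar> \<le> 2 ^ k \<and> \<bar>O' k\<bar> \<le> 2 ^ k * \<bar>s\<bar>" for k
  proof (induction k)
    case 0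
    then show ?case by (simp add: E_def O'_def)
  next
    case (Suc k)
    have "\<bar>c * E k\<bar> \<le> 1 * 2 ^ k" unfolding abs_mult using c Suc by (intro mult_mono) auto
    moreover have "\<bar>s * O' k\<bar> \<le> 1 * (2 ^ k * 1)" unfolding abs_mult using s Suc
      by (intro mult_mono order_trans[OF conjunct2[OF Suc]]) auto
    moreover have "\<bar>c * O' k\<bar> \<le> 1 * (2 ^ k * \<bar>s\<bar>)" unfolding abs_mult using c Suc by (intro mult_mono) auto
    moreover have "\<bar>s * E k\<bar> \<le> \<bar>s\<bar> * 2 ^ k" unfolding abs_mult using Suc by (intro mult_mono) auto
    ultimately show ?case unfolding E O' by (simp add: algebra_simps) linarith
  qed
  have "E k \<le> c + 2 ^ k * s\<^sup>2" using k
  proof (induction k rule: dec_induct)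
    case base
    then show ?case by (simp add: E_def)
  next
    case (step k)
    have "c * E k \<le> c * (c + 2 ^ k * s\<^sup>2)" using step c by (intro mult_left_mono) auto
    also have "\<dots> \<le> c + 2 ^ k * s\<^sup>2"
      using mult_right_mono[of c 1 "c + 2 ^ k * s\<^sup>2"] c by (simp add: algebra_simps)
    finally have "c * E k \<le> c + 2 ^ k * s\<^sup>2" .
    moreover have "s * O' k \<le> 2 ^ k * s\<^sup>2"
    proof -
      have "s * O' k \<le> \<bar>s\<bar> * \<bar>O' k\<bar>" by (metis abs_ge_self abs_mult)
      also have "\<dots> \<le> \<bar>s\<bar> * (2 ^ k * \<bar>s\<bar>)" using bounds[of k] by (intro mult_left_mono) auto
      finally show ?thesis by (simp add: power2_eq_square mult_ac flip: abs_mult)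
    qed
    ultimately show ?case unfolding E by simp
  qed
  then show ?thesis by (simp add: E_def)
qed

text \<open>After division by \<open>u = A^2 + B^2\<close> the two squares are \<open>c + s\<close>
  and \<open>c - s\<close>, where \<open>c\<close> lies below 1 by
  \<open>(1 - \<rho>^2) * \<tau>\<close> and \<open>s^2\<close> is at most
  \<open>4 * \<rho>^2 * \<tau>\<close>. By \<open>even_part_bound\<close> the spread costs at most
  \<open>2 ^ k * s^2\<close>, and this deliberately small \<open>\<rho>\<close> makes the deficit of
  \<open>c\<close> pay for it.\<close>

lemma two_point_inequality:
  fixes A B :: real
  assumes k: "k \<ge> 1"
  defines "\<rho> \<equiv> 1 / 2 ^ (k + 2)"
  shows "((A + \<rho> * B) ^ (2 * k) + (A - \<rho> * B) ^ (2 * k)) / 2 \<le> (A\<^sup>2 + B\<^sup>2) ^ k"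
proof (cases "A\<^sup>2 + B\<^sup>2 = 0")
  case True
  then show ?thesis using k by (auto simp: sum_power2_eq_zero_iff power_0_left)
next
  case False
  define u where "u = A\<^sup>2 + B\<^sup>2"
  have u: "u > 0" using False by (simp add: u_def sum_power2_gt_zero_iff)
  define \<tau> where "\<tau> = B\<^sup>2 / u"
  have \<tau>: "0 \<le> \<tau>" "\<tau> \<le> 1" using u by (auto simp: \<tau>_def u_def)
  define c where "c = (A\<^sup>2 + \<rho>\<^sup>2 * B\<^sup>2) / u"
  define s where "s = 2 * \<rho> * A * B / u"
  have \<rho>: "0 < \<rho>" "\<rho> \<le> 1" "\<rho>\<^sup>2 * (1 + 4 * 2 ^ k) \<le> 1"
  proof -
    have a: "(1::real) \<le> 2 ^ k" "(2::real) ^ k \<le> 2 ^ k * 2 ^ k" by auto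
    show "\<rho>\<^sup>2 * (1 + 4 * 2 ^ k) \<le> 1"
      by (simp add: \<rho>_def power_add power2_eq_square field_simps) (use a in linarith)
    show "\<rho> > 0" by (simp add: \<rho>_def)
    have "\<rho> = (1 / 2) ^ (k + 2)" by (simp add: \<rho>_def power_divide)
    then show "\<rho> \<le> 1" by (simp only: power_le_one)
  qed
  have c: "c = 1 - (1 - \<rho>\<^sup>2) * \<tau>" using u by (simp add: c_def \<tau>_def field_simps) (simp add: u_def algebra_simps)
  have \<rho>2: "\<rho>\<^sup>2 \<le> 1" using \<rho> by (simp add: power_le_one)
  have c01: "0 \<le> c" "c \<le> 1"
  proof -
    have "(1 - \<rho>\<^sup>2) * \<tau> \<le> 1 * 1" using \<tau> \<rho>2 by (intro mult_mono) auto
    then show "0 \<le> c" by (simp add: c)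
    show "c \<le> 1" using \<tau> \<rho>2 by (simp add: c)
  qed
  have s2: "s\<^sup>2 \<le> 4 * \<rho>\<^sup>2 * \<tau>"
  proof -
    have "s\<^sup>2 = 4 * \<rho>\<^sup>2 * \<tau> * (A\<^sup>2 / u)" using u by (simp add: s_def \<tau>_def power_mult_distrib power_divide power2_eq_square)
    also have "\<dots> \<le> 4 * \<rho>\<^sup>2 * \<tau> * 1" using u \<tau> by (intro mult_left_mono) (auto simp: u_def)
    finally show ?thesis by simp
  qed
  have s1: "\<bar>s\<bar> \<le> 1"
  proof -
    have "2 * \<bar>A\<bar> * \<bar>B\<bar> \<le> u" using sum_squares_bound[of "\<bar>A\<bar>" "\<bar>B\<bar>"] by (simp add: u_def)
    then have "\<rho> * (2 * \<bar>A\<bar> * \<bar>B\<bar>) \<le> 1 * u" using \<rho> by (intro mult_mono) auto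
    then show ?thesis using u \<rho> by (simp add: s_def abs_mult divide_simps mult_ac)
  qed
  have p: "(A + \<rho> * B)\<^sup>2 = u * (c + s)" "(A - \<rho> * B)\<^sup>2 = u * (c - s)"
    using u by (simp_all add: c_def s_def power2_eq_square field_simps)
  have "((A + \<rho> * B) ^ (2 * k) + (A - \<rho> * B) ^ (2 * k)) / 2 = u ^ k * (((c + s) ^ k + (c - s) ^ k) / 2)"
    unfolding power_mult p power_mult_distrib by (simp add: algebra_simps)
  also have "\<dots> \<le> u ^ k * 1"
  proof (rule mult_left_mono)
    have "((c + s) ^ k + (c - s) ^ k) / 2 \<le> c + 2 ^ k * s\<^sup>2" by (rule even_part_bound[OF c01 s1 k])
    also have "\<dots> \<le> c + 2 ^ k * (4 * \<rho>\<^sup>2 * \<tau>)" using s2 by simp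
    also have "\<dots> = 1 - \<tau> * (1 - \<rho>\<^sup>2 * (1 + 4 * 2 ^ k))" by (simp add: c algebra_simps)
    also have "\<dots> \<le> 1" using \<tau> \<rho> by simp
    finally show "((c + s) ^ k + (c - s) ^ k) / 2 \<le> 1" .
  qed (use u in simp)
  finally show ?thesis by (simp add: u_def)
qed

text \<open>Vector-valued hypercontractivity for even exponents, by induction on the number of
  signs. The translation \<open>y\<close> absorbs the sign that is split off, and the two-point
  inequality is applied to L_2 norms of the remaining sum.\<close>

lemma Kahane_even:
  fixes x :: "'i \<Rightarrow> 'a::real_normed_vector"
  assumes I: "finite I" and k: "k \<ge> 1"
  defines "\<rho> \<equiv> 1 / 2 ^ (k + 2)"
  shows "rad_exp I (\<lambda>\<epsilon>. norm (y + \<rho> *\<^sub>R (\<Sum>i\<in>I. \<epsilon> i *\<^sub>R x i)) ^ (2 * k))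
    \<le> (rad_exp I (\<lambda>\<epsilon>. (norm (y + (\<Sum>i\<in>I. \<epsilon> i *\<^sub>R x i)))\<^sup>2)) ^ k"
  using I
proof (induction I arbitrary: y)
  case empty
  then show ?case by (simp add: rad_exp_def power_mult)
next
  case (insert i I)
  define S where "S \<epsilon> = (\<Sum>i\<in>I. \<epsilon> i *\<^sub>R x i)" for \<epsilon>
  have upd: "(\<Sum>j\<in>insert i I. (\<epsilon>(i := t)) j *\<^sub>R x j) = t *\<^sub>R x i + S \<epsilon>" for \<epsilon> t
    using insert.hyps by (auto simp: S_def intro!: sum.cong)
  define n where "n t = rad_norm I (\<lambda>\<epsilon>. y + t *\<^sub>R x i + S \<epsilon>)" for t
  have n2: "(n t)\<^sup>2 = rad_exp I (\<lambda>\<epsilon>. (norm (y + t *\<^sub>R x i + S \<epsilon>))\<^sup>2)" for t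
    by (simp add: n_def rad_norm_square)
  have n0: "n t \<ge> 0" for t by (simp add: n_def rad_norm_nonneg)
  have "\<rho> = (1 / 2) ^ (k + 2)" by (simp add: \<rho>_def power_divide)
  then have \<rho>: "0 < \<rho>" "\<rho> \<le> 1" by (simp_all only: power_le_one) (simp_all add: power_le_one)
  \<comment> \<open>\<open>n\<close> is convex in \<open>t\<close>, so on [-1, 1] it lies below the
    chord \<open>A + t * B\<close> through its values at the endpoints.\<close>
  have conv: "n t \<le> (1 + t) / 2 * n 1 + (1 - t) / 2 * n (- 1)" if t: "\<bar>t\<bar> \<le> 1" for t
  proof -
    have "y + t *\<^sub>R x i + S \<epsilon> = ((1 + t) / 2) *\<^sub>R (y + 1 *\<^sub>R x i + S \<epsilon>) + ((1 - t) / 2) *\<^sub>R (y + (- 1) *\<^sub>R x i + S \<epsilon>)" for \<epsilon>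
    proof -
      have "((1 + t) / 2) *\<^sub>R (y + 1 *\<^sub>R x i + S \<epsilon>) + ((1 - t) / 2) *\<^sub>R (y + (- 1) *\<^sub>R x i + S \<epsilon>)
         = ((1 + t) / 2 + (1 - t) / 2) *\<^sub>R (y + S \<epsilon>) + ((1 + t) / 2 - (1 - t) / 2) *\<^sub>R x i"
        by (simp only: scaleR_add_left scaleR_add_right scaleR_diff_left scaleR_one scaleR_minus1_left) (simp add: scaleR_right_distrib)
      also have "(1 + t) / 2 + (1 - t) / 2 = 1" by (simp add: field_simps)
      also have "(1 + t) / 2 - (1 - t) / 2 = t" by (simp add: field_simps)
      finally show ?thesis by simp
    qed
    then have "n t \<le> rad_norm I (\<lambda>\<epsilon>. ((1 + t) / 2) *\<^sub>R (y + 1 *\<^sub>R x i + S \<epsilon>)) + rad_norm I (\<lambda>\<epsilon>. ((1 - t) / 2) *\<^sub>R (y + (- 1) *\<^sub>R x i + S \<epsilon>))"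
      unfolding n_def by (simp only: rad_norm_triangle)
    then show ?thesis using t by (simp only: rad_norm_scale n_def) auto
  qed
  define A B where "A = (n 1 + n (- 1)) / 2" and "B = (n 1 - n (- 1)) / 2"
  have nA: "n \<rho> \<le> A + \<rho> * B" "n (- \<rho>) \<le> A - \<rho> * B"
    using conv[of \<rho>] conv[of "- \<rho>"] \<rho> by (simp_all add: A_def B_def field_simps)
  have AB: "A\<^sup>2 + B\<^sup>2 = ((n 1)\<^sup>2 + (n (- 1))\<^sup>2) / 2" by (simp add: A_def B_def power2_eq_square field_simps)
  have IH: "rad_exp I (\<lambda>\<epsilon>. norm (y + t *\<^sub>R x i + \<rho> *\<^sub>R S \<epsilon>) ^ (2 * k)) \<le> n t ^ (2 * k)" for t
    using insert.IH[of "y + t *\<^sub>R x i"] unfolding power_mult n2 S_def[symmetric] .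
  have "rad_exp (insert i I) (\<lambda>\<epsilon>. norm (y + \<rho> *\<^sub>R (\<Sum>j\<in>insert i I. \<epsilon> j *\<^sub>R x j)) ^ (2 * k)) =
     (rad_exp I (\<lambda>\<epsilon>. norm (y + \<rho> *\<^sub>R x i + \<rho> *\<^sub>R S \<epsilon>) ^ (2 * k))
      + rad_exp I (\<lambda>\<epsilon>. norm (y + (- \<rho>) *\<^sub>R x i + \<rho> *\<^sub>R S \<epsilon>) ^ (2 * k))) / 2"
    unfolding rad_exp_insert[OF insert.hyps] upd
    by (simp only: scaleR_add_right scaleR_scaleR mult_1_right mult_minus1_right add.assoc)
  also have "\<dots> \<le> (n \<rho> ^ (2 * k) + n (- \<rho>) ^ (2 * k)) / 2"
    using IH[of \<rho>] IH[of "- \<rho>"] by simp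
  also have "\<dots> \<le> ((A + \<rho> * B) ^ (2 * k) + (A - \<rho> * B) ^ (2 * k)) / 2"
    using power_mono[OF nA(1) n0, of "2 * k"] power_mono[OF nA(2) n0, of "2 * k"] by simp
  also have "\<dots> \<le> (A\<^sup>2 + B\<^sup>2) ^ k" unfolding \<rho>_def by (rule two_point_inequality[OF k])
  also have "A\<^sup>2 + B\<^sup>2 = rad_exp (insert i I) (\<lambda>\<epsilon>. (norm (y + (\<Sum>j\<in>insert i I. \<epsilon> j *\<^sub>R x j)))\<^sup>2)"
    unfolding AB n2 rad_exp_insert[OF insert.hyps] upd by (simp only: add.assoc)
  finally show ?case .
qed

text \<open>For the norm \<open>t\<close> divided by its L_2 average,
  \<open>t powr r \<le> 1 + t ^ (2 * k)\<close> as soon as \<open>r \<le> 2 * k\<close>, which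
  leaves an even exponent. The contraction \<open>\<rho>\<close> is undone by homogeneity at the
  price \<open>1 / \<rho> ^ (2 * k)\<close>.\<close>

lemma Kahane:
  fixes r :: real
  assumes r: "r \<ge> 0"
  shows "\<exists>K>0. \<forall>(I::'i set) (x :: 'i \<Rightarrow> 'a::real_normed_vector). finite I \<longrightarrow>
    rad_exp I (\<lambda>\<epsilon>. norm (\<Sum>i\<in>I. \<epsilon> i *\<^sub>R x i) powr r) \<le> K * rad_norm I (\<lambda>\<epsilon>. \<Sum>i\<in>I. \<epsilon> i *\<^sub>R x i) powr r"
proof -
  obtain k :: nat where k: "k \<ge> 1" "r \<le> 2 * real k"
  proof -
    obtain n :: nat where "r / 2 \<le> real n" using real_arch_simple by blast
    then show ?thesis by (intro that[of "Suc n"]) auto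
  qed
  define \<rho> :: real where "\<rho> = 1 / 2 ^ (k + 2)"
  have \<rho>: "\<rho> > 0" by (simp add: \<rho>_def)
  define K where "K = 1 + 1 / \<rho> ^ (2 * k)"
  have "rad_exp I (\<lambda>\<epsilon>. norm (\<Sum>i\<in>I. \<epsilon> i *\<^sub>R x i) powr r) \<le> K * rad_norm I (\<lambda>\<epsilon>. \<Sum>i\<in>I. \<epsilon> i *\<^sub>R x i) powr r"
    if I: "finite I" for I :: "'i set" and x :: "'i \<Rightarrow> 'a"
  proof -
    define S where "S \<epsilon> = (\<Sum>i\<in>I. \<epsilon> i *\<^sub>R x i)" for \<epsilon>
    define \<sigma> where "\<sigma> = rad_norm I S"
    have \<sigma>0: "\<sigma> \<ge> 0" by (simp add: \<sigma>_def rad_norm_nonneg)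
    have \<sigma>2: "\<sigma>\<^sup>2 = rad_exp I (\<lambda>\<epsilon>. (norm (S \<epsilon>))\<^sup>2)" by (simp add: \<sigma>_def rad_norm_square)
    show ?thesis
    proof (cases "\<sigma> = 0")
      case True
      then have "(\<Sum>\<epsilon>\<in>signs I. (norm (S \<epsilon>))\<^sup>2) = 0" using \<sigma>2 by (simp add: rad_exp_def)
      then have "S \<epsilon> = 0" if "\<epsilon> \<in> signs I" for \<epsilon>
        using that finite_signs[OF I] by (subst (asm) sum_nonneg_eq_0_iff) auto
      then have "rad_exp I (\<lambda>\<epsilon>. norm (S \<epsilon>) powr r) = 0"
        by (simp add: rad_exp_def)
      then show ?thesis unfolding S_def[symmetric] by (simp add: K_def \<rho>_def)
    next
      case False
      with \<sigma>0 have \<sigma>: "\<sigma> > 0" by simp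
      have "norm (S \<epsilon>) powr r \<le> \<sigma> powr r * (1 + (1 / \<sigma> ^ (2 * k)) * norm (S \<epsilon>) ^ (2 * k))" for \<epsilon>
      proof -
        define t where "t = norm (S \<epsilon>) / \<sigma>"
        have t0: "t \<ge> 0" using \<sigma> by (simp add: t_def)
        have "t powr r \<le> 1 + t ^ (2 * k)"
        proof (cases "t \<le> 1")
          case True
          then have "t powr r \<le> 1" using t0 powr_mono2[of r t 1] r by simp
          then show ?thesis using t0 by (simp add: add_increasing2)
        next
          case False
          then have "t powr r \<le> t powr (2 * real k)" using k by (intro powr_mono) auto
          also have "\<dots> = t ^ (2 * k)" using False by (simp flip: powr_realpow)
          finally show ?thesis by simp
        qed
        then show ?thesis using \<sigma> by (simp add: t_def powr_divide power_divide field_simps)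
      qed
      then have "rad_exp I (\<lambda>\<epsilon>. norm (S \<epsilon>) powr r) \<le> rad_exp I (\<lambda>\<epsilon>. \<sigma> powr r * (1 + (1 / \<sigma> ^ (2 * k)) * norm (S \<epsilon>) ^ (2 * k)))"
        by (intro rad_exp_mono)
      also have "\<dots> = \<sigma> powr r * (1 + (1 / \<sigma> ^ (2 * k)) * rad_exp I (\<lambda>\<epsilon>. norm (S \<epsilon>) ^ (2 * k)))"
        by (simp only: rad_exp_mult_left rad_exp_add rad_exp_const[OF I])
      also have "\<dots> \<le> \<sigma> powr r * (1 + (1 / \<sigma> ^ (2 * k)) * (1 / \<rho> ^ (2 * k) * \<sigma> ^ (2 * k)))"
      proof -
        have "rad_exp I (\<lambda>\<epsilon>. norm (0 + \<rho> *\<^sub>R S \<epsilon>) ^ (2 * k)) \<le> (rad_exp I (\<lambda>\<epsilon>. (norm (0 + S \<epsilon>))\<^sup>2)) ^ k"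
          unfolding S_def \<rho>_def by (rule Kahane_even[OF I k(1)])
        then have "\<rho> ^ (2 * k) * rad_exp I (\<lambda>\<epsilon>. norm (S \<epsilon>) ^ (2 * k)) \<le> \<sigma> ^ (2 * k)"
          using \<rho> by (simp add: power_mult_distrib rad_exp_mult_left \<sigma>2 power_mult)
        then have "rad_exp I (\<lambda>\<epsilon>. norm (S \<epsilon>) ^ (2 * k)) \<le> 1 / \<rho> ^ (2 * k) * \<sigma> ^ (2 * k)"
          using \<rho> by (simp add: field_simps)
        then show ?thesis using \<sigma> by (intro mult_left_mono add_left_mono) auto
      qed
      also have "\<dots> = K * \<sigma> powr r" using \<sigma> by (simp add: K_def)
      finally show ?thesis by (simp add: S_def[symmetric] \<sigma>_def)
    qed
  qed
  moreover have "K > 0" using \<rho> by (simp add: K_def add_pos_nonneg)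
  ultimately show ?thesis by blast
qed

section \<open>Cotype and domination by a discrete L_q norm\<close>

text \<open>A convex function on a cube is largest at a vertex: the coordinates are moved to 1 or -1
  one at a time.\<close>

lemma sublinear_cube_bound:
  fixes N :: "('i \<Rightarrow> real) \<Rightarrow> real"
  assumes N: "sublinear N" and J: "finite J"
    and cong: "\<And>h h'. (\<And>j. j \<in> J \<Longrightarrow> h j = h' j) \<Longrightarrow> N h = N h'"
    and vert: "\<And>s. s \<in> signs J \<Longrightarrow> N s \<le> M"
    and h: "\<And>j. j \<in> J \<Longrightarrow> \<bar>h j\<bar> \<le> 1"
  shows "N h \<le> M"
proof -
  have "finite K \<Longrightarrow> K \<subseteq> J \<Longrightarrow> (\<And>j. j \<in> J - K \<Longrightarrow> h j \<in> {- 1, 1}) \<Longrightarrow> (\<And>j. j \<in> J \<Longrightarrow> \<bar>h j\<bar> \<le> 1) \<Longrightarrow> N h \<le> M" for K h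
  proof (induction K arbitrary: h rule: finite_induct)
    case empty
    have "N h = N (restrict h J)" by (rule cong) simp
    also have "\<dots> \<le> M" by (rule vert) (use empty in \<open>auto simp: PiE_iff\<close>)
    finally show ?case .
  next
    case (insert i K)
    have IH: "N (h(i := t)) \<le> M" if "t \<in> {- 1, 1}" for t
      by (rule insert.IH) (use insert.prems insert.hyps that in auto)
    define t where "t = h i"
    have t: "\<bar>t\<bar> \<le> 1" using insert.prems by (auto simp: t_def)
    have "h = ((1 + t) / 2) *\<^sub>R h(i := 1) + ((1 - t) / 2) *\<^sub>R h(i := - 1)"
      by (auto simp: fun_eq_iff t_def field_simps)
    then have "N h = N (((1 + t) / 2) *\<^sub>R h(i := 1) + ((1 - t) / 2) *\<^sub>R h(i := - 1))"
      by (rule arg_cong)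
    also have "\<dots> \<le> N (((1 + t) / 2) *\<^sub>R h(i := 1)) + N (((1 - t) / 2) *\<^sub>R h(i := - 1))"
      by (rule sublinear_add[OF N])
    also have "\<dots> = (1 + t) / 2 * N (h(i := 1)) + (1 - t) / 2 * N (h(i := - 1))"
      using t by (simp add: sublinear_scale[OF N])
    also have "\<dots> \<le> (1 + t) / 2 * M + (1 - t) / 2 * M"
      using t IH by (intro add_mono mult_left_mono) auto
    also have "\<dots> = M" by (simp add: field_simps)
    finally show ?case .
  qed
  from this[OF J order_refl] h show ?thesis by simp
qed

lemma has_cotype_const:
  assumes "has_cotype r TYPE('a::real_normed_vector)" "r > 0"
  shows "\<exists>C>0. \<forall>N (x :: nat \<Rightarrow> 'a). (\<Sum>i<N. norm (x i) powr r)
    \<le> C * rad_exp {..<N} (\<lambda>\<epsilon>. norm (\<Sum>i<N. \<epsilon> i *\<^sub>R x i) powr r)"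
proof -
  obtain C0 where C0: "\<And>N (x :: nat \<Rightarrow> 'a). (\<Sum>i<N. norm (x i) powr r) powr (1/r)
        \<le> C0 * (rad_exp {..<N} (\<lambda>\<epsilon>. norm (\<Sum>i<N. \<epsilon> i *\<^sub>R x i) powr r)) powr (1/r)"
    using assms(1) unfolding has_cotype_def by blast
  define C where "C = max C0 1"
  have "(\<Sum>i<N. norm (x i) powr r) \<le> C powr r * rad_exp {..<N} (\<lambda>\<epsilon>. norm (\<Sum>i<N. \<epsilon> i *\<^sub>R x i) powr r)"
    for N and x :: "nat \<Rightarrow> 'a"
  proof -
    let ?S = "\<Sum>i<N. norm (x i) powr r" and ?R = "rad_exp {..<N} (\<lambda>\<epsilon>. norm (\<Sum>i<N. \<epsilon> i *\<^sub>R x i) powr r)"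
    have S: "?S \<ge> 0" by (intro sum_nonneg) auto
    have R: "?R \<ge> 0" by (intro rad_exp_nonneg) auto
    have "?S powr (1/r) \<le> C * ?R powr (1/r)"
      using C0[where N = N and x = x] mult_right_mono[of C0 C "?R powr (1/r)"] by (simp add: C_def)
    then have "(?S powr (1/r)) powr r \<le> (C * ?R powr (1/r)) powr r"
      using assms(2) by (intro powr_mono2) auto
    then show ?thesis using assms(2) S R by (simp add: powr_powr powr_mult C_def)
  qed
  moreover have "C powr r > 0" by (simp add: C_def)
  ultimately show ?thesis by blast
qed

lemma sum_scaleR_swap:
  "(\<Sum>i\<in>I. \<delta> i *\<^sub>R (\<Sum>j\<in>J. h i j *\<^sub>R x j)) = (\<Sum>j\<in>J. (\<Sum>i\<in>I. \<delta> i * h i j) *\<^sub>R x j)"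
  for x :: "'j \<Rightarrow> 'a::real_vector"
  by (simp add: scaleR_sum_right scaleR_sum_left) (rule sum.swap)

lemma sign_sum_bound:
  assumes "\<delta> \<in> signs {..<n}" "(\<Sum>i<n. \<bar>h i j\<bar>) \<le> (1::real)"
  shows "\<bar>\<Sum>i<n. \<delta> i * h i j\<bar> \<le> 1"
proof -
  have "\<bar>\<Sum>i<n. \<delta> i * h i j\<bar> \<le> (\<Sum>i<n. \<bar>\<delta> i * h i j\<bar>)" by (rule sum_abs)
  also have "\<dots> = (\<Sum>i<n. \<bar>h i j\<bar>)"
  proof (intro sum.cong refl)
    fix i assume "i \<in> {..<n}"
    from PiE_mem[OF assms(1) this] show "\<bar>\<delta> i * h i j\<bar> = \<bar>h i j\<bar>" by auto
  qed
  finally show ?thesis using assms(2) by simp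
qed

lemma sublinear_norm_sum: "sublinear (\<lambda>h. norm (\<Sum>j\<in>J. h j *\<^sub>R x j))"
  unfolding sublinear_def
  by (auto simp: scaleR_add_left sum.distrib norm_triangle_ineq simp flip: scaleR_scaleR scaleR_sum_right)

text \<open>Maurey's factorization theorem for operators from a finite-dimensional \<open>\<ell>\<^sub>\<infinity>\<close>, represented by
  the images \<open>x j\<close> of the unit vectors.\<close>

lemma cotype_dominated:
  assumes ct: "has_cotype r TYPE('a::real_normed_vector)" and r: "r \<ge> 2" and q: "q > r"
  shows "\<exists>D>0. \<forall>(J::'i set) (x :: 'i \<Rightarrow> 'a). finite J \<longrightarrow> (\<forall>s\<in>signs J. norm (\<Sum>j\<in>J. s j *\<^sub>R x j) \<le> 1) \<longrightarrow>
    (\<exists>\<nu>. (\<forall>j\<in>J. 0 \<le> \<nu> j) \<and> (\<Sum>j\<in>J. \<nu> j) \<le> 1 \<and>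
      (\<forall>h t. t > 0 \<longrightarrow> (\<Sum>j\<in>J. \<nu> j * \<bar>h j\<bar> powr q) \<le> t powr q \<longrightarrow> norm (\<Sum>j\<in>J. h j *\<^sub>R x j) \<le> D * t))"
proof -
  obtain C where C: "C > 0" and cot: "\<And>N (x :: nat \<Rightarrow> 'a). (\<Sum>i<N. norm (x i) powr r)
    \<le> C * rad_exp {..<N} (\<lambda>\<epsilon>. norm (\<Sum>i<N. \<epsilon> i *\<^sub>R x i) powr r)"
    using has_cotype_const[OF ct] r by auto
  define D where "D = maurey_const r q * C powr (1 / r)"
  have D: "D > 0"
  proof -
    have "2 powr (1 - q / r) < 1" using q r by (intro powr_less_one) (auto simp: divide_simps)
    then show ?thesis using C r by (simp add: D_def maurey_const_def add_pos_nonneg)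
  qed
  have "\<exists>\<nu>. (\<forall>j\<in>J. 0 \<le> \<nu> j) \<and> (\<Sum>j\<in>J. \<nu> j) \<le> 1 \<and>
      (\<forall>h t. t > 0 \<longrightarrow> (\<Sum>j\<in>J. \<nu> j * \<bar>h j\<bar> powr q) \<le> t powr q \<longrightarrow> norm (\<Sum>j\<in>J. h j *\<^sub>R x j) \<le> D * t)"
    if J: "finite J" and x: "\<forall>s\<in>signs J. norm (\<Sum>j\<in>J. s j *\<^sub>R x j) \<le> 1" for J :: "'i set" and x :: "'i \<Rightarrow> 'a"
    unfolding D_def
  proof (rule summing_dominated[OF J sublinear_norm_sum _ _ _ q C])
    fix h :: "'i \<Rightarrow> real"
    show "norm (\<Sum>j\<in>J. (- h) j *\<^sub>R x j) = norm (\<Sum>j\<in>J. h j *\<^sub>R x j)"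
      by (simp add: sum_negf)
    show "norm (\<Sum>j\<in>J. h j *\<^sub>R x j) = 0" if "\<forall>j\<in>J. h j = 0" using that by simp
  next
    fix n :: nat and h :: "nat \<Rightarrow> 'i \<Rightarrow> real" assume h: "\<forall>j\<in>J. (\<Sum>i<n. \<bar>h i j\<bar>) \<le> 1"
    have "(\<Sum>i<n. norm (\<Sum>j\<in>J. h i j *\<^sub>R x j) powr r)
      \<le> C * rad_exp {..<n} (\<lambda>\<delta>. norm (\<Sum>j\<in>J. (\<Sum>i<n. \<delta> i * h i j) *\<^sub>R x j) powr r)"
      using cot[of "\<lambda>i. \<Sum>j\<in>J. h i j *\<^sub>R x j" n] by (simp only: sum_scaleR_swap)
    also have "\<dots> \<le> C * rad_exp {..<n} (\<lambda>_. 1)"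
    \<comment> \<open>Every signed sum of the \<open>h i\<close> lies in the unit cube, where the
      hypothesis on sign vectors gives the bound 1.\<close>
    proof (intro mult_left_mono rad_exp_mono)
      fix \<delta> assume \<delta>: "\<delta> \<in> signs {..<n}"
      have "norm (\<Sum>j\<in>J. (\<lambda>j. \<Sum>i<n. \<delta> i * h i j) j *\<^sub>R x j) \<le> 1"
      proof (rule sublinear_cube_bound[OF sublinear_norm_sum J])
        show "norm (\<Sum>j\<in>J. s j *\<^sub>R x j) \<le> 1" if "s \<in> signs J" for s using x that by blast
        show "\<bar>\<Sum>i<n. \<delta> i * h i j\<bar> \<le> 1" if "j \<in> J" for j
          using sign_sum_bound[OF \<delta>, of h j] h that by blast
      qed (simp cong: sum.cong)
      then show "norm (\<Sum>j\<in>J. (\<Sum>i<n. \<delta> i * h i j) *\<^sub>R x j) powr r \<le> 1"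
        using r powr_mono2[of r _ 1] by simp
    qed (use C in simp)
    finally show "(\<Sum>i<n. norm (\<Sum>j\<in>J. h i j *\<^sub>R x j) powr r) \<le> C" by (simp add: rad_exp_const)
  qed (use r in simp)
  with D show ?thesis by blast
qed

text \<open>Jensen's inequality for the convex function \<open>x powr (r / 2)\<close> of the squared
  norm.\<close>

lemma rad_norm_powr_le:
  assumes "finite J" "r \<ge> 2"
  shows "rad_norm J f powr r \<le> rad_exp J (\<lambda>\<epsilon>. norm (f \<epsilon>) powr r)"
proof -
  let ?c = "1 / 2 ^ card J :: real"
  have ne: "signs J \<noteq> {}" by (simp add: PiE_eq_empty_iff)
  have "rad_norm J f powr r = ((rad_norm J f)\<^sup>2) powr (r / 2)"
    by (simp add: powr_powr rad_norm_nonneg flip: powr_numeral)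
  also have "\<dots> = (\<Sum>\<epsilon>\<in>signs J. ?c *\<^sub>R (norm (f \<epsilon>))\<^sup>2) powr (r / 2)"
    unfolding rad_norm_square rad_exp_def by (simp add: sum_divide_distrib)
  also have "\<dots> \<le> (\<Sum>\<epsilon>\<in>signs J. ?c * ((norm (f \<epsilon>))\<^sup>2) powr (r / 2))"
    by (rule convex_on_sum[OF finite_signs[OF assms(1)] ne convex_on_powr_nonneg])
       (use assms in \<open>auto simp: card_signs\<close>)
  also have "\<dots> = rad_exp J (\<lambda>\<epsilon>. norm (f \<epsilon>) powr r)"
    unfolding rad_exp_def by (simp add: sum_divide_distrib powr_powr flip: powr_numeral)
  finally show ?thesis .
qed

lemma sublinear_rad_norm: "sublinear (\<lambda>h. rad_norm J (\<lambda>\<epsilon>. \<Sum>j\<in>J. (h j * \<epsilon> j) *\<^sub>R z j))"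
  unfolding sublinear_def
proof (intro conjI allI impI)
  fix g h :: "'a \<Rightarrow> real"
  show "rad_norm J (\<lambda>\<epsilon>. \<Sum>j\<in>J. ((g + h) j * \<epsilon> j) *\<^sub>R z j)
    \<le> rad_norm J (\<lambda>\<epsilon>. \<Sum>j\<in>J. (g j * \<epsilon> j) *\<^sub>R z j) + rad_norm J (\<lambda>\<epsilon>. \<Sum>j\<in>J. (h j * \<epsilon> j) *\<^sub>R z j)"
    by (rule order_trans[OF _ rad_norm_triangle])
       (simp add: distrib_right scaleR_add_left sum.distrib)
next
  fix c :: real and h :: "'a \<Rightarrow> real" assume "0 \<le> c"
  then show "rad_norm J (\<lambda>\<epsilon>. \<Sum>j\<in>J. ((c *\<^sub>R h) j * \<epsilon> j) *\<^sub>R z j) = c * rad_norm J (\<lambda>\<epsilon>. \<Sum>j\<in>J. (h j * \<epsilon> j) *\<^sub>R z j)"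
    using rad_norm_scale[of J c "\<lambda>\<epsilon>. \<Sum>j\<in>J. (h j * \<epsilon> j) *\<^sub>R z j"]
    by (simp add: scaleR_sum_right mult.assoc)
qed

lemma rad_norm_sign_change:
  assumes J: "finite J" and s: "s \<in> signs J"
  shows "rad_norm J (\<lambda>\<epsilon>. \<Sum>j\<in>J. (s j * \<epsilon> j) *\<^sub>R z j) = rad_norm J (\<lambda>\<epsilon>. \<Sum>j\<in>J. \<epsilon> j *\<^sub>R z j)"
proof -
  have "rad_exp J (\<lambda>\<epsilon>. (norm (\<Sum>j\<in>J. (\<lambda>j\<in>J. s j * \<epsilon> j) j *\<^sub>R z j))\<^sup>2) = rad_exp J (\<lambda>\<epsilon>. (norm (\<Sum>j\<in>J. \<epsilon> j *\<^sub>R z j))\<^sup>2)"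
    using s by (intro rad_exp_flip[OF J]) (auto simp: PiE_iff)
  then show ?thesis unfolding rad_norm_def by (simp cong: sum.cong)
qed

text \<open>The same factorization for the map sending \<open>h\<close> to the random vector with
  summands \<open>h j * \<epsilon> j * z j\<close>, as an operator into the L_2 space of signed
  sums. Its norm is at most \<open>M\<close> by invariance under sign changes. That space inherits
  cotype \<open>r\<close> by averaging the cotype inequality of the original space, and Kahane's
  inequality returns from L_r to L_2.\<close>

lemma rademacher_dominated:
  assumes ct: "has_cotype r TYPE('a::real_normed_vector)" and r: "r \<ge> 2" and q: "q > r"
  shows "\<exists>D>0. \<forall>(J::'i set) (z :: 'i \<Rightarrow> 'a) M. finite J \<longrightarrow> M > 0 \<longrightarrow> rad_norm J (\<lambda>\<epsilon>. \<Sum>j\<in>J. \<epsilon> j *\<^sub>R z j) \<le> M \<longrightarrow>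
    (\<exists>\<nu>. (\<forall>j\<in>J. 0 \<le> \<nu> j) \<and> (\<Sum>j\<in>J. \<nu> j) \<le> 1 \<and>
      (\<forall>h t. t > 0 \<longrightarrow> (\<Sum>j\<in>J. \<nu> j * \<bar>h j\<bar> powr q) \<le> t powr q \<longrightarrow>
         rad_norm J (\<lambda>\<epsilon>. \<Sum>j\<in>J. (h j * \<epsilon> j) *\<^sub>R z j) \<le> D * M * t))"
proof -
  obtain C where C: "C > 0" and cot: "\<And>N (x :: nat \<Rightarrow> 'a). (\<Sum>i<N. norm (x i) powr r)
    \<le> C * rad_exp {..<N} (\<lambda>\<epsilon>. norm (\<Sum>i<N. \<epsilon> i *\<^sub>R x i) powr r)"
    using has_cotype_const[OF ct] r by auto
  obtain K where K: "K > 0" and kah: "\<And>(I::'i set) (x :: 'i \<Rightarrow> 'a). finite I \<Longrightarrow>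
    rad_exp I (\<lambda>\<epsilon>. norm (\<Sum>i\<in>I. \<epsilon> i *\<^sub>R x i) powr r) \<le> K * rad_norm I (\<lambda>\<epsilon>. \<Sum>i\<in>I. \<epsilon> i *\<^sub>R x i) powr r"
    using Kahane[of r, where 'a = 'a and 'i = 'i] r by auto
  define D where "D M = maurey_const r q * (C * K * M powr r) powr (1 / r)" for M
  have D: "D 1 > 0"
  proof -
    have "2 powr (1 - q / r) < 1" using q r by (intro powr_less_one) (auto simp: divide_simps)
    then show ?thesis using C K r by (simp add: D_def maurey_const_def add_pos_nonneg)
  qed
  have DM: "D M = D 1 * M" if "M > 0" for M using that C K r by (simp add: D_def powr_mult powr_powr)
  have "\<exists>\<nu>. (\<forall>j\<in>J. 0 \<le> \<nu> j) \<and> (\<Sum>j\<in>J. \<nu> j) \<le> 1 \<and>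
      (\<forall>h t. t > 0 \<longrightarrow> (\<Sum>j\<in>J. \<nu> j * \<bar>h j\<bar> powr q) \<le> t powr q \<longrightarrow>
         rad_norm J (\<lambda>\<epsilon>. \<Sum>j\<in>J. (h j * \<epsilon> j) *\<^sub>R z j) \<le> D 1 * M * t)"
    if J: "finite J" and M: "M > 0" and z: "rad_norm J (\<lambda>\<epsilon>. \<Sum>j\<in>J. \<epsilon> j *\<^sub>R z j) \<le> M"
    for J :: "'i set" and z :: "'i \<Rightarrow> 'a" and M
    unfolding DM[OF M, symmetric] unfolding D_def
  proof (rule summing_dominated[OF J sublinear_rad_norm _ _ _ q])
    show "C * K * M powr r > 0" using C K M by simp
    fix h :: "'i \<Rightarrow> real"
    show "rad_norm J (\<lambda>\<epsilon>. \<Sum>j\<in>J. ((- h) j * \<epsilon> j) *\<^sub>R z j) = rad_norm J (\<lambda>\<epsilon>. \<Sum>j\<in>J. (h j * \<epsilon> j) *\<^sub>R z j)"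
      by (simp add: rad_norm_def sum_negf)
    show "rad_norm J (\<lambda>\<epsilon>. \<Sum>j\<in>J. (h j * \<epsilon> j) *\<^sub>R z j) = 0" if "\<forall>j\<in>J. h j = 0"
      using that by (simp add: rad_norm_def rad_exp_def)
  next
    fix n :: nat and h :: "nat \<Rightarrow> 'i \<Rightarrow> real" assume h: "\<forall>j\<in>J. (\<Sum>i<n. \<bar>h i j\<bar>) \<le> 1"
    define H where "H \<delta> j = (\<Sum>i<n. \<delta> i * h i j)" for \<delta> j
    have "(\<Sum>i<n. rad_norm J (\<lambda>\<epsilon>. \<Sum>j\<in>J. (h i j * \<epsilon> j) *\<^sub>R z j) powr r)
      \<le> (\<Sum>i<n. rad_exp J (\<lambda>\<epsilon>. norm (\<Sum>j\<in>J. (h i j * \<epsilon> j) *\<^sub>R z j) powr r))"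
      by (intro sum_mono rad_norm_powr_le J r)
    also have "\<dots> = rad_exp J (\<lambda>\<epsilon>. \<Sum>i<n. norm (\<Sum>j\<in>J. (h i j * \<epsilon> j) *\<^sub>R z j) powr r)"
      by (rule rad_exp_sum[symmetric])
    also have "\<dots> \<le> rad_exp J (\<lambda>\<epsilon>. C * rad_exp {..<n} (\<lambda>\<delta>. norm (\<Sum>j\<in>J. (H \<delta> j * \<epsilon> j) *\<^sub>R z j) powr r))"
    proof (rule rad_exp_mono)
      fix \<epsilon> :: "'i \<Rightarrow> real"
      have "(\<Sum>i<n. \<delta> i *\<^sub>R (\<Sum>j\<in>J. (h i j * \<epsilon> j) *\<^sub>R z j)) = (\<Sum>j\<in>J. (H \<delta> j * \<epsilon> j) *\<^sub>R z j)" for \<delta>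
        by (simp only: sum_scaleR_swap) (simp add: H_def sum_distrib_right mult.assoc)
      then show "(\<Sum>i<n. norm (\<Sum>j\<in>J. (h i j * \<epsilon> j) *\<^sub>R z j) powr r)
        \<le> C * rad_exp {..<n} (\<lambda>\<delta>. norm (\<Sum>j\<in>J. (H \<delta> j * \<epsilon> j) *\<^sub>R z j) powr r)"
        using cot[of "\<lambda>i. \<Sum>j\<in>J. (h i j * \<epsilon> j) *\<^sub>R z j" n] by simp
    qed
    also have "\<dots> = C * rad_exp {..<n} (\<lambda>\<delta>. rad_exp J (\<lambda>\<epsilon>. norm (\<Sum>j\<in>J. (H \<delta> j * \<epsilon> j) *\<^sub>R z j) powr r))"
      by (simp only: rad_exp_mult_left rad_exp_swap[of J])
    also have "\<dots> \<le> C * rad_exp {..<n} (\<lambda>\<delta>. K * M powr r)"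
    proof (intro mult_left_mono rad_exp_mono)
      fix \<delta> assume \<delta>: "\<delta> \<in> signs {..<n}"
      have "rad_norm J (\<lambda>\<epsilon>. \<Sum>j\<in>J. (H \<delta> j * \<epsilon> j) *\<^sub>R z j) \<le> M"
      proof (rule sublinear_cube_bound[OF sublinear_rad_norm J])
        show "rad_norm J (\<lambda>\<epsilon>. \<Sum>j\<in>J. (s j * \<epsilon> j) *\<^sub>R z j) \<le> M" if "s \<in> signs J" for s
          using rad_norm_sign_change[OF J that, of z] z by simp
        show "\<bar>H \<delta> j\<bar> \<le> 1" if "j \<in> J" for j
          unfolding H_def using sign_sum_bound[OF \<delta>, of h j] h that by blast
      qed (simp cong: sum.cong)
      then have "K * rad_norm J (\<lambda>\<epsilon>. \<Sum>j\<in>J. (H \<delta> j * \<epsilon> j) *\<^sub>R z j) powr r \<le> K * M powr r"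
        using K r by (intro mult_left_mono powr_mono2) (auto simp: rad_norm_nonneg)
      moreover have "rad_exp J (\<lambda>\<epsilon>. norm (\<Sum>j\<in>J. (H \<delta> j * \<epsilon> j) *\<^sub>R z j) powr r)
         \<le> K * rad_norm J (\<lambda>\<epsilon>. \<Sum>j\<in>J. (H \<delta> j * \<epsilon> j) *\<^sub>R z j) powr r"
        using kah[OF J, of "\<lambda>j. H \<delta> j *\<^sub>R z j"] by (simp add: mult.commute)
      ultimately show "rad_exp J (\<lambda>\<epsilon>. norm (\<Sum>j\<in>J. (H \<delta> j * \<epsilon> j) *\<^sub>R z j) powr r) \<le> K * M powr r" by linarith
    qed (use C in simp)
    finally show "(\<Sum>i<n. rad_norm J (\<lambda>\<epsilon>. \<Sum>j\<in>J. (h i j * \<epsilon> j) *\<^sub>R z j) powr r) \<le> C * K * M powr r"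
      by (simp add: rad_exp_const)
  qed (use r in simp)
  with D show ?thesis by blast
qed

section \<open>Gaussian averages\<close>

lemma nn_integral_exp_square_real:
  assumes "\<sigma> > 0"
  shows "(\<integral>\<^sup>+x. ennreal (exp (- x\<^sup>2 / (2 * \<sigma>\<^sup>2))) \<partial>lborel) = ennreal (sqrt (2 * pi * \<sigma>\<^sup>2))"
proof -
  have "(\<integral>\<^sup>+x. ennreal (exp (- x\<^sup>2 / (2 * \<sigma>\<^sup>2))) \<partial>lborel) =
      (\<integral>\<^sup>+x. ennreal (sqrt (2 * pi * \<sigma>\<^sup>2)) * ennreal (normal_density 0 \<sigma> x) \<partial>lborel)"
    using assms by (intro nn_integral_cong) (simp add: normal_density_def flip: ennreal_mult)
  also have "\<dots> = ennreal (sqrt (2 * pi * \<sigma>\<^sup>2)) * (\<integral>\<^sup>+x. ennreal (normal_density 0 \<sigma> x) \<partial>lborel)"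
    by (rule nn_integral_cmult) simp
  also have "(\<integral>\<^sup>+x. ennreal (normal_density 0 \<sigma> x) \<partial>lborel) = ennreal 1"
    using nn_integral_eq_integral[OF integrable_normal_density[OF assms, of 0]] integral_normal_density[OF assms, of 0]
      normal_density_nonneg by simp
  finally show ?thesis by simp
qed

lemma nn_integral_exp_square_complex:
  assumes "\<sigma> > 0"
  shows "(\<integral>\<^sup>+z. ennreal (exp (- (cmod z)\<^sup>2 / (2 * \<sigma>\<^sup>2))) \<partial>lborel) = ennreal (2 * pi * \<sigma>\<^sup>2)"
proof -
  have "exp (- (cmod z)\<^sup>2 / (2 * \<sigma>\<^sup>2)) = (\<Prod>b\<in>Basis. exp (- (z \<bullet> b)\<^sup>2 / (2 * \<sigma>\<^sup>2)))" for z
    by (simp add: Basis_complex_def cmod_power2 complex_i_not_one inner_complex_def flip: exp_add)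
       (simp add: diff_divide_distrib)
  then have "(\<integral>\<^sup>+z. ennreal (exp (- (cmod z)\<^sup>2 / (2 * \<sigma>\<^sup>2))) \<partial>lborel) =
     (\<integral>\<^sup>+z. (\<Prod>b\<in>Basis. ennreal (exp (- (z \<bullet> b)\<^sup>2 / (2 * \<sigma>\<^sup>2)))) \<partial>(lborel::complex measure))"
    by (simp add: prod_ennreal)
  also have "\<dots> = (\<Prod>b\<in>(Basis::complex set). (\<integral>\<^sup>+x. ennreal (exp (- x\<^sup>2 / (2 * \<sigma>\<^sup>2))) \<partial>lborel))"
    by (rule nn_integral_lborel_prod) auto
  also have "\<dots> = ennreal (sqrt (2 * pi * \<sigma>\<^sup>2)) * ennreal (sqrt (2 * pi * \<sigma>\<^sup>2))"
    unfolding nn_integral_exp_square_real[OF assms] by (simp add: Basis_complex_def complex_i_not_one power2_eq_square)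
  also have "\<dots> = ennreal (2 * pi * \<sigma>\<^sup>2)"
    using assms by (simp flip: ennreal_mult)
  finally show ?thesis .
qed

lemma cgauss_density_measurable [measurable]: "(\<lambda>z. ennreal (exp (- (cmod z)\<^sup>2) / pi)) \<in> borel_measurable borel"
  by measurable

lemma sets_cgauss [simp, measurable_cong]: "sets cgauss = sets borel"
  and space_cgauss [simp]: "space cgauss = UNIV"
  by (simp_all add: cgauss_def)

lemma prob_space_cgauss: "prob_space cgauss"
proof
  have "(\<integral>\<^sup>+z. ennreal (exp (- (cmod z)\<^sup>2)) \<partial>lborel) = ennreal pi"
    using nn_integral_exp_square_complex[of "1 / sqrt 2"] by (simp add: power_divide)
  moreover have "(\<integral>\<^sup>+z. ennreal (exp (- (cmod z)\<^sup>2) / pi) \<partial>lborel) = (\<integral>\<^sup>+z. ennreal (exp (- (cmod z)\<^sup>2)) / ennreal pi \<partial>lborel)"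
    by (intro nn_integral_cong) (simp add: divide_ennreal)
  ultimately have "(\<integral>\<^sup>+z. ennreal (exp (- (cmod z)\<^sup>2) / pi) \<partial>lborel) = ennreal pi / ennreal pi"
    by (simp add: nn_integral_divide)
  also have "\<dots> = 1" by (simp add: divide_ennreal)
  finally show "emeasure cgauss (space cgauss) = 1"
    by (simp add: cgauss_def emeasure_density)
qed

text \<open>From \<open>|z| \<le> exp |z|\<close> and
  \<open>q * |z| \<le> q^2 / 2 + |z|^2 / 2\<close>, half of the Gaussian exponent pays for the
  power.\<close>

lemma cgauss_moment:
  assumes "q \<ge> 0"
  shows "integrable cgauss (\<lambda>z. cmod z powr q)"
proof (rule integrableI_bounded)
  have le: "cmod z powr q * exp (- (cmod z)\<^sup>2) \<le> exp (q\<^sup>2 / 2) * exp (- (cmod z)\<^sup>2 / 2)" for z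
  proof -
    have "cmod z powr q \<le> exp (cmod z) powr q"
      using exp_ge_add_one_self[of "cmod z"] assms by (intro powr_mono2) (auto simp del: exp_ge_add_one_self)
    also have "\<dots> = exp (q * cmod z)" by (simp add: powr_def)
    also have "\<dots> \<le> exp (q\<^sup>2 / 2 + (cmod z)\<^sup>2 / 2)"
      using sum_squares_bound[of q "cmod z"] by simp
    finally have "cmod z powr q * exp (- (cmod z)\<^sup>2) \<le> exp (q\<^sup>2 / 2 + (cmod z)\<^sup>2 / 2) * exp (- (cmod z)\<^sup>2)"
      by (rule mult_right_mono) simp
    also have "\<dots> = exp (q\<^sup>2 / 2) * exp (- (cmod z)\<^sup>2 / 2)" by (simp flip: exp_add)
    finally show ?thesis .
  qed
  show "(\<lambda>z. cmod z powr q) \<in> borel_measurable cgauss" by measurable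
  have "(\<integral>\<^sup>+z. ennreal (norm (cmod z powr q)) \<partial>cgauss) =
     (\<integral>\<^sup>+z. ennreal (exp (- (cmod z)\<^sup>2) / pi) * ennreal (cmod z powr q) \<partial>lborel)"
    unfolding cgauss_def by (subst nn_integral_density) (auto simp: mult.commute)
  also have "\<dots> \<le> (\<integral>\<^sup>+z. ennreal (exp (q\<^sup>2 / 2) / pi) * ennreal (exp (- (cmod z)\<^sup>2 / (2 * 1\<^sup>2))) \<partial>lborel)"
  proof (intro nn_integral_mono)
    fix z :: complex
    show "ennreal (exp (- (cmod z)\<^sup>2) / pi) * ennreal (cmod z powr q)
      \<le> ennreal (exp (q\<^sup>2 / 2) / pi) * ennreal (exp (- (cmod z)\<^sup>2 / (2 * 1\<^sup>2)))"
      using divide_right_mono[OF le[of z], of pi]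
      by (simp add: mult.commute ennreal_leI flip: ennreal_mult)
  qed
  also have "\<dots> = ennreal (exp (q\<^sup>2 / 2) / pi) * ennreal (2 * pi * 1\<^sup>2)"
    by (subst nn_integral_cmult) (simp_all only: nn_integral_exp_square_complex zero_less_one, measurable)
  also have "\<dots> < \<infinity>" by (simp add: ennreal_mult_less_top)
  finally show "(\<integral>\<^sup>+z. ennreal (norm (cmod z powr q)) \<partial>cgauss) < \<infinity>" .
qed

text \<open>Positivity allows division by the second moment after trace duality.\<close>

lemma cgauss_second_moment: "integrable cgauss (\<lambda>z. (cmod z)\<^sup>2)" "(\<integral>z. (cmod z)\<^sup>2 \<partial>cgauss) > 0"
proof -
  show int: "integrable cgauss (\<lambda>z. (cmod z)\<^sup>2)"
    using cgauss_moment[of 2] by simp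
  have "(\<integral>z. (cmod z)\<^sup>2 \<partial>cgauss) \<noteq> 0"
  proof
    assume "(\<integral>z. (cmod z)\<^sup>2 \<partial>cgauss) = 0"
    then have "AE z in cgauss. (cmod z)\<^sup>2 = 0"
      by (subst (asm) integral_nonneg_eq_0_iff_AE[OF int]) auto
    then have "AE z in (lborel :: complex measure). z = 0"
      unfolding cgauss_def by (subst (asm) AE_density) auto
    moreover have "AE z in (lborel :: complex measure). z \<noteq> 0" by (rule AE_lborel_singleton)
    ultimately have "AE z in (lborel :: complex measure). False" by eventually_elim auto
    then have "emeasure (lborel :: complex measure) UNIV = 0"
      by (simp add: AE_iff_measurable[OF _ refl])
    then show False by simp
  qed
  then show "(\<integral>z. (cmod z)\<^sup>2 \<partial>cgauss) > 0"
    by (simp add: order_less_le)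
qed

lemma cgauss_uminus: "distr cgauss cgauss uminus = cgauss"
proof -
  have lb: "distr lborel borel uminus = (lborel :: complex measure)"
    using lborel_affine[of "- 1" "0 :: complex"] by (simp add: density_1)
  have "distr cgauss cgauss uminus = distr (density lborel (\<lambda>z. ennreal (exp (- (cmod z)\<^sup>2) / pi))) borel uminus"
    unfolding cgauss_def by (rule distr_cong) auto
  also have "\<dots> = density (distr lborel borel uminus) (\<lambda>z. ennreal (exp (- (cmod z)\<^sup>2) / pi))"
    by (subst density_distr) auto
  also have "\<dots> = cgauss" unfolding lb cgauss_def ..
  finally show ?thesis .
qed

section \<open>Products of complex Gaussians and their sign symmetry\<close>

abbreviation gauss_prod :: "nat \<Rightarrow> (nat \<Rightarrow> complex) measure" where
  "gauss_prod n \<equiv> PiM {..<n} (\<lambda>_. cgauss)"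

lemma prob_space_gauss_prod: "prob_space (gauss_prod n)"
  by (intro prob_space_PiM prob_space_cgauss)

lemma product_sigma_finite_cgauss: "product_sigma_finite (\<lambda>_. cgauss)"
  unfolding product_sigma_finite_def by (intro allI prob_space_imp_sigma_finite prob_space_cgauss)

lemma gauss_prod_component_measurable: "i < n \<Longrightarrow> (\<lambda>\<gamma>. \<gamma> i) \<in> borel_measurable (gauss_prod n)"
  using measurable_component_singleton[of i "{..<n}" "\<lambda>_. cgauss"] by simp

lemma gauss_prod_component: "i < n \<Longrightarrow> distr (gauss_prod n) cgauss (\<lambda>\<gamma>. \<gamma> i) = cgauss"
  by (rule distr_PiM_component) (auto simp: prob_space_cgauss)

lemma gauss_prod_flip:
  fixes n :: nat
  assumes s: "\<And>i. i < n \<Longrightarrow> s i \<in> {- 1, 1 :: real}"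
  defines "T \<equiv> \<lambda>\<gamma>. \<lambda>i\<in>{..<n}. of_real (s i) * \<gamma> i"
  shows "T \<in> gauss_prod n \<rightarrow>\<^sub>M gauss_prod n" "distr (gauss_prod n) (gauss_prod n) T = gauss_prod n"
proof -
  interpret product_sigma_finite "\<lambda>_::nat. cgauss" by (rule product_sigma_finite_cgauss)
  show T: "T \<in> gauss_prod n \<rightarrow>\<^sub>M gauss_prod n"
    unfolding T_def by measurable
  show "distr (gauss_prod n) (gauss_prod n) T = gauss_prod n"
  proof (rule PiM_eqI)
    fix A :: "nat \<Rightarrow> complex set" assume A: "\<And>i. i \<in> {..<n} \<Longrightarrow> A i \<in> sets cgauss"
    have B: "((*) (of_real (s i)) -` A i) \<in> sets cgauss \<and> emeasure cgauss ((*) (of_real (s i)) -` A i) = emeasure cgauss (A i)"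
      if "i < n" for i
    proof -
      have m: "(*) (of_real (s i)) \<in> cgauss \<rightarrow>\<^sub>M cgauss" by measurable
      have "distr cgauss cgauss ((*) (of_real (s i))) = cgauss"
      proof -
        have "(*) (of_real (s i)) = (\<lambda>z::complex. z) \<or> (*) (of_real (s i)) = (uminus :: complex \<Rightarrow> complex)"
          using s[OF that] by (auto simp: fun_eq_iff)
        then show ?thesis using cgauss_uminus distr_id[of cgauss] by auto
      qed
      then show ?thesis
        using emeasure_distr[OF m, of "A i"] measurable_sets[OF m, of "A i"] A[of i] that by simp
    qed
    have "T -` (PiE {..<n} A) \<inter> space (gauss_prod n) = PiE {..<n} (\<lambda>i. (*) (of_real (s i)) -` A i)"
      by (auto simp: T_def space_PiM PiE_iff)
    then have "emeasure (distr (gauss_prod n) (gauss_prod n) T) (PiE {..<n} A) =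
        emeasure (gauss_prod n) (PiE {..<n} (\<lambda>i. (*) (of_real (s i)) -` A i))"
      using A by (subst emeasure_distr[OF T]) (auto intro!: sets_PiM_I_finite)
    also have "\<dots> = (\<Prod>i<n. emeasure cgauss ((*) (of_real (s i)) -` A i))"
      using B by (intro emeasure_PiM) auto
    also have "\<dots> = (\<Prod>i<n. emeasure cgauss (A i))" using B by (intro prod.cong) auto
    finally show "emeasure (distr (gauss_prod n) (gauss_prod n) T) (PiE {..<n} A) = (\<Prod>i<n. emeasure cgauss (A i))" .
  qed auto
qed

lemma integral_gauss_prod_flip:
  fixes F :: "(nat \<Rightarrow> complex) \<Rightarrow> 'b::{banach, second_countable_topology}"
  assumes s: "\<And>i. i < n \<Longrightarrow> s i \<in> {- 1, 1 :: real}" and F: "F \<in> borel_measurable (gauss_prod n)"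
  shows "(\<integral>\<gamma>. F (\<lambda>i\<in>{..<n}. of_real (s i) * \<gamma> i) \<partial>gauss_prod n) = (\<integral>\<gamma>. F \<gamma> \<partial>gauss_prod n)"
proof -
  note T = gauss_prod_flip[of n s, OF s]
  have "(\<integral>\<gamma>. F \<gamma> \<partial>gauss_prod n) = (\<integral>\<gamma>. F \<gamma> \<partial>distr (gauss_prod n) (gauss_prod n) (\<lambda>\<gamma>. \<lambda>i\<in>{..<n}. of_real (s i) * \<gamma> i))"
    using T(2) by simp
  also have "\<dots> = (\<integral>\<gamma>. F (\<lambda>i\<in>{..<n}. of_real (s i) * \<gamma> i) \<partial>gauss_prod n)"
    by (rule integral_distr[OF T(1) F])
  finally show ?thesis ..
qed

lemma gauss_prod_moment:
  assumes "i < n" "q \<ge> 0"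
  shows "integrable (gauss_prod n) (\<lambda>\<gamma>. cmod (\<gamma> i) powr q)"
    and "(\<integral>\<gamma>. cmod (\<gamma> i) powr q \<partial>gauss_prod n) = (\<integral>z. cmod z powr q \<partial>cgauss)"
proof -
  have m: "(\<lambda>\<gamma>. \<gamma> i) \<in> gauss_prod n \<rightarrow>\<^sub>M cgauss" using assms by simp
  have f: "(\<lambda>z. cmod z powr q) \<in> borel_measurable cgauss" by measurable
  show "integrable (gauss_prod n) (\<lambda>\<gamma>. cmod (\<gamma> i) powr q)"
    using integrable_distr_eq[OF m f] gauss_prod_component[OF assms(1)] cgauss_moment[OF assms(2)] by simp
  show "(\<integral>\<gamma>. cmod (\<gamma> i) powr q \<partial>gauss_prod n) = (\<integral>z. cmod z powr q \<partial>cgauss)"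
    using integral_distr[OF m f] gauss_prod_component[OF assms(1)] by simp
qed

lemma gauss_prod_square:
  assumes "i < n"
  shows "integrable (gauss_prod n) (\<lambda>\<gamma>. (cmod (\<gamma> i))\<^sup>2)"
    and "(\<integral>\<gamma>. (cmod (\<gamma> i))\<^sup>2 \<partial>gauss_prod n) = (\<integral>z. (cmod z)\<^sup>2 \<partial>cgauss)"
  using gauss_prod_moment[OF assms, of 2] by simp_all

text \<open>Flipping the sign of one coordinate negates an off-diagonal term, whose integral is
  therefore zero. The diagonal leaves the trace of \<open>a\<close> times the second moment.\<close>

lemma gauss_prod_pairing:
  fixes a :: "nat \<Rightarrow> nat \<Rightarrow> complex" and n :: nat
  defines "F \<equiv> \<lambda>\<gamma>. \<Sum>j<n. \<Sum>k<n. cnj (\<gamma> j) * \<gamma> k * a j k"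
  shows "integrable (gauss_prod n) F"
    and "(\<integral>\<gamma>. F \<gamma> \<partial>gauss_prod n) = of_real (\<integral>z. (cmod z)\<^sup>2 \<partial>cgauss) * (\<Sum>j<n. a j j)"
proof -
  have meas: "(\<lambda>\<gamma>. cnj (\<gamma> j) * \<gamma> k) \<in> borel_measurable (gauss_prod n)" if "j < n" "k < n" for j k
  proof -
    have "cnj \<in> borel_measurable borel" by (intro borel_measurable_continuous_onI continuous_intros)
    from measurable_compose[OF gauss_prod_component_measurable[OF that(1)] this]
    show ?thesis by (intro borel_measurable_times gauss_prod_component_measurable that)
  qed
  have int: "integrable (gauss_prod n) (\<lambda>\<gamma>. cnj (\<gamma> j) * \<gamma> k)" if "j < n" "k < n" for j k
  proof (rule Bochner_Integration.integrable_bound)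
    show "integrable (gauss_prod n) (\<lambda>\<gamma>. (cmod (\<gamma> j))\<^sup>2 + (cmod (\<gamma> k))\<^sup>2)"
      by (intro Bochner_Integration.integrable_add gauss_prod_square that)
    have "cmod (cnj z * w) \<le> (cmod z)\<^sup>2 + (cmod w)\<^sup>2" for z w
      using sum_squares_bound[of "cmod z" "cmod w"] mult_nonneg_nonneg[of "cmod z" "cmod w"]
      by (simp add: norm_mult del: mult_nonneg_nonneg)
    then show "AE \<gamma> in gauss_prod n. norm (cnj (\<gamma> j) * \<gamma> k) \<le> norm ((cmod (\<gamma> j))\<^sup>2 + (cmod (\<gamma> k))\<^sup>2)"
      by simp
    show "(\<lambda>\<gamma>. cnj (\<gamma> j) * \<gamma> k) \<in> borel_measurable (gauss_prod n)" by (rule meas[OF that])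
  qed
  show "integrable (gauss_prod n) F"
    unfolding F_def by (intro Bochner_Integration.integrable_sum integrable_mult_left int) auto
  have val: "(\<integral>\<gamma>. cnj (\<gamma> j) * \<gamma> k \<partial>gauss_prod n) = (if j = k then of_real (\<integral>z. (cmod z)\<^sup>2 \<partial>cgauss) else 0)"
    if jk: "j < n" "k < n" for j k
  proof (cases "j = k")
    case True
    have "(\<integral>\<gamma>. cnj (\<gamma> j) * \<gamma> j \<partial>gauss_prod n) = (\<integral>\<gamma>. of_real ((cmod (\<gamma> j))\<^sup>2) \<partial>gauss_prod n)"
      by (simp only: complex_norm_square mult.commute)
    also have "\<dots> = of_real (\<integral>\<gamma>. (cmod (\<gamma> j))\<^sup>2 \<partial>gauss_prod n)" by (rule integral_complex_of_real)
    finally show ?thesis using True gauss_prod_square(2)[OF jk(1)] by simp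
  next
    case False
    define s where "s i = (if i = j then - 1 else 1 :: real)" for i
    have "(\<integral>\<gamma>. cnj (\<gamma> j) * \<gamma> k \<partial>gauss_prod n) =
      (\<integral>\<gamma>. cnj ((\<lambda>i\<in>{..<n}. of_real (s i) * \<gamma> i) j) * (\<lambda>i\<in>{..<n}. of_real (s i) * \<gamma> i) k \<partial>gauss_prod n)"
      by (rule integral_gauss_prod_flip[symmetric, of n s "\<lambda>\<gamma>. cnj (\<gamma> j) * \<gamma> k"]) (use jk meas in \<open>auto simp: s_def\<close>)
    also have "\<dots> = (\<integral>\<gamma>. - (cnj (\<gamma> j) * \<gamma> k) \<partial>gauss_prod n)"
      using jk False by (simp add: s_def)
    also have "\<dots> = - (\<integral>\<gamma>. cnj (\<gamma> j) * \<gamma> k \<partial>gauss_prod n)" by simp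
    finally show ?thesis using False by simp
  qed
  have "(\<integral>\<gamma>. F \<gamma> \<partial>gauss_prod n) = (\<Sum>j<n. \<Sum>k<n. (\<integral>\<gamma>. cnj (\<gamma> j) * \<gamma> k \<partial>gauss_prod n) * a j k)"
  proof -
    have i1: "integrable (gauss_prod n) (\<lambda>\<gamma>. cnj (\<gamma> j) * \<gamma> k * a j k)" if "j < n" "k < n" for j k
      by (intro integrable_mult_left int that)
    have i2: "integrable (gauss_prod n) (\<lambda>\<gamma>. \<Sum>k<n. cnj (\<gamma> j) * \<gamma> k * a j k)" if "j < n" for j
      using i1 that by (intro Bochner_Integration.integrable_sum) auto
    have "(\<integral>\<gamma>. F \<gamma> \<partial>gauss_prod n) = (\<Sum>j<n. \<integral>\<gamma>. (\<Sum>k<n. cnj (\<gamma> j) * \<gamma> k * a j k) \<partial>gauss_prod n)"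
      unfolding F_def using i2 by (intro Bochner_Integration.integral_sum) auto
    also have "\<dots> = (\<Sum>j<n. \<Sum>k<n. \<integral>\<gamma>. cnj (\<gamma> j) * \<gamma> k * a j k \<partial>gauss_prod n)"
      using i1 by (intro sum.cong refl Bochner_Integration.integral_sum) auto
    finally show ?thesis by simp
  qed
  also have "\<dots> = (\<Sum>j<n. \<Sum>k<n. if j = k then of_real (\<integral>z. (cmod z)\<^sup>2 \<partial>cgauss) * a j k else 0)"
    by (intro sum.cong refl) (auto simp: val)
  also have "\<dots> = of_real (\<integral>z. (cmod z)\<^sup>2 \<partial>cgauss) * (\<Sum>j<n. a j j)"
    by (simp add: sum_distrib_left)
  finally show "(\<integral>\<gamma>. F \<gamma> \<partial>gauss_prod n) = of_real (\<integral>z. (cmod z)\<^sup>2 \<partial>cgauss) * (\<Sum>j<n. a j j)" .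
qed

text \<open>The target space of the seminorm need not be separable, so its measurability is obtained from
  continuity in finitely many coordinates.\<close>

lemma measurable_Lipschitz_coordinates:
  fixes V :: "(nat \<Rightarrow> complex) \<Rightarrow> real"
  assumes lip: "\<And>u v. \<bar>V u - V v\<bar> \<le> (\<Sum>k<n. K k * cmod (u k - v k))"
    and g: "\<And>k. k < n \<Longrightarrow> g k \<in> borel_measurable M"
  shows "(\<lambda>\<omega>. V (\<lambda>k. g k \<omega>)) \<in> borel_measurable M"
proof -
  have cont: "continuous_on UNIV V"
    unfolding continuous_on_def
  proof (intro ballI)
    fix v
    have "((\<lambda>u. \<Sum>k<n. K k * cmod (u k - v k)) \<longlongrightarrow> (\<Sum>k<n. K k * cmod (v k - v k))) (at v)"
    proof (intro tendsto_sum tendsto_mult tendsto_const tendsto_norm tendsto_diff)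
      fix k
      have "continuous_on UNIV (\<lambda>u :: nat \<Rightarrow> complex. u k)" by (rule continuous_on_product_coordinates)
      then show "((\<lambda>u. u k) \<longlongrightarrow> v k) (at v)" by (simp add: continuous_on_def)
    qed
    then have "((\<lambda>u. \<Sum>k<n. K k * cmod (u k - v k)) \<longlongrightarrow> 0) (at v)" by simp
    then have "((\<lambda>u. V u - V v) \<longlongrightarrow> 0) (at v)"
      by (rule Lim_null_comparison[rotated]) (simp add: lip)
    then show "(V \<longlongrightarrow> V v) (at v within UNIV)" by (simp add: LIM_zero_iff)
  qed
  have V: "V \<in> borel_measurable (PiM UNIV (\<lambda>_. borel))"
    using borel_measurable_continuous_onI[OF cont] measurable_cong_sets[OF sets_PiM_equal_borel refl] by blast
  \<comment> \<open>\<open>V\<close> depends on the first \<open>n\<close> coordinates only; filling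
    the others with 0 gives a measurable map into the full product space.\<close>
  have "(\<lambda>\<omega>. \<lambda>k. if k < n then g k \<omega> else 0) \<in> M \<rightarrow>\<^sub>M PiM UNIV (\<lambda>_. borel)"
  proof (rule measurable_PiM_single')
    show "(\<lambda>\<omega>. if k < n then g k \<omega> else 0) \<in> borel_measurable M" for k
      using g by (cases "k < n") auto
  qed auto
  from measurable_compose[OF this V] have "(\<lambda>\<omega>. V (\<lambda>k. if k < n then g k \<omega> else 0)) \<in> borel_measurable M" .
  moreover have "V (\<lambda>k. if k < n then g k \<omega> else 0) = V (\<lambda>k. g k \<omega>)" for \<omega>
    using lip[of "\<lambda>k. if k < n then g k \<omega> else 0" "\<lambda>k. g k \<omega>"] by simp
  ultimately show ?thesis by simp
qed

section \<open>Complex scalars and Gaussian sums in X\<close>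

locale complex_structured =
  fixes smul :: "complex \<Rightarrow> 'a::banach \<Rightarrow> 'a"
  assumes complex_structure: "complex_structure smul"
begin

lemma smul_of_real: "smul (of_real r) x = r *\<^sub>R x"
  and smul_mult: "smul (a * b) x = smul a (smul b x)"
  and smul_add_left: "smul (a + b) x = smul a x + smul b x"
  and smul_add_right: "smul a (x + y) = smul a x + smul a y"
  and norm_smul: "norm (smul a x) = cmod a * norm x"
  using complex_structure unfolding complex_structure_def by auto

lemma smul_zero_right: "smul a 0 = 0"
  using smul_add_right[of a 0 0] by simp

lemma smul_sum_right: "smul a (\<Sum>i\<in>I. f i) = (\<Sum>i\<in>I. smul a (f i))"
  by (induction I rule: infinite_finite_induct) (auto simp: smul_zero_right smul_add_right)

lemma smul_diff_left: "smul (a - b) x = smul a x - smul b x"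
  using smul_add_left[of "a - b" b x] by (simp add: algebra_simps)

lemma smul_scaleR: "smul a (r *\<^sub>R x) = r *\<^sub>R smul a x"
  by (metis mult.commute smul_mult smul_of_real)

lemma smul_Re_Im: "smul a x = Re a *\<^sub>R x + smul \<i> (Im a *\<^sub>R x)"
proof -
  have "smul a x = smul (of_real (Re a) + \<i> * of_real (Im a)) x" by (simp flip: complex_eq)
  then show ?thesis by (simp only: smul_add_left smul_mult smul_of_real)
qed

lemma norm_smul_sum_Lipschitz:
  "\<bar>norm (\<Sum>k\<in>I. smul (u k) (z k)) - norm (\<Sum>k\<in>I. smul (v k) (z k))\<bar> \<le> (\<Sum>k\<in>I. norm (z k) * cmod (u k - v k))"
proof -
  have "\<bar>norm (\<Sum>k\<in>I. smul (u k) (z k)) - norm (\<Sum>k\<in>I. smul (v k) (z k))\<bar>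
      \<le> norm ((\<Sum>k\<in>I. smul (u k) (z k)) - (\<Sum>k\<in>I. smul (v k) (z k)))"
    by (rule norm_triangle_ineq3)
  also have "\<dots> = norm (\<Sum>k\<in>I. smul (u k - v k) (z k))" by (simp add: smul_diff_left sum_subtractf)
  also have "\<dots> \<le> (\<Sum>k\<in>I. norm (z k) * cmod (u k - v k))"
    by (rule sum_norm_le) (simp add: norm_smul mult.commute)
  finally show ?thesis .
qed

lemma measurable_norm_smul_sum:
  fixes n :: nat
  assumes "\<And>k. k < n \<Longrightarrow> g k \<in> borel_measurable M"
  shows "(\<lambda>\<omega>. norm (\<Sum>k<n. smul (g k \<omega>) (z k))) \<in> borel_measurable M"
  using measurable_Lipschitz_coordinates[where V = "\<lambda>u. norm (\<Sum>k<n. smul (u k) (z k))", OF norm_smul_sum_Lipschitz assms] .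

lemma gaussian_square_integrable:
  "integrable (gauss_prod n) (\<lambda>\<gamma>. (norm (\<Sum>j<n. smul (cnj (\<gamma> j)) (z j)))\<^sup>2)"
proof (rule Bochner_Integration.integrable_bound)
  show "integrable (gauss_prod n) (\<lambda>\<gamma>. (\<Sum>j<n. (norm (z j))\<^sup>2) * (\<Sum>j<n. (cmod (\<gamma> j))\<^sup>2))"
    by (intro integrable_mult_right Bochner_Integration.integrable_sum gauss_prod_square) auto
  have "norm (\<Sum>j<n. smul (cnj (\<gamma> j)) (z j)) \<le> (\<Sum>j<n. norm (z j) * cmod (\<gamma> j))" for \<gamma> :: "nat \<Rightarrow> complex"
    by (rule sum_norm_le) (simp add: norm_smul mult.commute)
  then have "(norm (\<Sum>j<n. smul (cnj (\<gamma> j)) (z j)))\<^sup>2 \<le> (\<Sum>j<n. norm (z j) * cmod (\<gamma> j))\<^sup>2" for \<gamma> :: "nat \<Rightarrow> complex"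
    by (intro power_mono) auto
  from order_trans[OF this Cauchy_Schwarz_ineq_sum]
  show "AE \<gamma> in gauss_prod n. norm ((norm (\<Sum>j<n. smul (cnj (\<gamma> j)) (z j)))\<^sup>2)
      \<le> norm ((\<Sum>j<n. (norm (z j))\<^sup>2) * (\<Sum>j<n. (cmod (\<gamma> j))\<^sup>2))"
    by (simp add: sum_nonneg abs_mult)
  have "cnj \<in> borel_measurable borel" by (intro borel_measurable_continuous_onI continuous_intros)
  then have "(\<lambda>\<gamma>. norm (\<Sum>j<n. smul (cnj (\<gamma> j)) (z j))) \<in> borel_measurable (gauss_prod n)"
    by (intro measurable_norm_smul_sum measurable_compose[OF gauss_prod_component_measurable]) auto
  then show "(\<lambda>\<gamma>. (norm (\<Sum>j<n. smul (cnj (\<gamma> j)) (z j)))\<^sup>2) \<in> borel_measurable (gauss_prod n)"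
    by (rule borel_measurable_power)
qed

text \<open>By symmetry random signs may be inserted; conditionally on the Gaussians, the domination of the
  Rademacher average by an \<open>L\<^sub>q\<close> norm then applies.\<close>

lemma gaussian_le_rademacher:
  assumes ct: "has_cotype r TYPE('a)" and r: "r \<ge> 2"
  shows "\<exists>C>0. \<forall>n (z :: nat \<Rightarrow> 'a) M. M > 0 \<longrightarrow> rad_norm {..<n} (\<lambda>\<epsilon>. \<Sum>j<n. \<epsilon> j *\<^sub>R z j) \<le> M \<longrightarrow>
    (\<integral>\<gamma>. (norm (\<Sum>j<n. smul (cnj (\<gamma> j)) (z j)))\<^sup>2 \<partial>gauss_prod n) \<le> C * M\<^sup>2"
proof -
  \<comment> \<open>An auxiliary exponent, local to this lemma, chosen to exceed
    \<open>r\<close>.\<close>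
  define q where "q = r + 1"
  have q: "q > r" "q \<ge> 2" using r by (auto simp: q_def)
  obtain D where D: "D > 0" and dom: "\<And>(J::nat set) (z :: nat \<Rightarrow> 'a) M. finite J \<Longrightarrow> M > 0 \<Longrightarrow>
    rad_norm J (\<lambda>\<epsilon>. \<Sum>j\<in>J. \<epsilon> j *\<^sub>R z j) \<le> M \<Longrightarrow>
    (\<exists>\<nu>. (\<forall>j\<in>J. 0 \<le> \<nu> j) \<and> (\<Sum>j\<in>J. \<nu> j) \<le> 1 \<and>
      (\<forall>h t. t > 0 \<longrightarrow> (\<Sum>j\<in>J. \<nu> j * \<bar>h j\<bar> powr q) \<le> t powr q \<longrightarrow>
         rad_norm J (\<lambda>\<epsilon>. \<Sum>j\<in>J. (h j * \<epsilon> j) *\<^sub>R z j) \<le> D * M * t))"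
    using rademacher_dominated[OF ct r q(1), where 'i = nat] by blast
  define m where "m = (\<integral>z. cmod z powr q \<partial>cgauss)"
  have m: "m \<ge> 0" unfolding m_def by (intro integral_nonneg_AE) auto
  have "(\<integral>\<gamma>. (norm (\<Sum>j<n. smul (cnj (\<gamma> j)) (z j)))\<^sup>2 \<partial>gauss_prod n) \<le> (4 * D\<^sup>2 * (1 + m)) * M\<^sup>2"
    if M: "M > 0" and z: "rad_norm {..<n} (\<lambda>\<epsilon>. \<Sum>j<n. \<epsilon> j *\<^sub>R z j) \<le> M" for n and z :: "nat \<Rightarrow> 'a" and M
  proof -
    obtain \<nu> where \<nu>: "\<And>j. j < n \<Longrightarrow> 0 \<le> \<nu> j" "(\<Sum>j<n. \<nu> j) \<le> 1"
      and dom': "\<And>h t. t > 0 \<Longrightarrow> (\<Sum>j<n. \<nu> j * \<bar>h j\<bar> powr q) \<le> t powr q \<Longrightarrow>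
         rad_norm {..<n} (\<lambda>\<epsilon>. \<Sum>j<n. (h j * \<epsilon> j) *\<^sub>R z j) \<le> D * M * t"
      using dom[OF finite_lessThan M z] by auto
    define G where "G \<gamma> = (norm (\<Sum>j<n. smul (cnj (\<gamma> j)) (z j)))\<^sup>2" for \<gamma>
    have Gint: "integrable (gauss_prod n) G" unfolding G_def by (rule gaussian_square_integrable)
    have Gm: "G \<in> borel_measurable (gauss_prod n)" using Gint by (rule borel_measurable_integrable)
    \<comment> \<open>The summand 1 makes \<open>t = W \<gamma> powr (1 / q)\<close> positive, and
      \<open>W \<gamma> \<ge> 1\<close> gives \<open>t^2 \<le> W \<gamma>\<close>. The integral of
      \<open>W\<close> is bounded independently of \<open>n\<close> because \<open>\<nu>\<close> has
      mass at most 1.\<close>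
    define W where "W \<gamma> = 1 + (\<Sum>j<n. \<nu> j * cmod (\<gamma> j) powr q)" for \<gamma> :: "nat \<Rightarrow> complex"
    have W1: "W \<gamma> \<ge> 1" for \<gamma> using \<nu> by (auto simp: W_def intro!: sum_nonneg)
    have pt: "rad_exp {..<n} (\<lambda>\<epsilon>. G (\<lambda>i\<in>{..<n}. of_real (\<epsilon> i) * \<gamma> i)) \<le> 4 * D\<^sup>2 * M\<^sup>2 * W \<gamma>" for \<gamma>
    proof -
      define t where "t = W \<gamma> powr (1 / q)"
      have t: "t > 0" "t powr q = W \<gamma>" using W1[of \<gamma>] q r by (auto simp: t_def powr_powr)
      have part: "rad_norm {..<n} (\<lambda>\<epsilon>. \<Sum>j<n. (h j * \<epsilon> j) *\<^sub>R z j) \<le> D * M * t"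
        if h: "\<And>j. \<bar>h j\<bar> \<le> cmod (\<gamma> j)" for h
      proof (rule dom'[OF t(1)])
        have "(\<Sum>j<n. \<nu> j * \<bar>h j\<bar> powr q) \<le> (\<Sum>j<n. \<nu> j * cmod (\<gamma> j) powr q)"
          using h \<nu> q by (intro sum_mono mult_left_mono powr_mono2) auto
        then show "(\<Sum>j<n. \<nu> j * \<bar>h j\<bar> powr q) \<le> t powr q" unfolding t(2) W_def by simp
      qed
      \<comment> \<open>The domination is for real multipliers, so real and imaginary parts are
        estimated separately; this produces the factor 4 after squaring.\<close>
      have split: "(\<Sum>j<n. smul (cnj (of_real (\<epsilon> j) * \<gamma> j)) (z j)) =
         (\<Sum>j<n. (Re (\<gamma> j) * \<epsilon> j) *\<^sub>R z j) + smul \<i> (\<Sum>j<n. (- Im (\<gamma> j) * \<epsilon> j) *\<^sub>R z j)" for \<epsilon>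
        by (subst smul_Re_Im) (simp add: sum.distrib smul_sum_right mult.commute)
      have Geq: "G (\<lambda>i\<in>{..<n}. of_real (\<epsilon> i) * \<gamma> i) = (norm (\<Sum>j<n. smul (cnj (of_real (\<epsilon> j) * \<gamma> j)) (z j)))\<^sup>2" for \<epsilon>
        unfolding G_def by (intro arg_cong[where f = "\<lambda>x. (norm x)\<^sup>2"] sum.cong) auto
      have "rad_exp {..<n} (\<lambda>\<epsilon>. G (\<lambda>i\<in>{..<n}. of_real (\<epsilon> i) * \<gamma> i)) =
         (rad_norm {..<n} (\<lambda>\<epsilon>. (\<Sum>j<n. (Re (\<gamma> j) * \<epsilon> j) *\<^sub>R z j) + smul \<i> (\<Sum>j<n. (- Im (\<gamma> j) * \<epsilon> j) *\<^sub>R z j)))\<^sup>2"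
        unfolding rad_norm_square split[symmetric] Geq ..
      also have "\<dots> \<le> (D * M * t + D * M * t)\<^sup>2"
      proof (intro power_mono rad_norm_nonneg order_trans[OF rad_norm_triangle] add_mono)
        show "rad_norm {..<n} (\<lambda>\<epsilon>. \<Sum>j<n. (Re (\<gamma> j) * \<epsilon> j) *\<^sub>R z j) \<le> D * M * t"
          by (rule part) (rule abs_Re_le_cmod)
        have "rad_norm {..<n} (\<lambda>\<epsilon>. smul \<i> (\<Sum>j<n. (- Im (\<gamma> j) * \<epsilon> j) *\<^sub>R z j)) = rad_norm {..<n} (\<lambda>\<epsilon>. \<Sum>j<n. (- Im (\<gamma> j) * \<epsilon> j) *\<^sub>R z j)"
          by (simp add: rad_norm_def norm_smul)
        also have "\<dots> \<le> D * M * t" by (rule part) (simp add: abs_Im_le_cmod)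
        finally show "rad_norm {..<n} (\<lambda>\<epsilon>. smul \<i> (\<Sum>j<n. (- Im (\<gamma> j) * \<epsilon> j) *\<^sub>R z j)) \<le> D * M * t" .
      qed
      also have "\<dots> = 4 * D\<^sup>2 * M\<^sup>2 * t\<^sup>2" by (simp add: power2_eq_square algebra_simps)
      also have "\<dots> \<le> 4 * D\<^sup>2 * M\<^sup>2 * W \<gamma>"
      proof (intro mult_left_mono)
        have "t\<^sup>2 = W \<gamma> powr (2 / q)" using t by (simp add: t_def powr_powr flip: powr_numeral)
        also have "\<dots> \<le> W \<gamma> powr 1" using W1[of \<gamma>] q by (intro powr_mono) auto
        finally show "t\<^sup>2 \<le> W \<gamma>" using W1[of \<gamma>] by simp
      qed simp
      finally show ?thesis .
    qed
    have Wint: "integrable (gauss_prod n) W" and Wval: "(\<integral>\<gamma>. W \<gamma> \<partial>gauss_prod n) \<le> 1 + m"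
    proof -
      interpret prob_space "gauss_prod n" by (rule prob_space_gauss_prod)
      have i1: "integrable (gauss_prod n) (\<lambda>\<gamma>. \<nu> j * cmod (\<gamma> j) powr q)" if "j < n" for j
        using that q by (intro integrable_mult_right gauss_prod_moment) auto
      then have i2: "integrable (gauss_prod n) (\<lambda>\<gamma>. \<Sum>j<n. \<nu> j * cmod (\<gamma> j) powr q)"
        by (intro Bochner_Integration.integrable_sum) auto
      then show "integrable (gauss_prod n) W" unfolding W_def by simp
      have "(\<integral>\<gamma>. W \<gamma> \<partial>gauss_prod n) = 1 + (\<Sum>j<n. \<nu> j * m)"
        unfolding W_def using i1 i2 q gauss_prod_moment(2)[of _ n q]
        by (simp add: Bochner_Integration.integral_sum prob_space m_def)
      also have "\<dots> \<le> 1 + 1 * m"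
        unfolding sum_distrib_right[symmetric] using \<nu>(2) m by (intro add_left_mono mult_right_mono) auto
      finally show "(\<integral>\<gamma>. W \<gamma> \<partial>gauss_prod n) \<le> 1 + m" by simp
    qed
    have flip: "(\<integral>\<gamma>. G (\<lambda>i\<in>{..<n}. of_real (\<epsilon> i) * \<gamma> i) \<partial>gauss_prod n) = (\<integral>\<gamma>. G \<gamma> \<partial>gauss_prod n)"
      and flip_int: "integrable (gauss_prod n) (\<lambda>\<gamma>. G (\<lambda>i\<in>{..<n}. of_real (\<epsilon> i) * \<gamma> i))" if "\<epsilon> \<in> signs {..<n}" for \<epsilon>
    proof -
      have s: "\<epsilon> i \<in> {- 1, 1}" if "i < n" for i using \<open>\<epsilon> \<in> signs {..<n}\<close> that by (auto simp: PiE_iff)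
      show "(\<integral>\<gamma>. G (\<lambda>i\<in>{..<n}. of_real (\<epsilon> i) * \<gamma> i) \<partial>gauss_prod n) = (\<integral>\<gamma>. G \<gamma> \<partial>gauss_prod n)"
        by (rule integral_gauss_prod_flip[OF s Gm])
      show "integrable (gauss_prod n) (\<lambda>\<gamma>. G (\<lambda>i\<in>{..<n}. of_real (\<epsilon> i) * \<gamma> i))"
        using integrable_distr_eq[OF gauss_prod_flip(1)[OF s] Gm] gauss_prod_flip(2)[OF s] Gint by simp
    qed
    have "(\<integral>\<gamma>. G \<gamma> \<partial>gauss_prod n) = rad_exp {..<n} (\<lambda>\<epsilon>. \<integral>\<gamma>. G (\<lambda>i\<in>{..<n}. of_real (\<epsilon> i) * \<gamma> i) \<partial>gauss_prod n)"
      using rad_exp_cong[of "{..<n}" "\<lambda>\<epsilon>. \<integral>\<gamma>. G (\<lambda>i\<in>{..<n}. of_real (\<epsilon> i) * \<gamma> i) \<partial>gauss_prod n"] flip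
      by (simp add: rad_exp_const)
    also have "\<dots> = (\<integral>\<gamma>. rad_exp {..<n} (\<lambda>\<epsilon>. G (\<lambda>i\<in>{..<n}. of_real (\<epsilon> i) * \<gamma> i)) \<partial>gauss_prod n)"
      unfolding rad_exp_def using flip_int by (simp add: Bochner_Integration.integral_sum)
    also have "\<dots> \<le> (\<integral>\<gamma>. 4 * D\<^sup>2 * M\<^sup>2 * W \<gamma> \<partial>gauss_prod n)"
    proof (rule integral_mono)
      show "integrable (gauss_prod n) (\<lambda>\<gamma>. rad_exp {..<n} (\<lambda>\<epsilon>. G (\<lambda>i\<in>{..<n}. of_real (\<epsilon> i) * \<gamma> i)))"
        unfolding rad_exp_def by (intro integrable_divide Bochner_Integration.integrable_sum flip_int) auto
    qed (auto intro: pt Wint)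
    also have "\<dots> = 4 * D\<^sup>2 * M\<^sup>2 * (\<integral>\<gamma>. W \<gamma> \<partial>gauss_prod n)" by simp
    also have "\<dots> \<le> 4 * D\<^sup>2 * M\<^sup>2 * (1 + m)" by (intro mult_left_mono Wval) auto
    finally show ?thesis by (simp add: G_def mult_ac)
  qed
  moreover have "4 * D\<^sup>2 * (1 + m) > 0" using D m by simp
  ultimately show ?thesis by blast
qed

end

section \<open>Weak summability and the bidual\<close>

text \<open>Young's inequality for the normalized functions; \<open>e\<close> keeps the normalizing
  constants positive and tends to 0.\<close>

lemma integral_Holder:
  fixes f g :: "'a \<Rightarrow> real"
  assumes pq: "p > 1" "q > 1" "1 / p + 1 / q = 1"
    and nonneg: "\<And>x. 0 \<le> f x" "\<And>x. 0 \<le> g x"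
    and int: "integrable M (\<lambda>x. f x powr p)" "integrable M (\<lambda>x. g x powr q)" "integrable M (\<lambda>x. f x * g x)"
  shows "(\<integral>x. f x * g x \<partial>M) \<le> (\<integral>x. f x powr p \<partial>M) powr (1 / p) * (\<integral>x. g x powr q \<partial>M) powr (1 / q)"
proof -
  let ?A = "\<integral>x. f x powr p \<partial>M" and ?B = "\<integral>x. g x powr q \<partial>M"
  have AB: "?A \<ge> 0" "?B \<ge> 0" by (auto intro!: integral_nonneg_AE)
  have step: "(\<integral>x. f x * g x \<partial>M) \<le> (?A + e) powr (1 / p) * (?B + e) powr (1 / q)" if e: "e > 0" for e
  proof -
    define a b where "a = (?A + e) powr (1 / p)" and "b = (?B + e) powr (1 / q)"
    have ab: "a > 0" "b > 0" "a powr p = ?A + e" "b powr q = ?B + e"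
    proof -
      have "?A + e > 0" "?B + e > 0" using AB e by linarith+
      then show "a > 0" "b > 0" "a powr p = ?A + e" "b powr q = ?B + e"
        using pq by (auto simp: a_def b_def powr_powr)
    qed
    have "f x * g x \<le> (a * b) * (f x powr p / (p * a powr p) + g x powr q / (q * b powr q))" for x
    proof -
      have "(f x / a) * (g x / b) \<le> (f x / a) powr p / p + (g x / b) powr q / q"
        using ab nonneg[of x] by (intro Youngs_inequality pq) auto
      also have "\<dots> = f x powr p / (p * a powr p) + g x powr q / (q * b powr q)"
        using ab nonneg[of x] by (simp add: powr_divide mult.commute)
      finally have "(f x * g x) / (a * b) \<le> f x powr p / (p * a powr p) + g x powr q / (q * b powr q)" by simp
      then show ?thesis using ab by (simp add: divide_le_eq mult.commute)
    qed
    then have "(\<integral>x. f x * g x \<partial>M) \<le> (\<integral>x. (a * b) * (f x powr p / (p * a powr p) + g x powr q / (q * b powr q)) \<partial>M)"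
      by (intro integral_mono int integrable_mult_right Bochner_Integration.integrable_add integrable_divide) auto
    also have "\<dots> = (a * b) * (?A / (p * (?A + e)) + ?B / (q * (?B + e)))"
      using ab by (simp add: Bochner_Integration.integral_add int)
    also have "\<dots> \<le> (a * b) * (1 / p + 1 / q)"
    proof (intro mult_left_mono add_mono)
      have "?A + e > 0" "?B + e > 0" using AB e by linarith+
      then have "?A / (?A + e) \<le> 1" "?B / (?B + e) \<le> 1" using e by (simp_all add: divide_le_eq)
      then have "?A / (?A + e) / p \<le> 1 / p" "?B / (?B + e) / q \<le> 1 / q"
        using pq by (intro divide_right_mono; simp)+
      then show "?A / (p * (?A + e)) \<le> 1 / p" "?B / (q * (?B + e)) \<le> 1 / q"
        by (simp_all only: divide_divide_eq_left mult.commute)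
    qed (use ab in auto)
    finally show ?thesis using pq by (simp add: a_def b_def)
  qed
  show ?thesis
  proof (rule LIMSEQ_le_const)
    have l: "(\<lambda>n. c + inverse (real (Suc n))) \<longlonglongrightarrow> c + 0" for c
      by (intro tendsto_intros LIMSEQ_inverse_real_of_nat)
    show "(\<lambda>n. (?A + inverse (real (Suc n))) powr (1 / p) * (?B + inverse (real (Suc n))) powr (1 / q))
      \<longlonglongrightarrow> ?A powr (1 / p) * ?B powr (1 / q)"
      using l[of ?A] l[of ?B] AB pq by (intro tendsto_mult tendsto_powr' tendsto_const) auto
    show "\<exists>N. \<forall>n\<ge>N. (\<integral>x. f x * g x \<partial>M) \<le>
        (?A + inverse (real (Suc n))) powr (1 / p) * (?B + inverse (real (Suc n))) powr (1 / q)"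
      by (intro exI[of _ 0] allI impI step) auto
  qed
qed

lemma sum_Holder:
  fixes a b :: "'i \<Rightarrow> real"
  assumes "finite I" and pq: "p > 1" "q > 1" "1 / p + 1 / q = 1"
    and nonneg: "\<And>x. 0 \<le> a x" "\<And>x. 0 \<le> b x"
  shows "(\<Sum>i\<in>I. a i * b i) \<le> (\<Sum>i\<in>I. a i powr p) powr (1 / p) * (\<Sum>i\<in>I. b i powr q) powr (1 / q)"
  using integral_Holder[where M = "count_space I", OF pq nonneg] assms(1)
  by (simp add: integrable_count_space lebesgue_integral_count_space_finite)

text \<open>The equality case of Hoelder's inequality: \<open>b i\<close> has the conjugate phase of
  \<open>a i\<close>, since the pairing is bilinear, and a modulus proportional to |a i|^(p -
  1).\<close>

lemma lq_norming_vector: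
  fixes a :: "'i \<Rightarrow> complex"
  assumes I: "finite I" and pq: "p > 1" "q > 1" "1 / p + 1 / q = 1"
  shows "\<exists>b. (\<Sum>i\<in>I. cmod (b i) powr q) \<le> 1 \<and> (\<Sum>i\<in>I. b i * a i) = of_real ((\<Sum>i\<in>I. cmod (a i) powr p) powr (1 / p))"
proof -
  define S where "S = (\<Sum>i\<in>I. cmod (a i) powr p)"
  show ?thesis
  proof (cases "S = 0")
    case True
    then have "cmod (a i) powr p = 0" if "i \<in> I" for i
      using that I unfolding S_def by (subst (asm) sum_nonneg_eq_0_iff) auto
    then show ?thesis using True pq by (intro exI[of _ "\<lambda>_. 0"]) (simp add: S_def[symmetric])
  next
    case False
    then have S: "S > 0" unfolding S_def by (simp add: order_less_le sum_nonneg)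
    define b where "b i = cnj (sgn (a i)) * of_real (cmod (a i) powr (p - 1) / S powr (1 / q))" for i
    have qp: "(p - 1) * q = p" using pq by (simp add: field_simps)
    have "cmod (b i) powr q = cmod (a i) powr p / S" for i
    proof (cases "a i = 0")
      case False
      then have "cmod (b i) = cmod (a i) powr (p - 1) / S powr (1 / q)" by (simp add: b_def norm_mult norm_divide norm_sgn)
      then show ?thesis using S pq qp by (simp add: powr_divide powr_powr)
    qed (simp add: b_def)
    then have "(\<Sum>i\<in>I. cmod (b i) powr q) = 1"
      using S by (simp add: S_def flip: sum_divide_distrib)
    moreover have "b i * a i = of_real (cmod (a i) powr p / S powr (1 / q))" for i
    proof (cases "a i = 0")
      case False
      have "cnj (sgn (a i)) * a i = of_real (cmod (a i))"
      proof -
        have "cnj (sgn (a i)) * a i = (a i * cnj (a i)) / of_real (cmod (a i))"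
          by (simp add: sgn_eq mult.commute)
        also have "\<dots> = of_real (cmod (a i))"
          using False by (simp only: complex_norm_square[symmetric]) (simp add: power2_eq_square)
        finally show ?thesis .
      qed
      then have "b i * a i = of_real (cmod (a i) * (cmod (a i) powr (p - 1) / S powr (1 / q)))"
        by (simp add: b_def mult.commute mult.left_commute)
      also have "cmod (a i) * (cmod (a i) powr (p - 1) / S powr (1 / q)) = cmod (a i) powr p / S powr (1 / q)"
        using False by (simp add: powr_diff)
      finally show ?thesis .
    qed (simp add: b_def)
    then have "(\<Sum>i\<in>I. b i * a i) = of_real (S / S powr (1 / q))"
      by (simp add: S_def flip: sum_divide_distrib)
    moreover have "S / S powr (1 / q) = S powr (1 / p)"
    proof -
      have "S powr (1 / p) * S powr (1 / q) = S" using S pq by (simp flip: powr_add)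
      then show ?thesis using S by (simp add: field_simps)
    qed
    ultimately show ?thesis by (intro exI[of _ b]) (simp add: S_def[symmetric])
  qed
qed

section \<open>Duals and biduals of concretely given spaces\<close>

text \<open>The closure and homogeneity properties behind rescaling to the unit ball. Duals inherit
  them by \<open>normed_cspace_dual\<close>, so each result for \<open>dual\<close> can be applied
  again to the bidual.\<close>

definition normed_cspace :: "'v cspace \<Rightarrow> bool" where
  "normed_cspace S \<longleftrightarrow> carr S \<noteq> {} \<and> (\<forall>x\<in>carr S. \<forall>y\<in>carr S. vadd S x y \<in> carr S) \<and>
    (\<forall>c. \<forall>x\<in>carr S. vsmul S c x \<in> carr S \<and> vnorm S (vsmul S c x) = cmod c * vnorm S x) \<and>
    (\<forall>x\<in>carr S. 0 \<le> vnorm S x)"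

lemma vadd_dual: "vadd (dual S) f g = (\<lambda>x. f x + g x)"
  and vsmul_dual: "vsmul (dual S) c f = (\<lambda>x. c * f x)"
  and vnorm_dual: "vnorm (dual S) f = (SUP x\<in>{x\<in>carr S. vnorm S x \<le> 1}. cmod (f x))"
  by (simp_all add: dual_def)

lemma carr_dualI:
  assumes "\<And>x y. x \<in> carr S \<Longrightarrow> y \<in> carr S \<Longrightarrow> f (vadd S x y) = f x + f y"
    and "\<And>c x. x \<in> carr S \<Longrightarrow> f (vsmul S c x) = c * f x"
    and "\<And>x. x \<in> carr S \<Longrightarrow> cmod (f x) \<le> K * vnorm S x" and "\<And>x. x \<notin> carr S \<Longrightarrow> f x = 0"
  shows "f \<in> carr (dual S)"
  unfolding dual_def using assms by (auto intro!: exI[of _ K])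

lemma carr_dualD:
  assumes "f \<in> carr (dual S)"
  shows "\<And>x y. x \<in> carr S \<Longrightarrow> y \<in> carr S \<Longrightarrow> f (vadd S x y) = f x + f y"
    and "\<And>c x. x \<in> carr S \<Longrightarrow> f (vsmul S c x) = c * f x"
    and "\<exists>K. \<forall>x\<in>carr S. cmod (f x) \<le> K * vnorm S x" and "\<And>x. x \<notin> carr S \<Longrightarrow> f x = 0"
  using assms by (auto simp: dual_def)

lemma dual_bound:
  assumes S: "normed_cspace S" and f: "f \<in> carr (dual S)" and x: "x \<in> carr S"
  shows "cmod (f x) \<le> vnorm (dual S) f * vnorm S x"
proof -
  obtain K where K: "\<And>x. x \<in> carr S \<Longrightarrow> cmod (f x) \<le> K * vnorm S x"
    using carr_dualD(3)[OF f] by blast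
  have x0: "vnorm S x \<ge> 0" using S x by (auto simp: normed_cspace_def)
  show ?thesis
  proof (cases "vnorm S x = 0")
    case True
    then show ?thesis using K[OF x] by simp
  next
    case False
    have bdd: "bdd_above ((\<lambda>x. cmod (f x)) ` {x \<in> carr S. vnorm S x \<le> 1})"
    proof (rule bdd_aboveI2)
      fix y assume y: "y \<in> {x \<in> carr S. vnorm S x \<le> 1}"
      have "K * vnorm S y \<le> \<bar>K\<bar> * 1" using y S by (intro mult_mono) (auto simp: normed_cspace_def)
      then show "cmod (f y) \<le> \<bar>K\<bar>" using K[of y] y by simp
    qed
    define c where "c = complex_of_real (1 / vnorm S x)"
    have y: "vsmul S c x \<in> carr S" "vnorm S (vsmul S c x) = 1"
      using S x False x0 by (auto simp: normed_cspace_def c_def norm_divide)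
    have "f (vsmul S c x) = c * f x" by (rule carr_dualD(2)[OF f x])
    moreover have "cmod (f (vsmul S c x)) \<le> vnorm (dual S) f"
      unfolding vnorm_dual by (rule cSUP_upper[OF _ bdd]) (use y in simp)
    ultimately have "cmod c * cmod (f x) \<le> vnorm (dual S) f" by (simp add: norm_mult)
    moreover have "cmod c = 1 / vnorm S x" using x0 by (simp add: c_def norm_divide)
    ultimately show ?thesis using False x0 by (simp add: field_simps)
  qed
qed

lemma dual_norm_le:
  assumes S: "normed_cspace S" and le: "\<And>x. x \<in> carr S \<Longrightarrow> vnorm S x \<le> 1 \<Longrightarrow> cmod (f x) \<le> B"
  shows "vnorm (dual S) f \<le> B"
proof -
  obtain x where "x \<in> carr S" using S by (auto simp: normed_cspace_def)
  then have "vsmul S 0 x \<in> {x \<in> carr S. vnorm S x \<le> 1}" using S by (auto simp: normed_cspace_def)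
  then have "{x \<in> carr S. vnorm S x \<le> 1} \<noteq> {}" by blast
  then show ?thesis unfolding vnorm_dual by (intro cSUP_least) (auto intro: le)
qed

text \<open>A negative supremum would, by \<open>dual_bound\<close>, force \<open>f\<close> to
  vanish on the carrier, and then the supremum would be 0.\<close>

lemma dual_norm_nonneg:
  assumes S: "normed_cspace S" and f: "f \<in> carr (dual S)"
  shows "0 \<le> vnorm (dual S) f"
proof (rule ccontr)
  assume neg: "\<not> 0 \<le> vnorm (dual S) f"
  obtain x where x: "x \<in> carr S" using S by (auto simp: normed_cspace_def)
  have z: "f y = 0" if "y \<in> carr S" for y
  proof -
    have "vnorm (dual S) f * vnorm S y \<le> 0"
      using neg S that by (intro mult_nonpos_nonneg) (auto simp: normed_cspace_def)
    then have "cmod (f y) \<le> 0" using dual_bound[OF S f that] by linarith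
    then show ?thesis by simp
  qed
  have ne: "{x \<in> carr S. vnorm S x \<le> 1} \<noteq> {}"
    using S x by (auto simp: normed_cspace_def intro!: exI[of _ "vsmul S 0 x"])
  have "vnorm (dual S) f = (SUP x\<in>{x \<in> carr S. vnorm S x \<le> 1}. 0)"
    unfolding vnorm_dual by (intro SUP_cong refl) (simp add: z)
  also have "\<dots> = 0" using ne by (rule cSUP_const)
  finally have "vnorm (dual S) f = 0" .
  with neg show False by simp
qed

lemma normed_cspace_dual:
  assumes S: "normed_cspace S"
  shows "normed_cspace (dual S)"
  unfolding normed_cspace_def
proof (intro conjI ballI allI)
  show "carr (dual S) \<noteq> {}"
    using carr_dualI[of S "\<lambda>_. 0" 0] by auto
  fix f assume f: "f \<in> carr (dual S)"
  show "0 \<le> vnorm (dual S) f" by (rule dual_norm_nonneg[OF S f])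
  show "vadd (dual S) f g \<in> carr (dual S)" if g: "g \<in> carr (dual S)" for g
  proof -
    have "cmod (f x + g x) \<le> (vnorm (dual S) f + vnorm (dual S) g) * vnorm S x" if "x \<in> carr S" for x
      using norm_triangle_ineq[of "f x" "g x"] dual_bound[OF S f that] dual_bound[OF S g that]
      by (simp add: algebra_simps)
    then show ?thesis
      unfolding vadd_dual
      by (intro carr_dualI[where K = "vnorm (dual S) f + vnorm (dual S) g"])
         (simp_all add: carr_dualD[OF f] carr_dualD[OF g] algebra_simps)
  qed
  have smul: "vsmul (dual S) c f \<in> carr (dual S)" if f: "f \<in> carr (dual S)" for c f
  proof -
    have "cmod (c * f x) \<le> (cmod c * vnorm (dual S) f) * vnorm S x" if "x \<in> carr S" for x
      using mult_left_mono[OF dual_bound[OF S f that], of "cmod c"] by (simp add: norm_mult mult.assoc)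
    then show ?thesis
      unfolding vsmul_dual
      by (intro carr_dualI[where K = "cmod c * vnorm (dual S) f"])
         (simp_all add: carr_dualD[OF f] algebra_simps)
  qed
  show "vsmul (dual S) c f \<in> carr (dual S)" for c by (rule smul[OF f])
  have le: "vnorm (dual S) (vsmul (dual S) c f) \<le> cmod c * vnorm (dual S) f" if f: "f \<in> carr (dual S)" for c f
  proof (rule dual_norm_le[OF S])
    fix x assume x: "x \<in> carr S" "vnorm S x \<le> 1"
    have "cmod (f x) \<le> vnorm (dual S) f * 1"
      using dual_bound[OF S f x(1)] mult_left_mono[OF x(2) dual_norm_nonneg[OF S f]] by linarith
    then show "cmod (vsmul (dual S) c f x) \<le> cmod c * vnorm (dual S) f"
      by (simp add: vsmul_dual norm_mult mult_left_mono)
  qed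
  show "vnorm (dual S) (vsmul (dual S) c f) = cmod c * vnorm (dual S) f" for c
  proof (rule antisym[OF le[OF f]])
    show "cmod c * vnorm (dual S) f \<le> vnorm (dual S) (vsmul (dual S) c f)"
    proof (cases "c = 0")
      case True
      then show ?thesis using dual_norm_nonneg[OF S smul[OF f]] by simp
    next
      case False
      have "f = vsmul (dual S) (inverse c) (vsmul (dual S) c f)" by (rule ext) (use False in \<open>simp add: vsmul_dual\<close>)
      then have "vnorm (dual S) f \<le> cmod (inverse c) * vnorm (dual S) (vsmul (dual S) c f)"
        using le[OF smul[OF f], of "inverse c" c] by simp
      then show ?thesis using False by (simp add: norm_inverse norm_divide field_simps)
    qed
  qed
qed

text \<open>Membership and the value of \<open>z\<close> are proved in one induction, because
  additivity of \<open>z\<close> is available only for arguments already known to lie in the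
  carrier.\<close>

lemma dual_lincomb:
  assumes S: "normed_cspace S" and fin: "finite I" and f: "\<And>i. i \<in> I \<Longrightarrow> f i \<in> carr (dual S)"
  shows "(\<lambda>x. \<Sum>i\<in>I. c i * f i x) \<in> carr (dual S)"
    and "z \<in> carr (dual (dual S)) \<Longrightarrow> z (\<lambda>x. \<Sum>i\<in>I. c i * f i x) = (\<Sum>i\<in>I. c i * z (f i))"
proof -
  have D: "normed_cspace (dual S)" by (rule normed_cspace_dual[OF S])
  have zero: "(\<lambda>x. 0) \<in> carr (dual S)" by (rule carr_dualI[where K = 0]) auto
  have "(\<lambda>x. \<Sum>i\<in>I. c i * f i x) \<in> carr (dual S) \<and>
     (z \<in> carr (dual (dual S)) \<longrightarrow> z (\<lambda>x. \<Sum>i\<in>I. c i * f i x) = (\<Sum>i\<in>I. c i * z (f i)))"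
    using fin f
  proof (induction I rule: finite_induct)
    case empty
    have "z (\<lambda>x. 0) = 0" if "z \<in> carr (dual (dual S))"
    proof -
      have "z (vsmul (dual S) 0 (\<lambda>x. 0)) = 0 * z (\<lambda>x. 0)" by (rule carr_dualD(2)[OF that zero])
      then show ?thesis by (simp add: vsmul_dual)
    qed
    then show ?case using zero by simp
  next
    case (insert i I)
    let ?g = "\<lambda>x. \<Sum>i\<in>I. c i * f i x"
    have fi: "f i \<in> carr (dual S)" and g: "?g \<in> carr (dual S)"
      and zg: "z \<in> carr (dual (dual S)) \<Longrightarrow> z ?g = (\<Sum>i\<in>I. c i * z (f i))"
      using insert by auto
    have cf: "vsmul (dual S) (c i) (f i) \<in> carr (dual S)" using D fi by (auto simp: normed_cspace_def)
    have eq: "(\<lambda>x. \<Sum>i\<in>insert i I. c i * f i x) = vadd (dual S) (vsmul (dual S) (c i) (f i)) ?g"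
      using insert.hyps by (simp add: vadd_dual vsmul_dual)
    have "vadd (dual S) (vsmul (dual S) (c i) (f i)) ?g \<in> carr (dual S)"
      using D cf g by (auto simp: normed_cspace_def)
    moreover have "z (vadd (dual S) (vsmul (dual S) (c i) (f i)) ?g) = c i * z (f i) + z ?g" if z: "z \<in> carr (dual (dual S))"
      using carr_dualD(1)[OF z cf g] carr_dualD(2)[OF z fi] by simp
    ultimately show ?case unfolding eq using zg insert.hyps by simp
  qed
  then show "(\<lambda>x. \<Sum>i\<in>I. c i * f i x) \<in> carr (dual S)"
    and "z \<in> carr (dual (dual S)) \<Longrightarrow> z (\<lambda>x. \<Sum>i\<in>I. c i * f i x) = (\<Sum>i\<in>I. c i * z (f i))" by auto
qed

lemma weak_l1_bdd:
  assumes Y: "normed_cspace Y" and z: "\<And>j. j < k \<Longrightarrow> z j \<in> carr (dual Y)"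
  shows "bdd_above ((\<lambda>\<phi>. \<Sum>j<k. cmod (\<phi> (z j))) ` {\<phi> \<in> carr (dual (dual Y)). vnorm (dual (dual Y)) \<phi> \<le> 1})"
proof (rule bdd_aboveI2)
  fix \<phi> assume \<phi>: "\<phi> \<in> {\<phi> \<in> carr (dual (dual Y)). vnorm (dual (dual Y)) \<phi> \<le> 1}"
  show "(\<Sum>j<k. cmod (\<phi> (z j))) \<le> (\<Sum>j<k. vnorm (dual Y) (z j))"
  proof (rule sum_mono)
    fix j assume "j \<in> {..<k}"
    then have zj: "z j \<in> carr (dual Y)" using z by simp
    have "cmod (\<phi> (z j)) \<le> vnorm (dual (dual Y)) \<phi> * vnorm (dual Y) (z j)"
      using \<phi> zj by (intro dual_bound[OF normed_cspace_dual[OF Y]]) auto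
    also have "\<dots> \<le> 1 * vnorm (dual Y) (z j)"
      using \<phi> dual_norm_nonneg[OF Y zj] by (intro mult_right_mono) auto
    finally show "cmod (\<phi> (z j)) \<le> vnorm (dual Y) (z j)" by simp
  qed
qed

text \<open>Evaluations at points of \<open>Y\<close> belong to the unit ball of the dual of \<open>dual Y\<close>.\<close>

lemma weak_l1_bound:
  assumes Y: "normed_cspace Y" and z: "\<And>j. j < k \<Longrightarrow> z j \<in> carr (dual Y)" and y: "y \<in> carr Y"
  shows "(\<Sum>j<k. cmod (z j y)) \<le> weak_l1 (dual Y) z k * vnorm Y y"
proof -
  note D = normed_cspace_dual[OF Y]
  note bdd = weak_l1_bdd[of Y k z, OF Y z]
  have unit: "(\<Sum>j<k. cmod (z j y)) \<le> weak_l1 (dual Y) z k" if y: "y \<in> carr Y" "vnorm Y y \<le> 1" for y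
  proof -
    define \<phi> where "\<phi> = (\<lambda>g. if g \<in> carr (dual Y) then g y else (0::complex))"
    have bd: "cmod (\<phi> g) \<le> 1 * vnorm (dual Y) g" if "g \<in> carr (dual Y)" for g
    proof -
      have "cmod (g y) \<le> vnorm (dual Y) g * vnorm Y y" by (rule dual_bound[OF Y that y(1)])
      also have "\<dots> \<le> vnorm (dual Y) g * 1" by (intro mult_left_mono y dual_norm_nonneg[OF Y that])
      finally show ?thesis using that by (simp add: \<phi>_def)
    qed
    have cl: "\<And>g h. g \<in> carr (dual Y) \<Longrightarrow> h \<in> carr (dual Y) \<Longrightarrow> vadd (dual Y) g h \<in> carr (dual Y)"
      "\<And>c g. g \<in> carr (dual Y) \<Longrightarrow> vsmul (dual Y) c g \<in> carr (dual Y)"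
      using D by (auto simp: normed_cspace_def)
    have "\<phi> \<in> carr (dual (dual Y))"
    proof (rule carr_dualI[OF _ _ bd])
      show "\<phi> (vadd (dual Y) g h) = \<phi> g + \<phi> h" if "g \<in> carr (dual Y)" "h \<in> carr (dual Y)" for g h
        using cl(1)[OF that] that by (simp add: \<phi>_def) (simp add: vadd_dual)
      show "\<phi> (vsmul (dual Y) c g) = c * \<phi> g" if "g \<in> carr (dual Y)" for c g
        using cl(2)[OF that] that by (simp add: \<phi>_def) (simp add: vsmul_dual)
    qed (auto simp: \<phi>_def)
    moreover have "vnorm (dual (dual Y)) \<phi> \<le> 1"
    proof (rule dual_norm_le[OF D])
      show "cmod (\<phi> g) \<le> 1" if "g \<in> carr (dual Y)" "vnorm (dual Y) g \<le> 1" for g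
        using bd[OF that(1)] that(2) by simp
    qed
    ultimately have "(\<Sum>j<k. cmod (\<phi> (z j))) \<le> weak_l1 (dual Y) z k"
      unfolding weak_l1_def by (intro cSUP_upper[OF _ bdd]) simp
    then show ?thesis using z by (simp add: \<phi>_def)
  qed
  show ?thesis
  proof (cases "vnorm Y y = 0")
    case True
    have "cmod (z j y) \<le> 0" if "j < k" for j using dual_bound[OF Y z[OF that] y] True by simp
    then show ?thesis using True by simp
  next
    case False
    then have pos: "vnorm Y y > 0" using Y y by (auto simp: normed_cspace_def order_less_le)
    define c where "c = complex_of_real (1 / vnorm Y y)"
    have y': "vsmul Y c y \<in> carr Y" "vnorm Y (vsmul Y c y) = 1"
      using Y y pos by (auto simp: normed_cspace_def c_def norm_divide)
    have "z j (vsmul Y c y) = c * z j y" if "j < k" for j by (rule carr_dualD(2)[OF z[OF that] y])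
    then have "(\<Sum>j<k. cmod (z j (vsmul Y c y))) = (\<Sum>j<k. cmod (z j y)) / vnorm Y y"
      using pos by (simp add: c_def norm_mult norm_divide sum_divide_distrib)
    then show ?thesis using unit[of "vsmul Y c y"] y' pos by (simp add: divide_le_eq)
  qed
qed

lemma weak_l1_nonneg:
  assumes Y: "normed_cspace Y" and z: "\<And>j. j < k \<Longrightarrow> z j \<in> carr (dual Y)"
  shows "0 \<le> weak_l1 (dual Y) z k"
proof -
  have \<phi>: "(\<lambda>_. 0) \<in> {\<phi> \<in> carr (dual (dual Y)). vnorm (dual (dual Y)) \<phi> \<le> 1}"
    using dual_norm_le[OF normed_cspace_dual[OF Y], of "\<lambda>_. 0" 1] by (auto intro!: carr_dualI[where K = 0])
  from cSUP_upper[OF \<phi> weak_l1_bdd[of Y k z, OF Y z]] show ?thesis by (simp add: weak_l1_def)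
qed

section \<open>Complex functionals on X\<close>

context complex_structured
begin

abbreviation X' :: "('a \<Rightarrow> complex) cspace" where "X' \<equiv> dual (space_of smul)"

lemma normed_cspace_space_of: "normed_cspace (space_of smul)"
  by (simp add: normed_cspace_def space_of_def norm_smul)

lemma normed_cspace_X': "normed_cspace X'"
  by (rule normed_cspace_dual[OF normed_cspace_space_of])

lemma X'_add: "f \<in> carr X' \<Longrightarrow> f (x + y) = f x + f y"
  and X'_smul: "f \<in> carr X' \<Longrightarrow> f (smul c x) = c * f x"
  using carr_dualD(1,2)[of f "space_of smul"] by (auto simp: space_of_def)

lemma X'_bound: "f \<in> carr X' \<Longrightarrow> cmod (f x) \<le> vnorm X' f * norm x"
  using dual_bound[OF normed_cspace_space_of, of f x] by (simp add: space_of_def)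

lemma X'_I:
  assumes "\<And>x y. f (x + y) = f x + f y" "\<And>c x. f (smul c x) = c * f x" "\<And>x. cmod (f x) \<le> K * norm x"
  shows "f \<in> carr X'"
  by (rule carr_dualI[where K = K]) (auto simp: space_of_def assms)

lemma X'_norm_le: "(\<And>x. norm x \<le> 1 \<Longrightarrow> cmod (f x) \<le> B) \<Longrightarrow> vnorm X' f \<le> B"
  using dual_norm_le[OF normed_cspace_space_of, of f B] by (simp add: space_of_def)

lemma X'_norm_approx:
  assumes "f \<in> carr X'" "e > 0"
  shows "\<exists>x. norm x \<le> 1 \<and> vnorm X' f - e < cmod (f x)"
proof (rule ccontr)
  assume "\<not> ?thesis"
  then have "vnorm X' f \<le> vnorm X' f - e" by (intro X'_norm_le) (auto simp: not_less)
  with assms show False by simp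
qed

lemma X'_zero: "f \<in> carr X' \<Longrightarrow> f 0 = 0"
  using X'_add[of f 0 0] by simp

lemma X'_sum: "f \<in> carr X' \<Longrightarrow> f (\<Sum>i\<in>I. x i) = (\<Sum>i\<in>I. f (x i))"
  by (induction I rule: infinite_finite_induct) (auto simp: X'_zero X'_add)

lemma X'_scaleR: "f \<in> carr X' \<Longrightarrow> f (r *\<^sub>R x) = of_real r * f x"
  using X'_smul[of f "of_real r" x] by (simp add: smul_of_real)

lemma smul_ii: "smul \<i> (smul \<i> x) = - x"
  using smul_mult[of \<i> \<i> x] smul_of_real[of "- 1" x] by simp

text \<open>Multiplying \<open>x\<close> by a unimodular scalar makes \<open>\<psi> x\<close> real
  and nonnegative, so the bound on the real part \<open>\<xi>\<close> becomes a bound on the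
  modulus.\<close>

lemma complexify_functional:
  assumes lin: "linear \<xi>" and bd: "\<And>x. \<xi> x \<le> B * norm x"
  defines "\<psi> \<equiv> \<lambda>x. complex_of_real (\<xi> x) - \<i> * of_real (\<xi> (smul \<i> x))"
  shows "\<psi> \<in> carr X'" and "\<And>x. Re (\<psi> x) = \<xi> x"
proof -
  show Re: "Re (\<psi> x) = \<xi> x" for x by (simp add: \<psi>_def)
  have add: "\<psi> (x + y) = \<psi> x + \<psi> y" for x y
    by (simp add: \<psi>_def linear_add[OF lin] smul_add_right algebra_simps)
  have smul: "\<psi> (smul c x) = c * \<psi> x" for c x
  proof -
    have eq1: "smul \<i> (smul c x) = Re c *\<^sub>R smul \<i> x - Im c *\<^sub>R x"
      by (simp add: smul_Re_Im[of c x] smul_add_right smul_scaleR smul_ii)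
    have eq2: "smul c x = Re c *\<^sub>R x + Im c *\<^sub>R smul \<i> x"
      by (simp add: smul_Re_Im[of c x] smul_scaleR)
    show ?thesis
      unfolding \<psi>_def eq1 unfolding eq2
      by (simp add: linear_add[OF lin] linear_diff[OF lin] linear_scale[OF lin] complex_eq_iff algebra_simps)
  qed
  have "cmod (\<psi> x) \<le> B * norm x" for x
  proof (cases "\<psi> x = 0")
    case True
    have "0 \<le> B * norm x" using bd[of x] bd[of "- x"] by (simp add: linear_neg[OF lin])
    then show ?thesis using True by simp
  next
    case False
    define c where "c = cnj (sgn (\<psi> x))"
    have "c * \<psi> x = of_real (cmod (\<psi> x))"
    proof -
      have "c * \<psi> x = (\<psi> x * cnj (\<psi> x)) / of_real (cmod (\<psi> x))"
        by (simp add: c_def sgn_eq mult.commute)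
      also have "\<dots> = of_real (cmod (\<psi> x))"
        using False by (simp only: complex_norm_square[symmetric]) (simp add: power2_eq_square)
      finally show ?thesis .
    qed
    then have "cmod (\<psi> x) = Re (\<psi> (smul c x))" by (simp add: smul)
    also have "\<dots> \<le> B * norm (smul c x)" unfolding Re by (rule bd)
    also have "norm (smul c x) = norm x" using False by (simp add: norm_smul c_def norm_sgn)
    finally show ?thesis .
  qed
  then show "\<psi> \<in> carr X'" by (intro X'_I add smul)
qed

text \<open>The real part of \<open>\<psi> v\<close> already equals \<open>norm v\<close>, which
  bounds the modulus; hence the imaginary part is 0.\<close>

lemma exists_norming_functional: "\<exists>f\<in>carr X'. vnorm X' f \<le> 1 \<and> f v = of_real (norm v)"
proof -
  have "sublinear (norm :: 'a \<Rightarrow> real)" by (simp add: sublinear_def norm_triangle_ineq)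
  then obtain \<xi> where \<xi>: "linear \<xi>" "\<And>w. \<xi> w \<le> norm w" "\<xi> v = norm v"
    using norming_functional[of norm v] by blast
  define \<psi> where "\<psi> x = complex_of_real (\<xi> x) - \<i> * of_real (\<xi> (smul \<i> x))" for x
  have \<psi>: "\<psi> \<in> carr X'" "\<And>x. Re (\<psi> x) = \<xi> x"
    using complexify_functional[OF \<xi>(1), of 1] \<xi>(2) by (auto simp: \<psi>_def[abs_def])
  have bd: "cmod (\<psi> x) \<le> norm x" for x
  proof (cases "\<psi> x = 0")
    case False
    define c where "c = cnj (sgn (\<psi> x))"
    have "c * \<psi> x = (\<psi> x * cnj (\<psi> x)) / of_real (cmod (\<psi> x))" by (simp add: c_def sgn_eq mult.commute)
    also have "\<dots> = of_real (cmod (\<psi> x))"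
      using False by (simp only: complex_norm_square[symmetric]) (simp add: power2_eq_square)
    finally have "cmod (\<psi> x) = Re (\<psi> (smul c x))" by (simp add: X'_smul[OF \<psi>(1)])
    also have "\<dots> \<le> norm (smul c x)" unfolding \<psi>(2) by (rule \<xi>(2))
    also have "\<dots> = norm x" using False by (simp add: norm_smul c_def norm_sgn)
    finally show ?thesis .
  qed simp
  have "Re (\<psi> v) = norm v" by (simp add: \<psi>(2) \<xi>(3))
  moreover have "(Re (\<psi> v))\<^sup>2 + (Im (\<psi> v))\<^sup>2 \<le> (norm v)\<^sup>2"
    using power_mono[OF bd[of v], of 2] by (simp add: cmod_power2)
  ultimately have "\<psi> v = of_real (norm v)" by (simp add: complex_eq_iff)
  moreover have "vnorm X' \<psi> \<le> 1" by (rule X'_norm_le) (use bd order_trans in blast)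
  ultimately show ?thesis using \<psi>(1) by blast
qed

text \<open>Says that \<open>x\<close> represents an operator of norm at most 1 from the real
  l_infinity space of dimension \<open>k\<close>. Equivalently, the sum of the |Re (f (x j))| is at
  most 1 for every \<open>f\<close> in the dual unit ball.\<close>

definition weakly_bounded :: "nat \<Rightarrow> (nat \<Rightarrow> 'a) \<Rightarrow> bool" where
  "weakly_bounded k x \<longleftrightarrow> (\<forall>s\<in>signs {..<k}. norm (\<Sum>j<k. s j *\<^sub>R x j) \<le> 1)"

text \<open>Maurey's factorization of \<open>x\<close> bounds the i-th combination by
  \<open>2 * D * S i powr (1 / q)\<close>, the 2 coming from real and imaginary parts. Exchanging
  the sums over \<open>i\<close> and \<open>j\<close> shows that the \<open>S i\<close> add up to at
  most 1, and Hoelder's inequality in \<open>i\<close> finishes the estimate.\<close>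

lemma cotype_weak_pairing:
  assumes ct: "has_cotype r TYPE('a)" and r: "r \<ge> 2" and q: "q > r" and p: "p > 1" "1 / p + 1 / q = 1"
  shows "\<exists>D>0. \<forall>k N x b f. weakly_bounded k x \<longrightarrow> (\<forall>j<k. (\<Sum>i<N. cmod (b i j) powr q) \<le> 1) \<longrightarrow>
     (\<forall>i<N. f i \<in> carr X') \<longrightarrow>
     (\<Sum>i<(N::nat). cmod (f i (\<Sum>j<k. smul (b i j) (x j)))) \<le> D * (\<Sum>i<N. vnorm X' (f i) powr p) powr (1 / p)"
proof -
  obtain D where D: "D > 0" and dom: "\<And>(J::nat set) (x :: nat \<Rightarrow> 'a). finite J \<Longrightarrow>
     (\<forall>s\<in>signs J. norm (\<Sum>j\<in>J. s j *\<^sub>R x j) \<le> 1) \<Longrightarrow>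
    (\<exists>\<nu>. (\<forall>j\<in>J. 0 \<le> \<nu> j) \<and> (\<Sum>j\<in>J. \<nu> j) \<le> 1 \<and>
      (\<forall>h t. t > 0 \<longrightarrow> (\<Sum>j\<in>J. \<nu> j * \<bar>h j\<bar> powr q) \<le> t powr q \<longrightarrow> norm (\<Sum>j\<in>J. h j *\<^sub>R x j) \<le> D * t))"
    using cotype_dominated[OF ct r q, where 'i = nat] by blast
  have q1: "q > 1" using r q by simp
  have "(\<Sum>i<N. cmod (f i (\<Sum>j<k. smul (b i j) (x j)))) \<le> 2 * D * (\<Sum>i<N. vnorm X' (f i) powr p) powr (1 / p)"
    if x: "weakly_bounded k x" and b: "\<forall>j<k. (\<Sum>i<N. cmod (b i j) powr q) \<le> 1" and f: "\<forall>i<N. f i \<in> carr X'"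
    for k N :: nat and x b f
  proof -
    obtain \<nu> where \<nu>: "\<And>j. j < k \<Longrightarrow> 0 \<le> \<nu> j" "(\<Sum>j<k. \<nu> j) \<le> 1"
      and dom': "\<And>h t. t > 0 \<Longrightarrow> (\<Sum>j<k. \<nu> j * \<bar>h j\<bar> powr q) \<le> t powr q \<Longrightarrow> norm (\<Sum>j<k. h j *\<^sub>R x j) \<le> D * t"
      using dom[of "{..<k}" x] x unfolding weakly_bounded_def by auto
    define S where "S i = (\<Sum>j<k. \<nu> j * cmod (b i j) powr q)" for i
    have S0: "S i \<ge> 0" for i unfolding S_def using \<nu> by (intro sum_nonneg) auto
    have part: "norm (\<Sum>j<k. h j *\<^sub>R x j) \<le> D * t" if h: "\<And>j. \<bar>h j\<bar> \<le> cmod (b i j)" and t: "t > 0" "S i \<le> t powr q" for i h t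
    proof (rule dom'[OF t(1)])
      have "(\<Sum>j<k. \<nu> j * \<bar>h j\<bar> powr q) \<le> S i"
        unfolding S_def using h \<nu> q1 by (intro sum_mono mult_left_mono powr_mono2) auto
      then show "(\<Sum>j<k. \<nu> j * \<bar>h j\<bar> powr q) \<le> t powr q" using t(2) by simp
    qed
    have bt: "norm (\<Sum>j<k. smul (b i j) (x j)) \<le> 2 * D * t" if t: "t > 0" "S i \<le> t powr q" for i t
    proof -
      have "(\<Sum>j<k. smul (b i j) (x j)) = (\<Sum>j<k. Re (b i j) *\<^sub>R x j) + smul \<i> (\<Sum>j<k. Im (b i j) *\<^sub>R x j)"
        by (subst smul_Re_Im) (simp add: sum.distrib smul_sum_right)
      also have "norm \<dots> \<le> norm (\<Sum>j<k. Re (b i j) *\<^sub>R x j) + norm (smul \<i> (\<Sum>j<k. Im (b i j) *\<^sub>R x j))"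
        by (rule norm_triangle_ineq)
      also have "\<dots> \<le> D * t + D * t"
        unfolding norm_smul using part[OF abs_Re_le_cmod t] part[OF abs_Im_le_cmod t] by simp
      finally show ?thesis by simp
    qed
    have bS: "norm (\<Sum>j<k. smul (b i j) (x j)) \<le> 2 * D * S i powr (1 / q)" for i
    proof (cases "S i = 0")
      case True
      \<comment> \<open>The domination is stated for \<open>t > 0\<close>; when
        \<open>S i = 0\<close>, every such \<open>t\<close> is admissible.\<close>
      have "norm (\<Sum>j<k. smul (b i j) (x j)) \<le> 0 + e" if "e > 0" for e
        using bt[of "e / (2 * D)" i] D that True by simp
      then have "norm (\<Sum>j<k. smul (b i j) (x j)) \<le> 0" by (rule field_le_epsilon)
      then show ?thesis using True by simp
    next
      case False
      then show ?thesis using S0[of i] q1 by (intro bt) (auto simp: powr_powr)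
    qed
    have "(\<Sum>i<N. cmod (f i (\<Sum>j<k. smul (b i j) (x j)))) \<le> (\<Sum>i<N. vnorm X' (f i) * (2 * D * S i powr (1 / q)))"
    proof (rule sum_mono)
      fix i assume "i \<in> {..<N}"
      then have fi: "f i \<in> carr X'" using f by simp
      show "cmod (f i (\<Sum>j<k. smul (b i j) (x j))) \<le> vnorm X' (f i) * (2 * D * S i powr (1 / q))"
        by (rule order_trans[OF X'_bound[OF fi]])
           (intro mult_left_mono bS dual_norm_nonneg[OF normed_cspace_space_of fi])
    qed
    also have "\<dots> = 2 * D * (\<Sum>i<N. \<bar>vnorm X' (f i)\<bar> * S i powr (1 / q))"
      unfolding sum_distrib_left using f dual_norm_nonneg[OF normed_cspace_space_of]
      by (intro sum.cong refl) simp
    also have "\<dots> \<le> 2 * D * ((\<Sum>i<N. \<bar>vnorm X' (f i)\<bar> powr p) powr (1 / p) * (\<Sum>i<N. (S i powr (1 / q)) powr q) powr (1 / q))"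
      using D p q1 by (intro mult_left_mono sum_Holder) auto
    also have "\<dots> \<le> 2 * D * ((\<Sum>i<N. \<bar>vnorm X' (f i)\<bar> powr p) powr (1 / p) * 1)"
    proof (intro mult_left_mono)
      have "(\<Sum>i<N. (S i powr (1 / q)) powr q) = (\<Sum>i<N. S i)"
        using S0 q1 by (simp add: powr_powr)
      also have "\<dots> = (\<Sum>j<k. \<nu> j * (\<Sum>i<N. cmod (b i j) powr q))"
        unfolding S_def by (subst sum.swap) (simp add: sum_distrib_left)
      also have "\<dots> \<le> (\<Sum>j<k. \<nu> j * 1)" using b \<nu> by (intro sum_mono mult_left_mono) auto
      finally have "(\<Sum>i<N. (S i powr (1 / q)) powr q) \<le> 1" using \<nu>(2) by simp
      then show "(\<Sum>i<N. (S i powr (1 / q)) powr q) powr (1 / q) \<le> 1"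
        using q1 powr_mono2[of "1 / q" "\<Sum>i<N. (S i powr (1 / q)) powr q" 1] by (simp add: sum_nonneg)
    qed (use D in auto)
    also have "(\<Sum>i<N. \<bar>vnorm X' (f i)\<bar> powr p) = (\<Sum>i<N. vnorm X' (f i) powr p)"
      using f dual_norm_nonneg[OF normed_cspace_space_of] by (intro sum.cong refl) simp
    finally show ?thesis by simp
  qed
  with D show ?thesis by (intro exI[of _ "2 * D"]) simp
qed

text \<open>A functional on \<open>k\<close>-tuples that is bounded on weakly bounded tuples of \<open>X\<close> extends, by Hahn-Banach on
  the \<open>\<ell>\<^sub>\<infinity>\<close>-sum indexed by signs, to weakly bounded tuples of the bidual. This replaces local reflexivity.\<close>

lemma weak_functional_bidual:
  assumes \<eta>: "\<And>j. j < k \<Longrightarrow> \<eta> j \<in> carr X'" and B: "B \<ge> 0"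
    and bound: "\<And>x. weakly_bounded k x \<Longrightarrow> Re (\<Sum>j<k. \<eta> j (x j)) \<le> B"
    and z: "\<And>j. j < k \<Longrightarrow> z j \<in> carr (dual X')"
  shows "cmod (\<Sum>j<k. z j (\<eta> j)) \<le> B * weak_l1 (dual X') z k"
proof -
  define Sg where "Sg = signs {..<k}"
  have Sg: "finite Sg" "Sg \<noteq> {}" by (auto simp: Sg_def finite_signs PiE_eq_empty_iff)
  \<comment> \<open>\<open>A\<close> maps tuples into the l_infinity-sum of copies of X indexed by
    signs, and \<open>p\<close> is \<open>B\<close> times the norm of that sum. A tuple
    \<open>x\<close> is weakly bounded exactly when \<open>A x\<close> has norm at most 1.\<close>
  define p where "p v = B * Max ((\<lambda>s. norm (v s)) ` Sg)" for v :: "(nat \<Rightarrow> real) \<Rightarrow> 'a"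
  define A where "A x = (\<lambda>s. \<Sum>j<k. s j *\<^sub>R x j)" for x :: "nat \<Rightarrow> 'a"
  define \<phi> where "\<phi> x = Re (\<Sum>j<k. \<eta> j (x j))" for x
  have Max_ge': "norm (v s) \<le> Max ((\<lambda>s. norm (v s)) ` Sg)" if "s \<in> Sg" for v :: "(nat \<Rightarrow> real) \<Rightarrow> 'a" and s
    using Sg that by (intro Max_ge) auto
  have Max_le': "Max ((\<lambda>s. norm (v s)) ` Sg) \<le> c" if "\<And>s. s \<in> Sg \<Longrightarrow> norm (v s) \<le> c" for v :: "(nat \<Rightarrow> real) \<Rightarrow> 'a" and c
    using Sg that by (intro Max.boundedI) auto
  have p_le: "p v \<le> B * c" if "\<And>s. s \<in> Sg \<Longrightarrow> norm (v s) \<le> c" for v c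
    unfolding p_def by (intro mult_left_mono Max_le' B that)
  have sub: "sublinear p"
  proof (rule sublinearI)
    fix u v :: "(nat \<Rightarrow> real) \<Rightarrow> 'a"
    have "p (u + v) \<le> B * (Max ((\<lambda>s. norm (u s)) ` Sg) + Max ((\<lambda>s. norm (v s)) ` Sg))"
      by (rule p_le) (auto intro: order_trans[OF norm_triangle_ineq] add_mono Max_ge')
    then show "p (u + v) \<le> p u + p v" by (simp add: p_def algebra_simps)
  next
    have "(\<lambda>s. norm ((0 :: (nat \<Rightarrow> real) \<Rightarrow> 'a) s)) ` Sg = {0}" using Sg by auto
    then show "p 0 = 0" by (simp add: p_def)
  next
    fix c :: real and v :: "(nat \<Rightarrow> real) \<Rightarrow> 'a" assume "c > 0"
    then have "p (c *\<^sub>R v) \<le> B * (c * Max ((\<lambda>s. norm (v s)) ` Sg))"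
      by (intro p_le) (auto intro: Max_ge')
    then show "p (c *\<^sub>R v) \<le> c * p v" by (simp add: p_def mult_ac)
  qed
  have linA: "linear A"
    by (intro linearI ext) (simp_all add: A_def scaleR_add_right sum.distrib scaleR_sum_right mult.commute)
  have lin\<phi>: "linear \<phi>"
    by (intro linearI) (simp_all add: \<phi>_def X'_add[OF \<eta>] X'_scaleR[OF \<eta>] sum.distrib sum_distrib_left)
  have \<phi>_le: "\<phi> x \<le> p (A x)" for x
  proof (rule field_le_epsilon)
    fix e :: real assume e: "e > 0"
    define M where "M = Max ((\<lambda>s. norm (A x s)) ` Sg)"
    have M0: "M \<ge> 0"
    proof -
      obtain s where "s \<in> Sg" using Sg by blast
      then show ?thesis using Max_ge'[of s "A x"] norm_ge_zero[of "A x s"] unfolding M_def by linarith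
    qed
    \<comment> \<open>The slack \<open>d\<close> permits division by \<open>M + d\<close> also when
      \<open>M = 0\<close>, and costs at most \<open>e\<close>.\<close>
    define d where "d = e / (B + 1)"
    have d: "d > 0" "B * d \<le> e" using e B by (auto simp: d_def field_simps)
    have "weakly_bounded k (\<lambda>j. (1 / (M + d)) *\<^sub>R x j)"
      unfolding weakly_bounded_def
    proof
      fix s assume s: "s \<in> signs {..<k}"
      have "(\<Sum>j<k. s j *\<^sub>R (1 / (M + d)) *\<^sub>R x j) = (1 / (M + d)) *\<^sub>R A x s"
        by (simp add: A_def scaleR_sum_right mult.commute)
      moreover have "norm (A x s) \<le> M" using Max_ge'[of s "A x"] s by (simp add: M_def Sg_def)
      ultimately show "norm (\<Sum>j<k. s j *\<^sub>R (1 / (M + d)) *\<^sub>R x j) \<le> 1"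
        using M0 d by simp
    qed
    from bound[OF this] have "\<phi> ((1 / (M + d)) *\<^sub>R x) \<le> B" by (simp add: \<phi>_def)
    then have "\<phi> x \<le> B * (M + d)" using M0 d by (simp add: linear_scale[OF lin\<phi>] field_simps)
    also have "\<dots> \<le> p (A x) + e" using d by (simp add: p_def M_def algebra_simps)
    finally show "\<phi> x \<le> p (A x) + e" .
  qed
  have "\<exists>F. linear F \<and> (\<forall>v. F v \<le> p v) \<and> (\<forall>x. F (A x) = \<phi> x)"
    by (rule Hahn_Banach_factor[OF sub linA lin\<phi>]) (rule \<phi>_le)
  then obtain F where F: "linear F" "\<And>v. F v \<le> p v" "\<And>x. F (A x) = \<phi> x"
    by blast
  define single where "single s x = (\<lambda>s'. if s' = s then x else 0)" for s :: "nat \<Rightarrow> real" and x :: 'a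
  define \<xi> where "\<xi> s x = F (single s x)" for s x
  have lin\<xi>: "linear (\<xi> s)" for s
  proof (rule linearI)
    have "single s (x + y) = single s x + single s y" for x y by (auto simp: single_def)
    then show "\<xi> s (x + y) = \<xi> s x + \<xi> s y" for x y by (simp add: \<xi>_def linear_add[OF F(1)])
    have "single s (c *\<^sub>R x) = c *\<^sub>R single s x" for c x by (auto simp: single_def)
    then show "\<xi> s (c *\<^sub>R x) = c *\<^sub>R \<xi> s x" for c x by (simp add: \<xi>_def linear_scale[OF F(1)])
  qed
  have \<xi>_bd: "\<xi> s x \<le> B * norm x" for s x
    unfolding \<xi>_def by (rule order_trans[OF F(2) p_le]) (simp add: single_def)
  have F_sum: "F v = (\<Sum>s\<in>Sg. \<xi> s (v s))" for v
  proof -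
    define d where "d = v - (\<Sum>s\<in>Sg. single s (v s))"
    have ds: "d s = 0" if "s \<in> Sg" for s
      using that Sg by (simp add: d_def sum_fun_apply single_def)
    have "p d \<le> B * 0" "p (- d) \<le> B * 0" by (rule p_le, simp add: ds)+
    then have "F d = 0" using F(2)[of d] F(2)[of "- d"] by (simp add: linear_neg[OF F(1)])
    then show ?thesis by (simp add: d_def linear_diff[OF F(1)] linear_sum[OF F(1)] \<xi>_def)
  qed
  define \<psi> where "\<psi> s x = complex_of_real (\<xi> s x) - \<i> * of_real (\<xi> s (smul \<i> x))" for s x
  have \<psi>: "\<psi> s \<in> carr X'" and Re\<psi>: "Re (\<psi> s x) = \<xi> s x" for s x
    using complexify_functional[OF lin\<xi> \<xi>_bd] by (auto simp: \<psi>_def[abs_def])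
  \<comment> \<open>The dual of an l_infinity-sum carries the sum of the norms: almost norming
    vectors, rotated so that the values are real, form one vector \<open>y\<close> of norm at most
    1.\<close>
  have \<psi>_sum: "(\<Sum>s\<in>Sg. vnorm X' (\<psi> s)) \<le> B"
  proof (rule field_le_epsilon)
    fix e :: real assume e: "e > 0"
    define d where "d = e / card Sg"
    have d: "d > 0" using e Sg by (simp add: d_def card_gt_0_iff)
    have "\<forall>s. \<exists>x. norm x \<le> 1 \<and> vnorm X' (\<psi> s) - d < cmod (\<psi> s x)"
      using X'_norm_approx[OF \<psi> d] by blast
    then obtain x where x: "\<And>s. norm (x s) \<le> 1" "\<And>s. vnorm X' (\<psi> s) - d < cmod (\<psi> s (x s))" by metis
    define y where "y s = smul (cnj (sgn (\<psi> s (x s)))) (x s)" for s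
    have y1: "norm (y s) \<le> 1" for s
      using x(1)[of s] by (cases "\<psi> s (x s) = 0") (auto simp: y_def norm_smul norm_sgn)
    have y2: "\<xi> s (y s) = cmod (\<psi> s (x s))" for s
    proof (cases "\<psi> s (x s) = 0")
      case False
      have "cnj (sgn (\<psi> s (x s))) * \<psi> s (x s) = (\<psi> s (x s) * cnj (\<psi> s (x s))) / of_real (cmod (\<psi> s (x s)))"
        by (simp add: sgn_eq mult.commute)
      also have "\<dots> = of_real (cmod (\<psi> s (x s)))"
        using False by (simp only: complex_norm_square[symmetric]) (simp add: power2_eq_square)
      finally show ?thesis unfolding Re\<psi>[symmetric] y_def X'_smul[OF \<psi>] by simp
    next
      case True
      then show ?thesis unfolding Re\<psi>[symmetric] y_def X'_smul[OF \<psi>] by simp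
    qed
    have "(\<Sum>s\<in>Sg. vnorm X' (\<psi> s)) \<le> (\<Sum>s\<in>Sg. \<xi> s (y s) + d)"
      unfolding y2 by (intro sum_mono) (use x(2) in \<open>simp add: less_eq_real_def algebra_simps\<close>)
    also have "\<dots> = F y + e" using Sg by (simp add: F_sum sum.distrib d_def)
    also have "F y \<le> B * 1" by (rule order_trans[OF F(2) p_le]) (rule y1)
    finally show "(\<Sum>s\<in>Sg. vnorm X' (\<psi> s)) \<le> B + e" by simp
  qed
  \<comment> \<open>All the \<open>\<eta> j\<close> are combinations, with coefficients
    \<open>s j\<close>, of the same finitely many functionals \<open>\<psi> s\<close>. The
    \<open>z j\<close> can be applied to these, and the weak l_1 norm then controls the sum over
    \<open>j\<close> for each fixed \<open>s\<close>.\<close>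
  have rep: "\<eta> j x = (\<Sum>s\<in>Sg. of_real (s j) * \<psi> s x)" if j: "j < k" for j x
  proof -
    have Re_eq: "Re (\<eta> j x) = Re (\<Sum>s\<in>Sg. of_real (s j) * \<psi> s x)" for x
    proof -
      define u where "u = (\<lambda>i. if i = j then x else 0)"
      have "\<eta> i (u i) = (if i = j then \<eta> j x else 0)" if "i < k" for i
        using X'_zero[OF \<eta>[OF that]] by (simp add: u_def)
      then have "(\<Sum>i<k. \<eta> i (u i)) = (\<Sum>i<k. if i = j then \<eta> j x else 0)" by (intro sum.cong) auto
      then have "\<phi> u = Re (\<eta> j x)" using j by (simp add: \<phi>_def)
      moreover have "A u s = s j *\<^sub>R x" for s
      proof -
        have "A u s = (\<Sum>i<k. if i = j then s j *\<^sub>R x else 0)"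
          unfolding A_def u_def by (intro sum.cong) auto
        then show ?thesis using j by simp
      qed
      then have "F (A u) = (\<Sum>s\<in>Sg. s j * \<xi> s x)"
        by (simp add: F_sum linear_scale[OF lin\<xi>])
      ultimately show ?thesis using F(3)[of u] by (simp add: Re\<psi>)
    qed
    have "Im (\<eta> j x) = - Re (\<eta> j (smul \<i> x))" by (simp add: X'_smul[OF \<eta>[OF j]])
    also have "\<dots> = - Re (\<Sum>s\<in>Sg. of_real (s j) * \<psi> s (smul \<i> x))" by (simp only: Re_eq)
    also have "\<dots> = Im (\<Sum>s\<in>Sg. of_real (s j) * \<psi> s x)"
      by (simp add: X'_smul[OF \<psi>] sum_negf[symmetric])
    finally show ?thesis using Re_eq[of x] by (simp only: complex_eq_iff)
  qed
  have "z j (\<eta> j) = (\<Sum>s\<in>Sg. of_real (s j) * z j (\<psi> s))" if j: "j < k" for j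
  proof -
    have "\<eta> j = (\<lambda>x. \<Sum>s\<in>Sg. of_real (s j) * \<psi> s x)" using rep[OF j] by (rule ext)
    then show ?thesis
      using dual_lincomb(2)[OF normed_cspace_space_of Sg(1) \<psi> z[OF j], of "\<lambda>s. of_real (s j)"] by simp
  qed
  then have "cmod (\<Sum>j<k. z j (\<eta> j)) = cmod (\<Sum>j<k. \<Sum>s\<in>Sg. of_real (s j) * z j (\<psi> s))" by simp
  also have "\<dots> \<le> (\<Sum>j<k. \<Sum>s\<in>Sg. cmod (z j (\<psi> s)))"
  proof (intro sum_norm_le)
    fix j s assume "j \<in> {..<k}" "s \<in> Sg"
    then have "s \<in> signs {..<k}" "j \<in> {..<k}" by (simp_all only: Sg_def)
    then have "s j \<in> {- 1, 1}" by (rule PiE_mem)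
    then have "\<bar>s j\<bar> = 1" by auto
    then show "cmod (of_real (s j) * z j (\<psi> s)) \<le> cmod (z j (\<psi> s))" by (simp add: norm_mult)
  qed
  also have "\<dots> = (\<Sum>s\<in>Sg. \<Sum>j<k. cmod (z j (\<psi> s)))" by (rule sum.swap)
  also have "\<dots> \<le> (\<Sum>s\<in>Sg. weak_l1 (dual X') z k * vnorm X' (\<psi> s))"
    by (intro sum_mono weak_l1_bound[OF normed_cspace_X' z \<psi>])
  also have "\<dots> = weak_l1 (dual X') z k * (\<Sum>s\<in>Sg. vnorm X' (\<psi> s))" by (simp add: sum_distrib_left)
  also have "\<dots> \<le> weak_l1 (dual X') z k * B"
    by (intro mult_left_mono \<psi>_sum weak_l1_nonneg[OF normed_cspace_X' z])
  finally show ?thesis by (simp add: mult.commute)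
qed

text \<open>The map sending \<open>z\<close> to the family of the \<open>z (f i)\<close> is
  1-summing into l_p. The l_p norms are written as \<open>z j (\<eta> j)\<close> with
  \<open>\<eta> j\<close> a combination of the \<open>f i\<close>; on tuples of X the
  \<open>\<eta> j\<close> are bounded by \<open>cotype_weak_pairing\<close>, and
  \<open>weak_functional_bidual\<close> transfers the bound.\<close>

lemma bidual_summing:
  assumes ct: "has_cotype r TYPE('a)" and r: "r \<ge> 2" and q: "q > r" and p: "p > 1" "1 / p + 1 / q = 1"
  shows "\<exists>D>0. \<forall>k N z f. (\<forall>j<k. z j \<in> carr (dual X')) \<longrightarrow> (\<forall>i<N. f i \<in> carr X') \<longrightarrow>
     (\<Sum>j<k. (\<Sum>i<(N::nat). cmod (z j (f i)) powr p) powr (1 / p))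
       \<le> D * (\<Sum>i<N. vnorm X' (f i) powr p) powr (1 / p) * weak_l1 (dual X') z k"
proof -
  obtain D where D: "D > 0" and pair: "\<And>k N x b f. weakly_bounded k x \<Longrightarrow> (\<forall>j<k. (\<Sum>i<N. cmod (b i j) powr q) \<le> 1) \<Longrightarrow>
     (\<forall>i<N. f i \<in> carr X') \<Longrightarrow>
     (\<Sum>i<(N::nat). cmod (f i (\<Sum>j<k. smul (b i j) (x j)))) \<le> D * (\<Sum>i<N. vnorm X' (f i) powr p) powr (1 / p)"
    using cotype_weak_pairing[OF ct r q p] by blast
  have q1: "q > 1" using q r by simp
  have "(\<Sum>j<k. (\<Sum>i<N. cmod (z j (f i)) powr p) powr (1 / p))
       \<le> D * (\<Sum>i<N. vnorm X' (f i) powr p) powr (1 / p) * weak_l1 (dual X') z k"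
    if z: "\<forall>j<k. z j \<in> carr (dual X')" and f: "\<forall>i<N. f i \<in> carr X'" for k N :: nat and z f
  proof -
    define B where "B = D * (\<Sum>i<N. vnorm X' (f i) powr p) powr (1 / p)"
    have "\<forall>j. \<exists>b. (\<Sum>i<N. cmod (b i) powr q) \<le> 1 \<and>
        (\<Sum>i<N. b i * z j (f i)) = of_real ((\<Sum>i<N. cmod (z j (f i)) powr p) powr (1 / p))"
      by (intro allI lq_norming_vector) (use p q1 in auto)
    then obtain b where b: "\<And>j. (\<Sum>i<N. cmod (b j i) powr q) \<le> 1"
      "\<And>j. (\<Sum>i<N. b j i * z j (f i)) = of_real ((\<Sum>i<N. cmod (z j (f i)) powr p) powr (1 / p))" by metis
    define \<eta> where "\<eta> j = (\<lambda>x. \<Sum>i<N. b j i * f i x)" for j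
    have \<eta>: "\<eta> j \<in> carr X'" for j
      unfolding \<eta>_def using f by (intro dual_lincomb(1)[OF normed_cspace_space_of]) auto
    have z\<eta>: "z j (\<eta> j) = (\<Sum>i<N. b j i * z j (f i))" if "j < k" for j
      unfolding \<eta>_def using f z that by (intro dual_lincomb(2)[OF normed_cspace_space_of]) auto
    have "cmod (\<Sum>j<k. z j (\<eta> j)) \<le> B * weak_l1 (dual X') z k"
    proof (rule weak_functional_bidual)
      show "B \<ge> 0" using D by (simp add: B_def)
      fix x assume x: "weakly_bounded k x"
      have eq: "(\<Sum>j<k. \<eta> j (x j)) = (\<Sum>i<N. f i (\<Sum>j<k. smul (b j i) (x j)))"
        unfolding \<eta>_def using f by (subst sum.swap) (simp add: X'_sum X'_smul)
      have "Re (\<Sum>j<k. \<eta> j (x j)) \<le> cmod (\<Sum>i<N. f i (\<Sum>j<k. smul (b j i) (x j)))"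
        unfolding eq by (rule complex_Re_le_cmod)
      also have "\<dots> \<le> (\<Sum>i<N. cmod (f i (\<Sum>j<k. smul (b j i) (x j))))" by (rule norm_sum)
      also have "\<dots> \<le> B" unfolding B_def using pair[OF x, where N = N and b = "\<lambda>i j. b j i" and f = f] b(1) f by auto
      finally show "Re (\<Sum>j<k. \<eta> j (x j)) \<le> B" .
    qed (use \<eta> z in auto)
    moreover have "(\<Sum>j<k. z j (\<eta> j)) = of_real (\<Sum>j<k. (\<Sum>i<N. cmod (z j (f i)) powr p) powr (1 / p))"
      using z\<eta> by (simp add: b(2))
    moreover have "(\<Sum>j<k. (\<Sum>i<N. cmod (z j (f i)) powr p) powr (1 / p)) \<ge> 0" by (intro sum_nonneg) auto
    ultimately show ?thesis by (simp only: norm_of_real B_def abs_of_nonneg)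
  qed
  with D show ?thesis by blast
qed

end

section \<open>Proof of the theorem\<close>

lemma rad_exp_reindex:
  fixes N :: nat and e :: "nat \<Rightarrow> 'i" and z :: "'i \<Rightarrow> 'b::real_vector"
  assumes e: "bij_betw e {..<N} I"
  shows "rad_exp {..<N} (\<lambda>\<epsilon>. G (\<Sum>j<N. \<epsilon> j *\<^sub>R z (e j))) = rad_exp I (\<lambda>\<epsilon>. G (\<Sum>\<alpha>\<in>I. \<epsilon> \<alpha> *\<^sub>R z \<alpha>))"
proof -
  have I: "finite I" "card I = N" using bij_betw_finite[OF e] bij_betw_same_card[OF e] by auto
  define g where "g = inv_into {..<N} e"
  have g: "\<alpha> \<in> I \<Longrightarrow> g \<alpha> \<in> {..<N} \<and> e (g \<alpha>) = \<alpha>" "j < N \<Longrightarrow> g (e j) = j \<and> e j \<in> I" for \<alpha> j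
    unfolding g_def using bij_betw_inv_into_right[OF e] bij_betw_inv_into_left[OF e] bij_betwE[OF bij_betw_inv_into[OF e]] bij_betwE[OF e]
    by auto
  have "bij_betw (\<lambda>\<epsilon>. \<lambda>j\<in>{..<N}. \<epsilon> (e j)) (signs I) (signs {..<N})"
  proof (rule bij_betw_byWitness[where f' = "\<lambda>\<delta>. \<lambda>\<alpha>\<in>I. \<delta> (g \<alpha>)"])
    show "(\<lambda>\<epsilon>. \<lambda>j\<in>{..<N}. \<epsilon> (e j)) ` signs I \<subseteq> signs {..<N}"
      unfolding image_subset_iff restrict_PiE_iff
    proof (intro ballI)
      fix \<epsilon> j assume "\<epsilon> \<in> signs I" "j \<in> {..<N}"
      then show "\<epsilon> (e j) \<in> {-1, 1}" using g(2)[of j] PiE_mem[of \<epsilon> I "\<lambda>_. {-1, 1}" "e j"] by blast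
    qed
    show "(\<lambda>\<delta>. \<lambda>\<alpha>\<in>I. \<delta> (g \<alpha>)) ` signs {..<N} \<subseteq> signs I"
      unfolding image_subset_iff restrict_PiE_iff
    proof (intro ballI)
      fix \<delta> :: "nat \<Rightarrow> real" and \<alpha> assume "\<delta> \<in> signs {..<N}" "\<alpha> \<in> I"
      then show "\<delta> (g \<alpha>) \<in> {-1, 1}" using g(1)[of \<alpha>] PiE_mem[of \<delta> "{..<N}" "\<lambda>_. {-1, 1}" "g \<alpha>"] by blast
    qed
  qed (use g in \<open>auto simp: PiE_iff extensional_def fun_eq_iff\<close>)
  from sum.reindex_bij_betw[OF this, of "\<lambda>\<epsilon>. G (\<Sum>j<N. \<epsilon> j *\<^sub>R z (e j))"]
  have "(\<Sum>\<epsilon>\<in>signs {..<N}. G (\<Sum>j<N. \<epsilon> j *\<^sub>R z (e j))) = (\<Sum>\<epsilon>\<in>signs I. G (\<Sum>j<N. (\<lambda>j\<in>{..<N}. \<epsilon> (e j)) j *\<^sub>R z (e j)))"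
    by simp
  also have "\<dots> = (\<Sum>\<epsilon>\<in>signs I. G (\<Sum>\<alpha>\<in>I. \<epsilon> \<alpha> *\<^sub>R z \<alpha>))"
  proof (intro sum.cong refl arg_cong[of _ _ G])
    fix \<epsilon> :: "'i \<Rightarrow> real"
    have "(\<Sum>j<N. (\<lambda>j\<in>{..<N}. \<epsilon> (e j)) j *\<^sub>R z (e j)) = (\<Sum>j<N. \<epsilon> (e j) *\<^sub>R z (e j))" by (intro sum.cong) auto
    also have "\<dots> = (\<Sum>\<alpha>\<in>I. \<epsilon> \<alpha> *\<^sub>R z \<alpha>)" by (rule sum.reindex_bij_betw[OF e])
    finally show "(\<Sum>j<N. (\<lambda>j\<in>{..<N}. \<epsilon> (e j)) j *\<^sub>R z (e j)) = (\<Sum>\<alpha>\<in>I. \<epsilon> \<alpha> *\<^sub>R z \<alpha>)" .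
  qed
  finally show ?thesis using I by (simp add: rad_exp_def)
qed

lemma finite_multi_idx: "finite (multi_idx n m)"
proof -
  have "multi_idx n m \<subseteq> (\<lambda>f i. if i < n then f i else 0) ` PiE {..<n} (\<lambda>_. {..m})"
  proof
    fix \<alpha> assume \<alpha>: "\<alpha> \<in> multi_idx n m"
    have "\<alpha> i \<le> m" if "i < n" for i
      using \<alpha> member_le_sum[of i "{..<n}" \<alpha>] that by (auto simp: multi_idx_def)
    then have "restrict \<alpha> {..<n} \<in> PiE {..<n} (\<lambda>_. {..m})" by auto
    moreover have "\<alpha> = (\<lambda>i. if i < n then restrict \<alpha> {..<n} i else 0)"
      using \<alpha> by (auto simp: multi_idx_def fun_eq_iff)
    ultimately show "\<alpha> \<in> (\<lambda>f i. if i < n then f i else 0) ` PiE {..<n} (\<lambda>_. {..m})" by blast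
  qed
  then show ?thesis by (rule finite_subset) (intro finite_imageI finite_PiE, auto)
qed

lemma inj_on_restrict_multi_idx: "inj_on (\<lambda>\<alpha>. restrict \<alpha> {..<n}) (multi_idx n m)"
proof (rule inj_onI)
  fix \<alpha> \<beta> assume ab: "\<alpha> \<in> multi_idx n m" "\<beta> \<in> multi_idx n m" and eq: "restrict \<alpha> {..<n} = restrict \<beta> {..<n}"
  show "\<alpha> = \<beta>"
  proof
    fix i show "\<alpha> i = \<beta> i"
      using fun_cong[OF eq, of i] ab by (cases "i < n") (auto simp: multi_idx_def)
  qed
qed

section \<open>Trace duality and finitely many norming functionals\<close>

context complex_structured
begin

text \<open>Provides the hypothesis of \<open>measurable_Lipschitz_coordinates\<close>, and thereby
  measurability of the norm of a Gaussian sum in the dual.\<close>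

lemma X'_norm_lincomb_Lipschitz:
  fixes n :: nat
  assumes y: "\<And>k. k < n \<Longrightarrow> y k \<in> carr X'"
  shows "\<bar>vnorm X' (\<lambda>b. \<Sum>k<n. u k * y k b) - vnorm X' (\<lambda>b. \<Sum>k<n. v k * y k b)\<bar>
    \<le> (\<Sum>k<n. vnorm X' (y k) * cmod (u k - v k))"
proof -
  have one: "vnorm X' (\<lambda>b. \<Sum>k<n. u k * y k b) \<le> vnorm X' (\<lambda>b. \<Sum>k<n. v k * y k b) + (\<Sum>k<n. vnorm X' (y k) * cmod (u k - v k))"
    for u v :: "nat \<Rightarrow> complex"
  proof (rule X'_norm_le)
    fix x :: 'a assume x: "norm x \<le> 1"
    have bd: "cmod (f x) \<le> vnorm X' f" if f: "f \<in> carr X'" for f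
      using X'_bound[OF f, of x] mult_left_mono[OF x dual_norm_nonneg[OF normed_cspace_space_of f]] by simp
    have v: "(\<lambda>b. \<Sum>k<n. v k * y k b) \<in> carr X'"
      by (rule dual_lincomb(1)[OF normed_cspace_space_of]) (use y in auto)
    have "(\<Sum>k<n. u k * y k x) = (\<Sum>k<n. v k * y k x) + (\<Sum>k<n. (u k - v k) * y k x)"
      by (simp add: algebra_simps sum.distrib[symmetric])
    also have "cmod \<dots> \<le> cmod (\<Sum>k<n. v k * y k x) + cmod (\<Sum>k<n. (u k - v k) * y k x)" by (rule norm_triangle_ineq)
    also have "\<dots> \<le> vnorm X' (\<lambda>b. \<Sum>k<n. v k * y k b) + (\<Sum>k<n. vnorm X' (y k) * cmod (u k - v k))"
    proof (intro add_mono bd[OF v] sum_norm_le)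
      fix k assume "k \<in> {..<n}"
      then show "cmod ((u k - v k) * y k x) \<le> vnorm X' (y k) * cmod (u k - v k)"
        using mult_right_mono[OF bd[OF y[of k]], of "cmod (u k - v k)"] by (simp add: norm_mult mult.commute)
    qed
    finally show "cmod (\<Sum>k<n. u k * y k x) \<le> vnorm X' (\<lambda>b. \<Sum>k<n. v k * y k b) + (\<Sum>k<n. vnorm X' (y k) * cmod (u k - v k))" .
  qed
  from one[of u v] one[of v u] show ?thesis by (simp add: norm_minus_commute)
qed

text \<open>The Bochner integral of a non-integrable function is 0, so integrability must be known
  before Hoelder's inequality can involve the integral from \<open>has_GAP\<close>.\<close>

lemma dual_gaussian_square_integrable:
  assumes y: "\<And>k. k < n \<Longrightarrow> y k \<in> carr X'"
  shows "integrable (gauss_prod n) (\<lambda>\<gamma>. (vnorm X' (\<lambda>b. \<Sum>k<n. \<gamma> k * y k b))\<^sup>2)"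
proof (rule Bochner_Integration.integrable_bound)
  show "integrable (gauss_prod n) (\<lambda>\<gamma>. (\<Sum>j<n. (vnorm X' (y j))\<^sup>2) * (\<Sum>j<n. (cmod (\<gamma> j))\<^sup>2))"
    by (intro integrable_mult_right Bochner_Integration.integrable_sum gauss_prod_square) auto
  have zero: "vnorm X' (\<lambda>b. 0) = 0"
  proof (rule antisym)
    show "vnorm X' (\<lambda>b. 0) \<le> 0" by (rule X'_norm_le) simp
    have "(\<lambda>b. \<Sum>k<n. 0 * y k b) \<in> carr X'"
      by (rule dual_lincomb(1)[OF normed_cspace_space_of]) (use y in auto)
    then show "0 \<le> vnorm X' (\<lambda>b. 0)" using dual_norm_nonneg[OF normed_cspace_space_of] by simp
  qed
  have "(vnorm X' (\<lambda>b. \<Sum>k<n. \<gamma> k * y k b))\<^sup>2 \<le> (\<Sum>j<n. vnorm X' (y j) * cmod (\<gamma> j))\<^sup>2" for \<gamma>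
    using X'_norm_lincomb_Lipschitz[where n = n and y = y and u = \<gamma> and v = "\<lambda>_. 0", OF y]
    by (subst power2_abs[symmetric]) (intro power_mono, auto simp: zero)
  from order_trans[OF this Cauchy_Schwarz_ineq_sum]
  show "AE \<gamma> in gauss_prod n. norm ((vnorm X' (\<lambda>b. \<Sum>k<n. \<gamma> k * y k b))\<^sup>2)
      \<le> norm ((\<Sum>j<n. (vnorm X' (y j))\<^sup>2) * (\<Sum>j<n. (cmod (\<gamma> j))\<^sup>2))"
    by (simp add: sum_nonneg abs_mult)
  have "(\<lambda>\<gamma>. vnorm X' (\<lambda>b. \<Sum>k<n. (\<lambda>k. \<gamma> k) k * y k b)) \<in> borel_measurable (gauss_prod n)"
    using measurable_Lipschitz_coordinates[where V = "\<lambda>u. vnorm X' (\<lambda>b. \<Sum>k<n. u k * y k b)" and g = "\<lambda>k \<gamma>. \<gamma> k",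
        OF X'_norm_lincomb_Lipschitz[where n = n and y = y, OF y] gauss_prod_component_measurable] by simp
  then show "(\<lambda>\<gamma>. (vnorm X' (\<lambda>b. \<Sum>k<n. \<gamma> k * y k b))\<^sup>2) \<in> borel_measurable (gauss_prod n)"
    by (intro borel_measurable_power) simp
qed

text \<open>Pairing the Gaussian sum of the \<open>y k\<close> with the conjugated Gaussian sum of
  the \<open>z j\<close> and integrating leaves the trace, because distinct coordinates are
  orthogonal. The pointwise norm bound and Cauchy-Schwarz separate the two factors.\<close>

lemma gaussian_trace_duality:
  assumes y: "\<And>k. k < n \<Longrightarrow> y k \<in> carr X'"
  shows "(\<integral>z. (cmod z)\<^sup>2 \<partial>cgauss) * cmod (\<Sum>j<n. y j (z j)) \<le>
    sqrt (\<integral>\<gamma>. (vnorm X' (\<lambda>b. \<Sum>k<n. \<gamma> k * y k b))\<^sup>2 \<partial>gauss_prod n)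
    * sqrt (\<integral>\<gamma>. (norm (\<Sum>j<n. smul (cnj (\<gamma> j)) (z j)))\<^sup>2 \<partial>gauss_prod n)"
proof -
  define c where "c = (\<integral>z. (cmod z)\<^sup>2 \<partial>cgauss)"
  define F where "F \<gamma> = (\<Sum>j<n. \<Sum>k<n. cnj (\<gamma> j) * \<gamma> k * y k (z j))" for \<gamma>
  define V where "V \<gamma> = vnorm X' (\<lambda>b. \<Sum>k<n. \<gamma> k * y k b)" for \<gamma>
  define W where "W \<gamma> = norm (\<Sum>j<n. smul (cnj (\<gamma> j)) (z j))" for \<gamma>
  have lc: "(\<lambda>b. \<Sum>k<n. \<gamma> k * y k b) \<in> carr X'" for \<gamma>
    by (rule dual_lincomb(1)[OF normed_cspace_space_of]) (use y in auto)
  have V0: "V \<gamma> \<ge> 0" and W0: "W \<gamma> \<ge> 0" for \<gamma>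
    using dual_norm_nonneg[OF normed_cspace_space_of lc] by (auto simp: V_def W_def)
  have le: "cmod (F \<gamma>) \<le> V \<gamma> * W \<gamma>" for \<gamma>
  proof -
    have "F \<gamma> = (\<Sum>k<n. \<gamma> k * y k (\<Sum>j<n. smul (cnj (\<gamma> j)) (z j)))"
      unfolding F_def using y by (subst sum.swap) (simp add: X'_sum X'_smul sum_distrib_left mult_ac)
    then show ?thesis unfolding V_def W_def using X'_bound[OF lc] by simp
  qed
  have V2: "integrable (gauss_prod n) (\<lambda>\<gamma>. (V \<gamma>)\<^sup>2)" unfolding V_def by (rule dual_gaussian_square_integrable[OF y])
  have W2: "integrable (gauss_prod n) (\<lambda>\<gamma>. (W \<gamma>)\<^sup>2)" unfolding W_def by (rule gaussian_square_integrable)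
  have sq: "V = (\<lambda>\<gamma>. sqrt ((V \<gamma>)\<^sup>2))" "W = (\<lambda>\<gamma>. sqrt ((W \<gamma>)\<^sup>2))" using V0 W0 by auto
  have Vm: "V \<in> borel_measurable (gauss_prod n)" and Wm: "W \<in> borel_measurable (gauss_prod n)"
    using borel_measurable_integrable[OF V2] borel_measurable_integrable[OF W2]
    by (subst sq, measurable)+
  have VW: "integrable (gauss_prod n) (\<lambda>\<gamma>. V \<gamma> * W \<gamma>)"
  proof (rule Bochner_Integration.integrable_bound)
    show "integrable (gauss_prod n) (\<lambda>\<gamma>. (V \<gamma>)\<^sup>2 + (W \<gamma>)\<^sup>2)" using V2 W2 by simp
    show "(\<lambda>\<gamma>. V \<gamma> * W \<gamma>) \<in> borel_measurable (gauss_prod n)" using Vm Wm by measurable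
    have "\<bar>a * b\<bar> \<le> a\<^sup>2 + b\<^sup>2" if "a \<ge> 0" "b \<ge> 0" for a b :: real
      using sum_squares_bound[of a b] mult_nonneg_nonneg[OF that] by simp
    then show "AE \<gamma> in gauss_prod n. norm (V \<gamma> * W \<gamma>) \<le> norm ((V \<gamma>)\<^sup>2 + (W \<gamma>)\<^sup>2)"
      using V0 W0 by simp
  qed
  have "c * cmod (\<Sum>j<n. y j (z j)) = cmod (\<integral>\<gamma>. F \<gamma> \<partial>gauss_prod n)"
    using gauss_prod_pairing(2)[of n "\<lambda>j k. y k (z j)"] cgauss_second_moment(2)
    by (simp add: F_def[symmetric] c_def norm_mult)
  also have "\<dots> \<le> (\<integral>\<gamma>. cmod (F \<gamma>) \<partial>gauss_prod n)" by (rule integral_norm_bound)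
  also have "\<dots> \<le> (\<integral>\<gamma>. V \<gamma> * W \<gamma> \<partial>gauss_prod n)"
    using gauss_prod_pairing(1)[of n "\<lambda>j k. y k (z j)"]
    by (intro integral_mono VW integrable_norm le) (simp add: F_def[symmetric])
  also have "\<dots> \<le> (\<integral>\<gamma>. V \<gamma> powr 2 \<partial>gauss_prod n) powr (1 / 2) * (\<integral>\<gamma>. W \<gamma> powr 2 \<partial>gauss_prod n) powr (1 / 2)"
    using V0 W0 V2 W2 VW by (intro integral_Holder) auto
  also have "\<dots> = sqrt (\<integral>\<gamma>. (V \<gamma>)\<^sup>2 \<partial>gauss_prod n) * sqrt (\<integral>\<gamma>. (W \<gamma>)\<^sup>2 \<partial>gauss_prod n)"
    using V0 W0 by (simp add: powr_half_sqrt integral_nonneg_AE)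
  finally show ?thesis by (simp add: c_def V_def W_def)
qed

text \<open>The set contains all values of the polynomial, since monomials on the torus are
  unimodular. Its compactness reduces norming to finitely many functionals.\<close>

lemma compact_smul_combinations:
  "compact {(\<Sum>j<N. smul (u j) (x j)) | u. \<forall>j<(N::nat). cmod (u j) \<le> 1}"
proof (induction N)
  case 0
  have "{(\<Sum>j<0. smul (u j) (x j)) | u. \<forall>j<0. cmod (u j) \<le> 1} = {0}" by auto
  then show ?case by simp
next
  case (Suc N)
  have "continuous_on (cball 0 1) (\<lambda>c. smul c (x N))"
  proof -
    have "bounded_linear (\<lambda>c. smul c (x N))"
      by (rule bounded_linear_intro[where K = "norm (x N)"])
         (auto simp: smul_add_left norm_smul scaleR_conv_of_real smul_mult smul_of_real)
    then show ?thesis by (rule linear_continuous_on)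
  qed
  then have "compact ((\<lambda>c. smul c (x N)) ` cball 0 1)" by (intro compact_continuous_image compact_cball)
  from compact_sums[OF Suc.IH this]
  have "compact {a + b |a b. a \<in> {(\<Sum>j<N. smul (u j) (x j)) | u. \<forall>j<N. cmod (u j) \<le> 1} \<and> b \<in> (\<lambda>c. smul c (x N)) ` cball 0 1}" .
  also have "{a + b |a b. a \<in> {(\<Sum>j<N. smul (u j) (x j)) | u. \<forall>j<N. cmod (u j) \<le> 1} \<and> b \<in> (\<lambda>c. smul c (x N)) ` cball 0 1}
     = {(\<Sum>j<Suc N. smul (u j) (x j)) | u. \<forall>j<Suc N. cmod (u j) \<le> 1}" (is "?L = ?R")
  proof
    show "?L \<subseteq> ?R"
    proof
      fix v assume "v \<in> ?L"
      then obtain u c where u: "\<forall>j<N. cmod (u j) \<le> 1" "cmod c \<le> 1" and v: "v = (\<Sum>j<N. smul (u j) (x j)) + smul c (x N)" by auto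
      have "v = (\<Sum>j<Suc N. smul ((u(N := c)) j) (x j))" unfolding v by simp
      moreover have "\<forall>j<Suc N. cmod ((u(N := c)) j) \<le> 1" using u by (auto simp: less_Suc_eq)
      ultimately show "v \<in> ?R" by blast
    qed
    show "?R \<subseteq> ?L" by (fastforce simp: less_Suc_eq)
  qed
  finally show ?case .
qed

text \<open>Norming functionals at the centres of a finite cover by balls of radius
  \<open>e / 2\<close>: moving from the centre to \<open>v\<close> costs at most
  \<open>e / 2\<close> in the norm and \<open>e / 2\<close> in the value.\<close>

lemma finite_norming_functionals:
  assumes K: "compact K" and e: "e > 0"
  shows "\<exists>L (\<phi> :: nat \<Rightarrow> 'a \<Rightarrow> complex). (\<forall>i<L. \<phi> i \<in> carr X' \<and> vnorm X' (\<phi> i) \<le> 1) \<and>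
    (\<forall>v\<in>K. \<exists>i<L. norm v - e \<le> Re (\<phi> i v))"
proof -
  obtain T where T: "T \<subseteq> K" "finite T" "K \<subseteq> (\<Union>c\<in>T. ball c (e / 2))"
    by (rule compactE_image[OF K, of K "\<lambda>c. ball c (e / 2)"]) (use e in auto)
  obtain h where h: "bij_betw h {..<card T} T" using ex_bij_betw_nat_finite[OF T(2)] by (auto simp: atLeast0LessThan)
  have "\<forall>v. \<exists>f\<in>carr X'. vnorm X' f \<le> 1 \<and> f v = of_real (norm v)" using exists_norming_functional by blast
  then obtain g where g: "\<And>v. g v \<in> carr X'" "\<And>v. vnorm X' (g v) \<le> 1" "\<And>v. g v v = of_real (norm v)" by metis
  show ?thesis
  proof (rule exI[of _ "card T"], rule exI[of _ "\<lambda>i. g (h i)"], intro conjI ballI)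
    show "\<forall>i<card T. g (h i) \<in> carr X' \<and> vnorm X' (g (h i)) \<le> 1" using g by blast
    fix v assume "v \<in> K"
    then obtain c where c: "c \<in> T" "dist c v < e / 2" using T(3) by auto
    then obtain i where i: "i < card T" "h i = c" using bij_betw_imp_surj_on[OF h] by (metis imageE lessThan_iff)
    have "g c v = g c c + g c (v - c)" using X'_add[OF g(1), of c c "v - c"] by simp
    then have "Re (g c v) = norm c + Re (g c (v - c))" by (simp add: g(3))
    moreover have "- Re (g c (v - c)) \<le> cmod (g c (v - c))" using abs_Re_le_cmod[of "g c (v - c)"] by linarith
    moreover have "cmod (g c (v - c)) \<le> norm (v - c)"
      using X'_bound[OF g(1), of c "v - c"] mult_right_mono[OF g(2)[of c] norm_ge_zero[of "v - c"]] by simp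
    moreover have "norm v \<le> norm c + norm (v - c)" using norm_triangle_ineq[of c "v - c"] by simp
    moreover have "norm (v - c) < e / 2" using c(2) by (simp add: dist_norm norm_minus_commute)
    ultimately have "norm v - e \<le> Re (g c v)" by linarith
    then show "\<exists>i<card T. norm v - e \<le> Re (g (h i) v)" using i by blast
  qed
qed

lemma norm_smul_mon_bound:
  "norm (\<Sum>j<N. smul (mon n (e j) (\<lambda>i. cis (\<theta> i))) (x j)) \<le> (\<Sum>j<N. norm (x j))"
  by (rule sum_norm_le) (simp add: norm_smul norm_mon_cis)

text \<open>The core estimate: test \<open>f\<close> against \<open>g = |f|\<^bsup>q-1\<^esup> \<phi>\<close> with a finitely valued choice of
  almost norming functionals \<open>\<phi>\<close>, and bound the pairing by trace duality and GAP.\<close>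

lemma steinhaus_core:
  fixes q r p :: real and n N :: nat and e :: "nat \<Rightarrow> nat \<Rightarrow> nat" and x :: "nat \<Rightarrow> 'a"
  assumes r: "r \<ge> 2" and q: "q > r" and p: "p > 1" "1 / p + 1 / q = 1"
    and gauss: "\<And>z :: nat \<Rightarrow> 'a. rad_norm {..<N} (\<lambda>\<epsilon>. \<Sum>j<N. \<epsilon> j *\<^sub>R z j) \<le> M \<Longrightarrow>
        (\<integral>\<gamma>. (norm (\<Sum>j<N. smul (cnj (\<gamma> j)) (z j)))\<^sup>2 \<partial>gauss_prod N) \<le> CG * M\<^sup>2"
    and gap: "\<And>y :: nat \<Rightarrow> 'a \<Rightarrow> complex. (\<And>i. i < N \<Longrightarrow> y i \<in> carr X') \<Longrightarrow>
        sqrt (\<integral>\<gamma>. (vnorm X' (\<lambda>b. \<Sum>i<N. \<gamma> i * y i b))\<^sup>2 \<partial>gauss_prod N)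
        \<le> CP * pi1 (dual X') (\<lambda>z. sqrt (\<Sum>i<N. (cmod (z (y i)))\<^sup>2))"
    and summ: "\<And>k L z f. (\<forall>j<k. z j \<in> carr (dual X')) \<Longrightarrow> (\<forall>i<L. f i \<in> carr X') \<Longrightarrow>
     (\<Sum>j<k. (\<Sum>i<(L::nat). cmod (z j (f i)) powr p) powr (1 / p))
       \<le> D * (\<Sum>i<L. vnorm X' (f i) powr p) powr (1 / p) * weak_l1 (dual X') z k"
    and const: "CG > 0" "CP > 0" "D > 0" and M: "M > 0"
    and e: "inj_on e {..<N}" "inj_on (\<lambda>\<alpha>. restrict \<alpha> {..<n}) (e ` {..<N})"
    and rad: "rad_norm {..<N} (\<lambda>\<epsilon>. \<Sum>j<N. \<epsilon> j *\<^sub>R (sqrt (q / 2) ^ sum (e j) {..<n}) *\<^sub>R x j) \<le> M"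
    and \<epsilon>: "\<epsilon> > 0"
  defines "nf \<equiv> \<lambda>\<theta>. norm (\<Sum>j<N. smul (mon n (e j) (\<lambda>i. cis (\<theta> i))) (x j))"
    and "c \<equiv> (\<integral>z. (cmod z)\<^sup>2 \<partial>cgauss)"
  defines "S \<equiv> (\<integral>\<theta>. nf \<theta> powr q \<partial>torus n)"
  shows "c * (S - \<epsilon> * (\<Sum>j<N. norm (x j)) powr (q - 1)) \<le> CP * D * sqrt CG * M * S powr (1 / p)"
proof -
  \<comment> \<open>\<open>\<rho>\<close> enters on the dual side, for Weissler's inequality, and
    its inverse \<open>R\<close> on the side of X, as the weight of the theorem; they cancel in the
    pairing.\<close>
  define \<rho> where "\<rho> = sqrt (2 / q)"
  define R where "R = sqrt (q / 2)"
  define mo where "mo j \<theta> = mon n (e j) (\<lambda>i. cis (\<theta> i))" for j \<theta>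
  define f where "f \<theta> = (\<Sum>j<N. smul (mo j \<theta>) (x j))" for \<theta>
  define Bx where "Bx = (\<Sum>j<N. norm (x j))"
  have q2: "q \<ge> 2" "q > 1" using q r by auto
  have qp: "(q - 1) * p = q" using p q2 by (simp add: field_simps)
  have \<rho>R: "\<rho> ^ k * R ^ k = 1" for k
    using q2 by (simp add: \<rho>_def R_def power_mult_distrib[symmetric] real_sqrt_mult[symmetric])
  have nf: "nf \<theta> = norm (f \<theta>)" for \<theta> by (simp add: nf_def f_def mo_def)
  have nf0: "nf \<theta> \<ge> 0" and nfB: "nf \<theta> \<le> Bx" for \<theta>
    unfolding nf_def Bx_def by (rule norm_ge_zero, rule norm_smul_mon_bound)
  have mo1: "cmod (mo j \<theta>) = 1" for j \<theta> by (simp add: mo_def norm_mon_cis)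
  have mom[measurable]: "mo j \<in> borel_measurable (torus n)" for j
    unfolding mo_def[abs_def] by (rule measurable_torus_mon)
  have nfm[measurable]: "nf \<in> borel_measurable (torus n)"
    unfolding nf_def mo_def[symmetric] by (intro measurable_norm_smul_sum) measurable
  interpret T: prob_space "torus n" by (rule prob_space_torus)
  obtain L and \<phi> :: "nat \<Rightarrow> 'a \<Rightarrow> complex"
    where L\<phi>: "(\<forall>i<L. \<phi> i \<in> carr X' \<and> vnorm X' (\<phi> i) \<le> 1) \<and>
      (\<forall>v\<in>{(\<Sum>j<N. smul (u j) (x j)) | u. \<forall>j<N. cmod (u j) \<le> 1}. \<exists>i<L. norm v - \<epsilon> \<le> Re (\<phi> i v))"
    using finite_norming_functionals[OF compact_smul_combinations[where N = N and x = x] \<epsilon>] by (elim exE)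
  have \<phi>: "\<phi> i \<in> carr X'" "vnorm X' (\<phi> i) \<le> 1" if "i < L" for i
    using L\<phi> that by blast+
  have norming: "\<exists>i<L. norm v - \<epsilon> \<le> Re (\<phi> i v)"
    if "v \<in> {(\<Sum>j<N. smul (u j) (x j)) | u. \<forall>j<N. cmod (u j) \<le> 1}" for v
    using conjunct2[OF L\<phi>] that by (rule bspec)
  \<comment> \<open>The alternative \<open>L \<le> i\<close> makes \<open>Pr i\<close> constantly
    true beyond the given functionals, so \<open>Pr\<close> is measurable for every
    \<open>i\<close>, as the least-index construction requires.\<close>
  define Pr where "Pr i \<theta> \<longleftrightarrow> nf \<theta> - \<epsilon> \<le> Re (\<phi> i (f \<theta>)) \<or> L \<le> i" for i \<theta>
  define sel where "sel \<theta> = (LEAST i. Pr i \<theta>)" for \<theta>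
  have ex: "\<exists>i<L. nf \<theta> - \<epsilon> \<le> Re (\<phi> i (f \<theta>))" for \<theta>
    unfolding nf by (rule norming) (use mo1 in \<open>auto simp: f_def intro!: exI[of _ "\<lambda>j. mo j \<theta>"]\<close>)
  have sel: "sel \<theta> < L" "nf \<theta> - \<epsilon> \<le> Re (\<phi> (sel \<theta>) (f \<theta>))" for \<theta>
  proof -
    obtain i where i: "i < L" "nf \<theta> - \<epsilon> \<le> Re (\<phi> i (f \<theta>))" using ex by blast
    then have "Pr i \<theta>" by (simp add: Pr_def)
    then show "sel \<theta> < L" unfolding sel_def using Least_le[of "\<lambda>i. Pr i \<theta>" i] i(1) by simp
    moreover have "Pr (sel \<theta>) \<theta>" unfolding sel_def using \<open>Pr i \<theta>\<close> by (rule LeastI)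
    ultimately show "nf \<theta> - \<epsilon> \<le> Re (\<phi> (sel \<theta>) (f \<theta>))" by (simp add: Pr_def)
  qed
  have \<phi>f: "\<phi> i (f \<theta>) = (\<Sum>j<N. mo j \<theta> * \<phi> i (x j))" if "i < L" for i \<theta>
    unfolding f_def by (simp add: X'_sum[OF \<phi>(1)[OF that]] X'_smul[OF \<phi>(1)[OF that]])
  have Prm: "Measurable.pred (torus n) (Pr i)" for i
  proof (cases "i < L")
    case True
    have "Measurable.pred (torus n) (\<lambda>\<theta>. nf \<theta> - \<epsilon> \<le> Re (\<Sum>j<N. mo j \<theta> * \<phi> i (x j)))"
    proof (unfold pred_def, intro borel_measurable_le borel_measurable_diff)
      have "(\<lambda>\<theta>. \<Sum>j<N. mo j \<theta> * \<phi> i (x j)) \<in> borel_measurable (torus n)" by measurable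
      then show "(\<lambda>\<theta>. Re (\<Sum>j<N. mo j \<theta> * \<phi> i (x j))) \<in> borel_measurable (torus n)"
        by (simp only: borel_measurable_complex_iff)
    qed measurable
    then show ?thesis unfolding Pr_def[abs_def] using True by (simp add: \<phi>f)
  qed (simp add: Pr_def[abs_def])
  have selm[measurable]: "sel \<in> measurable (torus n) (count_space UNIV)"
    unfolding sel_def[abs_def] using Prm by (intro measurable_Least) auto
  \<comment> \<open>The \<open>s i\<close> have disjoint supports and g is the sum of the
    \<open>s i * \<phi> i\<close>; for fixed \<open>\<theta>\<close> every sum over \<open>i\<close>
    collapses to the index \<open>sel \<theta>\<close>.\<close>
  define s where "s i \<theta> = (if sel \<theta> = i then nf \<theta> powr (q - 1) else 0)" for i \<theta>
  have sm[measurable]: "s i \<in> borel_measurable (torus n)" for i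
    unfolding s_def[abs_def] by measurable
  have s0: "0 \<le> s i \<theta>" and sB: "s i \<theta> \<le> Bx powr (q - 1)" for i \<theta>
    using nf0 nfB q2 by (auto simp: s_def intro!: powr_mono2)
  have s_sum: "(\<Sum>i<L. of_real (s i \<theta>) * h i) = of_real (nf \<theta> powr (q - 1)) * h (sel \<theta>)" for h :: "nat \<Rightarrow> complex" and \<theta>
  proof -
    have "(\<Sum>i<L. of_real (s i \<theta>) * h i) = (\<Sum>i<L. if sel \<theta> = i then of_real (nf \<theta> powr (q - 1)) * h i else 0)"
      by (intro sum.cong) (auto simp: s_def)
    then show ?thesis using sel(1)[of \<theta>] by simp
  qed
  have sp_sum: "(\<Sum>i<L. s i \<theta> powr p * h i) = nf \<theta> powr q * h (sel \<theta>)" for h :: "nat \<Rightarrow> real" and \<theta>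
  proof -
    have "(\<Sum>i<L. s i \<theta> powr p * h i) = (\<Sum>i<L. if sel \<theta> = i then nf \<theta> powr q * h i else 0)"
      using p qp by (intro sum.cong) (auto simp: s_def powr_powr)
    then show ?thesis using sel(1)[of \<theta>] by simp
  qed
  have int_mos: "integrable (torus n) (\<lambda>\<theta>. mo j \<theta> * of_real (s i \<theta>))" for i j
  proof (rule torus_integrable_bounded)
    show "norm (mo j \<theta> * of_real (s i \<theta>)) \<le> Bx powr (q - 1)" for \<theta>
      using s0 sB by (simp add: norm_mult mo1)
  qed measurable
  define I where "I j i = (\<integral>\<theta>. mo j \<theta> * of_real (s i \<theta>) \<partial>torus n)" for j i
  \<comment> \<open>The weighted Fourier coefficient of g, expressed through the scalar integrals
    \<open>I j i\<close> so that no vector-valued integral occurs.\<close>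
  define y where "y j = (\<lambda>v. \<Sum>i<L. (of_real (\<rho> ^ sum (e j) {..<n}) * I j i) * \<phi> i v)" for j
  have y: "y j \<in> carr X'" for j
    unfolding y_def by (rule dual_lincomb(1)[OF normed_cspace_space_of]) (use \<phi> in auto)
  define zz where "zz j = (R ^ sum (e j) {..<n}) *\<^sub>R x j" for j
  define \<tau> where "\<tau> i = (\<integral>\<theta>. s i \<theta> powr p \<partial>torus n)" for i
  have int_sp: "integrable (torus n) (\<lambda>\<theta>. s i \<theta> powr p)" for i
  proof (rule torus_integrable_bounded)
    show "norm (s i \<theta> powr p) \<le> (Bx powr (q - 1)) powr p" for \<theta>
      using s0 sB p by (auto intro!: powr_mono2)
  qed measurable
  have \<tau>0: "\<tau> i \<ge> 0" for i unfolding \<tau>_def by (intro integral_nonneg_AE) auto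
  have int_nf: "integrable (torus n) (\<lambda>\<theta>. nf \<theta> powr t)" if "t \<ge> 0" for t
  proof (rule torus_integrable_bounded)
    show "norm (nf \<theta> powr t) \<le> Bx powr t" for \<theta>
      using nf0 nfB that by (auto intro!: powr_mono2)
  qed measurable
  have \<tau>_sum: "(\<Sum>i<L. \<tau> i) = S"
  proof -
    have "(\<Sum>i<L. \<tau> i) = (\<integral>\<theta>. (\<Sum>i<L. s i \<theta> powr p * 1) \<partial>torus n)"
      unfolding \<tau>_def by (subst Bochner_Integration.integral_sum) (auto simp: int_sp)
    then show ?thesis unfolding sp_sum S_def by simp
  qed
  have pairing: "S - \<epsilon> * Bx powr (q - 1) \<le> cmod (\<Sum>j<N. y j (zz j))"
  proof -
    have "(\<Sum>j<N. y j (zz j)) = (\<Sum>j<N. \<Sum>i<L. I j i * \<phi> i (x j))"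
    proof (intro sum.cong refl)
      fix j
      have "y j (zz j) = (\<Sum>i<L. (of_real (\<rho> ^ sum (e j) {..<n} * R ^ sum (e j) {..<n}) * I j i) * \<phi> i (x j))"
        unfolding y_def zz_def by (intro sum.cong refl) (simp add: X'_scaleR[OF \<phi>(1)])
      then show "y j (zz j) = (\<Sum>i<L. I j i * \<phi> i (x j))" by (simp add: \<rho>R)
    qed
    also have "\<dots> = (\<integral>\<theta>. (\<Sum>j<N. \<Sum>i<L. mo j \<theta> * of_real (s i \<theta>) * \<phi> i (x j)) \<partial>torus n)"
      unfolding I_def
      by (simp add: Bochner_Integration.integral_sum Bochner_Integration.integrable_sum integrable_mult_left int_mos
          del: of_real_mult)
    also have "\<dots> = (\<integral>\<theta>. of_real (nf \<theta> powr (q - 1)) * \<phi> (sel \<theta>) (f \<theta>) \<partial>torus n)"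
    proof (intro Bochner_Integration.integral_cong refl)
      fix \<theta>
      have "(\<Sum>j<N. \<Sum>i<L. mo j \<theta> * of_real (s i \<theta>) * \<phi> i (x j)) = (\<Sum>i<L. of_real (s i \<theta>) * \<phi> i (f \<theta>))"
        by (subst sum.swap) (simp add: \<phi>f sum_distrib_left mult_ac)
      then show "(\<Sum>j<N. \<Sum>i<L. mo j \<theta> * of_real (s i \<theta>) * \<phi> i (x j)) = of_real (nf \<theta> powr (q - 1)) * \<phi> (sel \<theta>) (f \<theta>)"
        by (simp only: s_sum)
    qed
    finally have eq: "(\<Sum>j<N. y j (zz j)) = (\<integral>\<theta>. of_real (nf \<theta> powr (q - 1)) * \<phi> (sel \<theta>) (f \<theta>) \<partial>torus n)" .
    have intG: "integrable (torus n) (\<lambda>\<theta>. of_real (nf \<theta> powr (q - 1)) * \<phi> (sel \<theta>) (f \<theta>))"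
    proof -
      have "integrable (torus n) (\<lambda>\<theta>. \<Sum>i<L. \<Sum>j<N. mo j \<theta> * of_real (s i \<theta>) * \<phi> i (x j))"
        by (intro Bochner_Integration.integrable_sum integrable_mult_left int_mos)
      also have "(\<lambda>\<theta>. \<Sum>i<L. \<Sum>j<N. mo j \<theta> * of_real (s i \<theta>) * \<phi> i (x j)) = (\<lambda>\<theta>. \<Sum>i<L. of_real (s i \<theta>) * \<phi> i (f \<theta>))"
        by (intro ext sum.cong refl) (simp add: \<phi>f sum_distrib_left mult_ac)
      finally show ?thesis by (simp only: s_sum)
    qed
    have "S - \<epsilon> * Bx powr (q - 1) = (\<integral>\<theta>. nf \<theta> powr q - \<epsilon> * Bx powr (q - 1) \<partial>torus n)"
      using int_nf[of q] q2 by (simp add: S_def T.prob_space)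
    also have "\<dots> \<le> (\<integral>\<theta>. Re (of_real (nf \<theta> powr (q - 1)) * \<phi> (sel \<theta>) (f \<theta>)) \<partial>torus n)"
    proof (rule integral_mono)
      show "integrable (torus n) (\<lambda>\<theta>. nf \<theta> powr q - \<epsilon> * Bx powr (q - 1))" using int_nf[of q] q2 by simp
      show "integrable (torus n) (\<lambda>\<theta>. Re (of_real (nf \<theta> powr (q - 1)) * \<phi> (sel \<theta>) (f \<theta>)))"
        using intG by (rule integrable_Re)
      fix \<theta>
      have "nf \<theta> powr q = nf \<theta> powr (q - 1) * nf \<theta>"
        using nf0[of \<theta>] q2 by (cases "nf \<theta> = 0") (auto simp: powr_diff)
      moreover have "nf \<theta> powr (q - 1) * (nf \<theta> - \<epsilon>) \<le> nf \<theta> powr (q - 1) * Re (\<phi> (sel \<theta>) (f \<theta>))"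
        by (intro mult_left_mono sel) simp
      moreover have "\<epsilon> * nf \<theta> powr (q - 1) \<le> \<epsilon> * Bx powr (q - 1)"
        using \<epsilon> nf0 nfB q2 by (intro mult_left_mono powr_mono2) auto
      ultimately show "nf \<theta> powr q - \<epsilon> * Bx powr (q - 1) \<le> Re (of_real (nf \<theta> powr (q - 1)) * \<phi> (sel \<theta>) (f \<theta>))"
        by (simp add: algebra_simps)
    qed
    also have "\<dots> = Re (\<Sum>j<N. y j (zz j))" unfolding eq using intG by (rule integral_Re)
    also have "\<dots> \<le> cmod (\<Sum>j<N. y j (zz j))" by (rule complex_Re_le_cmod)
    finally show ?thesis .
  qed
  \<comment> \<open>By disjointness of the supports, the L_p norm of z composed with g is the l_p
    norm of the numbers \<open>z (\<Phi> i)\<close>; this is the finite form in which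
    \<open>summ\<close> applies.\<close>
  define \<Phi> where "\<Phi> i = (\<lambda>v. of_real (\<tau> i powr (1 / p)) * \<phi> i v)" for i
  have \<Phi>: "\<Phi> i \<in> carr X'" "vnorm X' (\<Phi> i) \<le> \<tau> i powr (1 / p)" if "i < L" for i
  proof -
    have eq: "\<Phi> i = vsmul X' (of_real (\<tau> i powr (1 / p))) (\<phi> i)" by (simp add: \<Phi>_def vsmul_dual)
    show "\<Phi> i \<in> carr X'" unfolding eq using normed_cspace_X' \<phi>(1)[OF that] by (auto simp: normed_cspace_def)
    have "vnorm X' (\<Phi> i) = \<tau> i powr (1 / p) * vnorm X' (\<phi> i)"
      unfolding eq using normed_cspace_X' \<phi>(1)[OF that] by (auto simp: normed_cspace_def)
    then show "vnorm X' (\<Phi> i) \<le> \<tau> i powr (1 / p)" using \<phi>(2)[OF that] by (simp add: mult_left_le)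
  qed
  have key: "sqrt (\<Sum>j<N. (cmod (z (y j)))\<^sup>2) \<le> (\<Sum>i<L. cmod (z (\<Phi> i)) powr p) powr (1 / p)"
    if z: "z \<in> carr (dual X')" for z
  proof -
    define w where "w i = z (\<phi> i)" for i
    have zy: "z (y j) = of_real (\<rho> ^ sum (e j) {..<n}) * (\<Sum>i<L. I j i * w i)" for j
      unfolding y_def w_def
      by (subst dual_lincomb(2)[OF normed_cspace_space_of _ _ z]) (use \<phi> in \<open>auto simp: sum_distrib_left mult.assoc\<close>)
    have z\<Phi>: "cmod (z (\<Phi> i)) powr p = \<tau> i * cmod (w i) powr p" if i: "i < L" for i
    proof -
      have "z (\<Phi> i) = of_real (\<tau> i powr (1 / p)) * w i"
        using carr_dualD(2)[OF z \<phi>(1)[OF i], of "of_real (\<tau> i powr (1 / p))"] by (simp add: \<Phi>_def vsmul_dual w_def)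
      then show ?thesis using \<tau>0[of i] p by (simp add: norm_mult powr_mult powr_powr)
    qed
    define cc where "cc j = cnj (z (y j))" for j
    define Q where "Q = sqrt (\<Sum>j<N. (cmod (z (y j)))\<^sup>2)"
    \<comment> \<open>The integral of \<open>T * H\<close> is \<open>Q^2\<close>. Hoelder's
      inequality and Weissler's inequality for \<open>T\<close> bound it by \<open>Q\<close> times
      the L_p norm of \<open>H\<close>, and one factor \<open>Q\<close> cancels.\<close>
    define T where "T \<theta> = (\<Sum>j<N. cc j * of_real (\<rho> ^ sum (e j) {..<n}) * mo j \<theta>)" for \<theta>
    define H where "H \<theta> = (\<Sum>i<L. of_real (s i \<theta>) * w i)" for \<theta>
    have Tm[measurable]: "T \<in> borel_measurable (torus n)" and Hm[measurable]: "H \<in> borel_measurable (torus n)"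
      unfolding T_def[abs_def] H_def[abs_def] by measurable
    have Tb: "cmod (T \<theta>) \<le> (\<Sum>j<N. cmod (cc j * of_real (\<rho> ^ sum (e j) {..<n})))" for \<theta>
      unfolding T_def by (rule sum_norm_le) (simp add: norm_mult mo1)
    have Hb: "cmod (H \<theta>) \<le> (\<Sum>i<L. Bx powr (q - 1) * cmod (w i))" for \<theta>
      unfolding H_def by (rule sum_norm_le) (use s0 sB in \<open>simp add: norm_mult mult_right_mono\<close>)
    have Q0: "Q \<ge> 0" by (simp add: Q_def sum_nonneg)
    have Q2: "Q\<^sup>2 = (\<Sum>j<N. (cmod (z (y j)))\<^sup>2)" by (simp add: Q_def sum_nonneg)
    have "of_real (Q\<^sup>2) = (\<Sum>j<N. cc j * z (y j))"
      unfolding Q2 cc_def of_real_sum by (simp only: complex_norm_square mult.commute)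
    also have "\<dots> = (\<Sum>j<N. \<Sum>i<L. (cc j * of_real (\<rho> ^ sum (e j) {..<n})) * (I j i * w i))"
      by (simp add: zy sum_distrib_left mult.assoc)
    also have "\<dots> = (\<integral>\<theta>. (\<Sum>j<N. \<Sum>i<L. (cc j * of_real (\<rho> ^ sum (e j) {..<n})) * (mo j \<theta> * of_real (s i \<theta>) * w i)) \<partial>torus n)"
      unfolding I_def
      by (simp add: Bochner_Integration.integral_sum Bochner_Integration.integrable_sum integrable_mult_left
          integrable_mult_right int_mos del: of_real_mult of_real_power)
    also have "\<dots> = (\<integral>\<theta>. T \<theta> * H \<theta> \<partial>torus n)"
      by (intro Bochner_Integration.integral_cong refl, unfold T_def H_def sum_product, intro sum.cong refl) (simp add: mult_ac)
    finally have "Q\<^sup>2 = cmod (\<integral>\<theta>. T \<theta> * H \<theta> \<partial>torus n)"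
      by (metis abs_power2 norm_of_real)
    also have "\<dots> \<le> (\<integral>\<theta>. cmod (T \<theta> * H \<theta>) \<partial>torus n)" by (rule integral_norm_bound)
    also have "\<dots> = (\<integral>\<theta>. cmod (T \<theta>) * cmod (H \<theta>) \<partial>torus n)" by (simp add: norm_mult)
    also have "\<dots> \<le> (\<integral>\<theta>. cmod (T \<theta>) powr q \<partial>torus n) powr (1 / q) * (\<integral>\<theta>. cmod (H \<theta>) powr p \<partial>torus n) powr (1 / p)"
    proof (rule integral_Holder)
      show "1 / q + 1 / p = 1" using p by simp
      show "integrable (torus n) (\<lambda>\<theta>. cmod (T \<theta>) powr q)"
      proof (rule torus_integrable_bounded)
        show "norm (cmod (T \<theta>) powr q) \<le> (\<Sum>j<N. cmod (cc j * of_real (\<rho> ^ sum (e j) {..<n}))) powr q" for \<theta>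
          using powr_mono2[OF _ norm_ge_zero Tb, of q] q2 by simp
      qed measurable
      show "integrable (torus n) (\<lambda>\<theta>. cmod (H \<theta>) powr p)"
      proof (rule torus_integrable_bounded)
        show "norm (cmod (H \<theta>) powr p) \<le> (\<Sum>i<L. Bx powr (q - 1) * cmod (w i)) powr p" for \<theta>
          using powr_mono2[OF _ norm_ge_zero Hb, of p] p by simp
      qed measurable
      show "integrable (torus n) (\<lambda>\<theta>. cmod (T \<theta>) * cmod (H \<theta>))"
      proof (rule torus_integrable_bounded)
        show "norm (cmod (T \<theta>) * cmod (H \<theta>)) \<le> (\<Sum>j<N. cmod (cc j * of_real (\<rho> ^ sum (e j) {..<n}))) * (\<Sum>i<L. Bx powr (q - 1) * cmod (w i))" for \<theta>
          using mult_mono[OF Tb Hb] by (simp add: sum_nonneg)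
      qed measurable
    qed (use q2 p in auto)
    also have "\<dots> \<le> Q * (\<integral>\<theta>. cmod (H \<theta>) powr p \<partial>torus n) powr (1 / p)"
    proof (rule mult_right_mono)
      define ce where "ce \<alpha> = cc (inv_into {..<N} e \<alpha>)" for \<alpha>
      have ce: "ce (e j) = cc j" if "j < N" for j using inv_into_f_f[OF e(1)] that by (simp add: ce_def)
      have "(\<integral>\<theta>. cmod (T \<theta>) powr q \<partial>torus n) = (\<integral>\<theta>. cmod (\<Sum>\<alpha>\<in>e ` {..<N}. ce \<alpha> * of_real (sqrt (2 / q) ^ sum \<alpha> {..<n}) * mon n \<alpha> (\<lambda>i. cis (\<theta> i))) powr q \<partial>torus n)"
        unfolding T_def \<rho>_def mo_def by (simp add: sum.reindex[OF e(1)] ce)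
      also have "\<dots> \<le> (\<Sum>\<alpha>\<in>e ` {..<N}. (cmod (ce \<alpha>))\<^sup>2) powr (q / 2)"
        by (rule hypercontractive_torus[OF q2(1) _ e(2)]) simp
      also have "(\<Sum>\<alpha>\<in>e ` {..<N}. (cmod (ce \<alpha>))\<^sup>2) = Q\<^sup>2"
        unfolding Q2 by (simp add: sum.reindex[OF e(1)] ce cc_def)
      also have "(Q\<^sup>2) powr (q / 2) = Q powr q" using Q0 by (simp add: powr_powr flip: powr_numeral)
      finally have "(\<integral>\<theta>. cmod (T \<theta>) powr q \<partial>torus n) powr (1 / q) \<le> (Q powr q) powr (1 / q)"
        using q2 by (intro powr_mono2) (auto intro!: integral_nonneg_AE)
      then show "(\<integral>\<theta>. cmod (T \<theta>) powr q \<partial>torus n) powr (1 / q) \<le> Q" using Q0 q2 by (simp add: powr_powr)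
    qed simp
    also have "(\<integral>\<theta>. cmod (H \<theta>) powr p \<partial>torus n) = (\<Sum>i<L. cmod (z (\<Phi> i)) powr p)"
    proof -
      have "cmod (H \<theta>) powr p = (\<Sum>i<L. s i \<theta> powr p * cmod (w i) powr p)" for \<theta>
        unfolding H_def s_sum sp_sum using nf0[of \<theta>] qp p by (simp add: norm_mult powr_mult powr_powr)
      then have "(\<integral>\<theta>. cmod (H \<theta>) powr p \<partial>torus n) = (\<Sum>i<L. \<tau> i * cmod (w i) powr p)"
        unfolding \<tau>_def by (simp add: Bochner_Integration.integral_sum int_sp)
      then show ?thesis using z\<Phi> by simp
    qed
    finally have "Q * Q \<le> Q * (\<Sum>i<L. cmod (z (\<Phi> i)) powr p) powr (1 / p)" by (simp add: power2_eq_square)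
    then show ?thesis using Q0 unfolding Q_def[symmetric] by (cases "Q = 0") auto
  qed
  \<comment> \<open>\<open>pi1\<close> is the infimum of the admissible constants, so it is enough
    that this one is admissible.\<close>
  have pi: "pi1 (dual X') (\<lambda>z. sqrt (\<Sum>i<N. (cmod (z (y i)))\<^sup>2)) \<le> D * S powr (1 / p)"
    unfolding pi1_def
  proof (rule cInf_lower)
    show "D * S powr (1 / p) \<in> {C. 0 \<le> C \<and> (\<forall>k z. (\<forall>j<k. z j \<in> carr (dual X')) \<longrightarrow>
        (\<Sum>j<k. sqrt (\<Sum>i<N. (cmod (z j (y i)))\<^sup>2)) \<le> C * weak_l1 (dual X') z k)}"
    proof (intro CollectI conjI allI impI)
      show "0 \<le> D * S powr (1 / p)" using const by simp
      fix k and z :: "nat \<Rightarrow> ('a \<Rightarrow> complex) \<Rightarrow> complex" assume z: "\<forall>j<k. z j \<in> carr (dual X')"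
      have "(\<Sum>j<k. sqrt (\<Sum>i<N. (cmod (z j (y i)))\<^sup>2)) \<le> (\<Sum>j<k. (\<Sum>i<L. cmod (z j (\<Phi> i)) powr p) powr (1 / p))"
        using z by (intro sum_mono key) auto
      also have "\<dots> \<le> D * (\<Sum>i<L. vnorm X' (\<Phi> i) powr p) powr (1 / p) * weak_l1 (dual X') z k"
        using \<Phi> z by (intro summ) auto
      also have "\<dots> \<le> D * S powr (1 / p) * weak_l1 (dual X') z k"
      proof (intro mult_right_mono mult_left_mono powr_mono2)
        have "vnorm X' (\<Phi> i) powr p \<le> \<tau> i" if "i < L" for i
          using powr_mono2[OF _ dual_norm_nonneg[OF normed_cspace_space_of \<Phi>(1)[OF that]] \<Phi>(2)[OF that], of p] p \<tau>0[of i]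
          by (simp add: powr_powr)
        then show "(\<Sum>i<L. vnorm X' (\<Phi> i) powr p) \<le> S"
          unfolding \<tau>_sum[symmetric] by (intro sum_mono) auto
        show "0 \<le> weak_l1 (dual X') z k" using z by (intro weak_l1_nonneg[OF normed_cspace_X']) auto
      qed (use const p in \<open>auto intro: sum_nonneg\<close>)
      finally show "(\<Sum>j<k. sqrt (\<Sum>i<N. (cmod (z j (y i)))\<^sup>2)) \<le> D * S powr (1 / p) * weak_l1 (dual X') z k" .
    qed
  qed (auto intro: bdd_belowI[of _ 0])
  have "c * (S - \<epsilon> * Bx powr (q - 1)) \<le> c * cmod (\<Sum>j<N. y j (zz j))"
    using pairing cgauss_second_moment(2) by (intro mult_left_mono) (auto simp: c_def)
  also have "\<dots> \<le> sqrt (\<integral>\<gamma>. (vnorm X' (\<lambda>b. \<Sum>k<N. \<gamma> k * y k b))\<^sup>2 \<partial>gauss_prod N)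
    * sqrt (\<integral>\<gamma>. (norm (\<Sum>j<N. smul (cnj (\<gamma> j)) (zz j)))\<^sup>2 \<partial>gauss_prod N)"
    unfolding c_def by (rule gaussian_trace_duality[OF y])
  also have "\<dots> \<le> (CP * (D * S powr (1 / p))) * sqrt (CG * M\<^sup>2)"
  proof (intro mult_mono)
    show "sqrt (\<integral>\<gamma>. (vnorm X' (\<lambda>b. \<Sum>k<N. \<gamma> k * y k b))\<^sup>2 \<partial>gauss_prod N) \<le> CP * (D * S powr (1 / p))"
      by (rule order_trans[OF gap[OF y] mult_left_mono[OF pi]]) (use const in simp)
    show "sqrt (\<integral>\<gamma>. (norm (\<Sum>j<N. smul (cnj (\<gamma> j)) (zz j)))\<^sup>2 \<partial>gauss_prod N) \<le> sqrt (CG * M\<^sup>2)"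
      using rad by (intro real_sqrt_le_mono gauss) (simp add: zz_def R_def)
  qed (use const in \<open>auto intro!: integral_nonneg_AE\<close>)
  also have "\<dots> = CP * D * sqrt CG * M * S powr (1 / p)" using M by (simp add: real_sqrt_mult)
  finally show ?thesis by (simp add: Bx_def)
qed

end

theorem theorem3p6:
  fixes smul :: "complex \<Rightarrow> 'a::banach \<Rightarrow> 'a" and q :: real
  assumes "complex_structure smul"
    and "cotype_set TYPE('a) \<noteq> {}"
    and "has_GAP (dual (space_of smul))"
    and "q > cot TYPE('a)"
  shows "\<exists>C\<ge>1. \<forall>m n (x :: (nat \<Rightarrow> nat) \<Rightarrow> 'a).
     (steinhaus_exp n (\<lambda>w. norm (\<Sum>\<alpha>\<in>multi_idx n m. smul (mon n \<alpha> w) (x \<alpha>)) powr q)) powr (1/q)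
       \<le> C * (rad_exp (multi_idx n m) (\<lambda>\<epsilon>. (norm (\<Sum>\<alpha>\<in>multi_idx n m.
                 \<epsilon> \<alpha> *\<^sub>R (sqrt (q/2) ^ sum \<alpha> {..<n}) *\<^sub>R x \<alpha>))\<^sup>2)) powr (1/2)"
proof -
  interpret complex_structured smul by unfold_locales (rule assms(1))
  obtain r where rs: "r \<in> cotype_set TYPE('a)" "r < q"
    using cInf_lessD[OF assms(2)] assms(4) by (auto simp: cot_def)
  then have r: "r \<ge> 2" "has_cotype r TYPE('a)" by (auto simp: cotype_set_def)
  define p where "p = q / (q - 1)"
  have q: "q > 2 \<or> q > r" "q > 1" using rs r by auto
  have p: "p > 1" "1 / p + 1 / q = 1" using q by (auto simp: p_def field_simps)
  obtain CG where CG: "CG > 0" "\<And>n (z :: nat \<Rightarrow> 'a) M. M > 0 \<Longrightarrow> rad_norm {..<n} (\<lambda>\<epsilon>. \<Sum>j<n. \<epsilon> j *\<^sub>R z j) \<le> M \<Longrightarrow>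
    (\<integral>\<gamma>. (norm (\<Sum>j<n. smul (cnj (\<gamma> j)) (z j)))\<^sup>2 \<partial>gauss_prod n) \<le> CG * M\<^sup>2"
    using gaussian_le_rademacher[OF r(2,1)] by blast
  obtain CP where CP: "CP \<ge> 1" "\<And>n (y :: nat \<Rightarrow> 'a \<Rightarrow> complex). (\<And>i. i < n \<Longrightarrow> y i \<in> carr X') \<Longrightarrow>
      sqrt (\<integral>\<gamma>. (vnorm X' (\<lambda>b. \<Sum>i<n. \<gamma> i * y i b))\<^sup>2 \<partial>gauss_prod n)
        \<le> CP * pi1 (dual X') (\<lambda>z. sqrt (\<Sum>i<n. (cmod (z (y i)))\<^sup>2))"
    using assms(3) unfolding has_GAP_def by blast
  obtain D where D: "D > 0" "\<And>k L z f. (\<forall>j<k. z j \<in> carr (dual X')) \<Longrightarrow> (\<forall>i<L. f i \<in> carr X') \<Longrightarrow>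
     (\<Sum>j<k. (\<Sum>i<(L::nat). cmod (z j (f i)) powr p) powr (1 / p))
       \<le> D * (\<Sum>i<L. vnorm X' (f i) powr p) powr (1 / p) * weak_l1 (dual X') z k"
    using bidual_summing[OF r(2,1) rs(2) p] by blast
  define c where "c = (\<integral>z. (cmod z)\<^sup>2 \<partial>cgauss)"
  have c: "c > 0" unfolding c_def by (rule cgauss_second_moment(2))
  define K where "K = CP * D * sqrt CG / c"
  have K: "K > 0" using CP(1) D(1) CG(1) c by (simp add: K_def)
  have main: "(steinhaus_exp n (\<lambda>w. norm (\<Sum>\<alpha>\<in>multi_idx n m. smul (mon n \<alpha> w) (x \<alpha>)) powr q)) powr (1/q)
       \<le> K * (rad_exp (multi_idx n m) (\<lambda>\<epsilon>. (norm (\<Sum>\<alpha>\<in>multi_idx n m.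
                 \<epsilon> \<alpha> *\<^sub>R (sqrt (q/2) ^ sum \<alpha> {..<n}) *\<^sub>R x \<alpha>))\<^sup>2)) powr (1/2)"
    (is "?S powr _ \<le> K * ?R powr _") for m n and x :: "(nat \<Rightarrow> nat) \<Rightarrow> 'a"
  proof -
    define N where "N = card (multi_idx n m)"
    obtain e where e: "bij_betw e {..<N} (multi_idx n m)"
      using ex_bij_betw_nat_finite[OF finite_multi_idx[of n m]] by (auto simp: N_def atLeast0LessThan)
    have S: "?S = (\<integral>\<theta>. norm (\<Sum>j<N. smul (mon n (e j) (\<lambda>i. cis (\<theta> i))) (x (e j))) powr q \<partial>torus n)"
      unfolding steinhaus_exp_def
      by (subst sum.reindex_bij_betw[OF e, of "\<lambda>\<alpha>. smul (mon n \<alpha> (\<lambda>i. cis (\<theta> i))) (x \<alpha>)" for \<theta>]) (rule refl)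
    have R: "?R powr (1/2) = rad_norm {..<N} (\<lambda>\<epsilon>. \<Sum>j<N. \<epsilon> j *\<^sub>R (sqrt (q / 2) ^ sum (e j) {..<n}) *\<^sub>R x (e j))"
    proof -
      have "?R \<ge> 0" unfolding rad_exp_def by (intro divide_nonneg_nonneg sum_nonneg) simp_all
      then have "?R powr (1/2) = sqrt ?R" by (rule powr_half_sqrt)
      also have "\<dots> = rad_norm {..<N} (\<lambda>\<epsilon>. \<Sum>j<N. \<epsilon> j *\<^sub>R (sqrt (q / 2) ^ sum (e j) {..<n}) *\<^sub>R x (e j))"
        unfolding rad_norm_def
        by (rule arg_cong[where f = sqrt],
            rule rad_exp_reindex[OF e, where G = "\<lambda>v. (norm v)\<^sup>2" and z = "\<lambda>\<alpha>. (sqrt (q / 2) ^ sum \<alpha> {..<n}) *\<^sub>R x \<alpha>", symmetric])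
      finally show ?thesis .
    qed
    have e_inj: "inj_on e {..<N}" "inj_on (\<lambda>\<alpha>. restrict \<alpha> {..<n}) (e ` {..<N})"
      using e inj_on_restrict_multi_idx[of n m] by (auto simp: bij_betw_def)
    have S0: "?S \<ge> 0" unfolding S by (intro integral_nonneg_AE) auto
    \<comment> \<open>The Gaussian comparison takes a positive bound \<open>M\<close>, whereas the
      Rademacher average may be 0. So \<open>M\<close> is taken strictly above the average and
      lowered to it only after \<open>\<epsilon>\<close> has tended to 0.\<close>
    have bound: "?S \<le> K * M * ?S powr (1 / p)" if M: "M > ?R powr (1/2)" for M
    proof -
      define B where "B = (\<Sum>j<N. norm (x (e j))) powr (q - 1)"
      have M0: "M > 0" using M by (smt (verit) powr_ge_zero)
      have eps: "c * (?S - \<epsilon> * B) \<le> CP * D * sqrt CG * M * ?S powr (1 / p)" if \<epsilon>: "\<epsilon> > 0" for \<epsilon>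
        unfolding S B_def c_def
        by (rule steinhaus_core[OF r(1) rs(2) p _ _ _ CG(1) _ D(1) M0 e_inj _ \<epsilon>])
          (use CG(2)[OF M0] CP D(2) M R in auto)
      have "((\<lambda>\<epsilon>. c * (?S - \<epsilon> * B)) \<longlongrightarrow> c * (?S - 0 * B)) (at_right 0)" by (intro tendsto_intros)
      then have "c * (?S - 0 * B) \<le> CP * D * sqrt CG * M * ?S powr (1 / p)"
        by (rule tendsto_upperbound) (auto simp: eventually_at_filter eps)
      then show ?thesis using c by (simp add: K_def field_simps)
    qed
    have le: "?S \<le> K * ?R powr (1/2) * ?S powr (1 / p)"
    proof (rule tendsto_lowerbound)
      show "((\<lambda>M. K * M * ?S powr (1 / p)) \<longlongrightarrow> K * ?R powr (1/2) * ?S powr (1 / p)) (at_right (?R powr (1/2)))"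
        by (intro tendsto_intros)
      show "\<forall>\<^sub>F M in at_right (?R powr (1/2)). ?S \<le> K * M * ?S powr (1 / p)"
        using bound by (auto simp: eventually_at_filter)
    qed simp
    \<comment> \<open>Division by \<open>?S powr (1 / p)\<close> leaves the exponent 1 - 1/p = 1/q;
      \<open>?S = 0\<close> is treated separately.\<close>
    have "?S powr (1 / q) \<le> K * ?R powr (1/2)" if "?S > 0"
    proof (rule mult_right_le_imp_le)
      have "?S powr (1 / q) * ?S powr (1 / p) = ?S powr (1 / p + 1 / q)" by (simp only: powr_add mult.commute)
      also have "\<dots> = ?S" unfolding p(2) by (rule powr_one[OF S0])
      finally show "?S powr (1 / q) * ?S powr (1 / p) \<le> K * ?R powr (1/2) * ?S powr (1 / p)" using le by (rule ord_eq_le_trans)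
      show "0 < ?S powr (1 / p)" using that by (simp only: powr_gt_zero)
    qed
    moreover have "?S powr (1 / q) \<le> K * ?R powr (1/2)" if "?S = 0"
      unfolding that using K by simp
    ultimately show ?thesis using S0 by linarith
  qed
  show ?thesis
  proof (intro exI[of _ "max 1 K"] conjI allI)
    fix m n and x :: "(nat \<Rightarrow> nat) \<Rightarrow> 'a"
    show "(steinhaus_exp n (\<lambda>w. norm (\<Sum>\<alpha>\<in>multi_idx n m. smul (mon n \<alpha> w) (x \<alpha>)) powr q)) powr (1/q)
       \<le> max 1 K * (rad_exp (multi_idx n m) (\<lambda>\<epsilon>. (norm (\<Sum>\<alpha>\<in>multi_idx n m.
                 \<epsilon> \<alpha> *\<^sub>R (sqrt (q/2) ^ sum \<alpha> {..<n}) *\<^sub>R x \<alpha>))\<^sup>2)) powr (1/2)"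
      by (rule order_trans[OF main]) (intro mult_right_mono, auto)
  qed simp
qed

end
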